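(* Assume that for every $(t,x)\in[0,T]\times\mathbb{T}^2$ the functions $F(t,x,\cdot)$ and $G(x,\cdot)$ are convex and continuous on $[0,\infty)$. Define $$M(\phi)=0,\qquad C(\phi)=(A^*\phi,B^*\phi),\qquad \phi\in\mathcal{U},\qquad\qquad N=\mathcal{K}^{-1}\ \text{ on } \mathcal{M}\times\mathcal{W},$$ where $\mathcal{K}^{-1}$ is the inverse of the set-valued operator $\mathcal{K}$. Consider the discrete inclusion for $(\phi,\rho,w)\in\mathcal{U}\times\mathcal{M}\times\mathcal{W}$ $$(A^*\phi,B^*\phi)\in\mathcal{K}(\rho,w),\qquad A\rho+Bw=0, \tag{I}$$ and the pair of primal-dual monotone inclusions $$\text{(P)}\quad \text{find }\phi\in\mathcal{U}\text{ such that }0\in M(\phi)+C^*(N(C\phi)),$$ $$\text{(D)}\quad \text{find }(\rho,w)\in\mathcal{M}\times\mathcal{W}\text{ such that }(\rho,w)\in N(C\phi),\ -C^*(\rho,w)\in M(\phi)\text{ for some }\phi\in\mathcal{U}.$$ Then the following statements are true. 1. $M$ and $N$ are maximally monotone, and (I) is equivalent to the pair (P)-(D): $\phi$ solves (P) if and only if there is $(\rho,w)$ such that $(\phi,\rho,w)$ solves (I), and $(\rho,w)$ solves (D) if and only if there is $\phi$ such that $(\phi,\rho,w)$ solves (I). 2. The problem (P)-(D) admits at least one solution. 3. If $\nu>0$ and $F(t,x,\cdot)$, $G(x,\cdot)$ are differentiable for $\rho>0$ (with $\partial_\rho F=f$, $\partial_\rho G=g$), then (P)-(D) is equivalent to the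 discrete mean-field game system (S) given in the context: $(\phi,\rho)$ (with $\phi\in\mathcal{U}$ extended by $\phi^{N_T}_{ij}=g(x_{ij},\rho^{N_T}_{ij})$) solves (S) if and only if there is $w\in\mathcal{W}$ such that $(\rho,w)\in N(C\phi)$ and $-C^*(\rho,w)\in M(\phi)$. 4. If $\nu>0$ and $F(t,x,\cdot)$, $G(x,\cdot)$ are differentiable for $\rho>0$, and $\tau,\sigma>0$ satisfy $\tau\sigma<1/\|C\|^2$, then the algorithm (with iteration index $n\ge 0$ and arbitrary initial point in $\mathcal{U}\times\mathcal{M}\times\mathcal{W}$) $$\begin{cases}\phi^{(n+1)}=\phi^{(n)}-\tau\,(A\rho^{(n)}+Bw^{(n)}),\\ \tilde\phi^{(n+1)}=2\phi^{(n+1)}-\phi^{(n)},\\ (\rho^{(n+1)},w^{(n+1)})=(I+\sigma\mathcal{K})^{-1}\left(\rho^{(n)}+\sigma A^*\tilde\phi^{(n+1)},\,w^{(n)}+\sigma B^*\tilde\phi^{(n+1)}\right)\end{cases}$$ yields a solution of (S); that is, $(\phi^{(n)},\rho^{(n)},w^{(n)})$ converges as $n\to\infty$ to some $(\phi,\rho,w)$ such that $(\phi,\rho)$ (with $\phi$ extended by $\phi^{N_T}_{ij}=g(x_{ij},\rho^{N_T}_{ij})$) solves (S).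
   Context: **Grid and parameters.** $\mathbb{T}^2=\mathbb{R}^2/\mathbb{Z}^2$; $T>0$, $\nu\ge 0$; $h,\Delta t>0$ with $N_h=1/h\in\mathbb{N}$, $N_T=T/\Delta t\in\mathbb{N}$; $x_{ij}=(ih,jh)$, $t_k=k\Delta t$, $0\le i,j\le N_h-1$, $0\le k\le N_T$; spatial indices are taken modulo $N_h$. Fixed parameters: $\epsilon>0$, $1<\beta\le 2$, $0<\alpha\le \frac{4(\beta-1)}{\beta}$, $\beta'=\frac{\beta}{\beta-1}$. $\rho_0\ge 0$ is a probability density on $\mathbb{T}^2$ and $(\rho_0)_{ij}=\frac1{h^2}\int_{\|x-x_{ij}\|_\infty\le h/2}\rho_0(x)\,dx$, so $\sum_{i,j}(\rho_0)_{ij}=1/h^2$; the grid function is also denoted $\rho_0$. **Difference operators.** $(D_1u)_{ij}=\frac{u_{(i+1)j}-u_{ij}}h$, $(D_2u)_{ij}=\frac{u_{i(j+1)}-u_{ij}}h$, $[D_hu]_{ij}=\big((D_1u)_{ij},(D_1u)_{(i-1)j},(D_2u)_{ij},(D_2u)_{i(j-1)}\big)$, $(\Delta_hu)_{ij}=\frac{u_{(i-1)j}+u_{(i+1)j}+u_{i(j-1)}+u_{i(j+1)}-4u_{ij}}{4h^2}$, $(D_tu_{ij})^k=\frac{u^{k+1}_{ij}-u^k_{ij}}{\Delta t}$. **Spaces and linear operators** (all with Euclidean inner products). $\mathcal{M}=\mathbb{R}^{(N_T+1)\times N_h\times N_h}$ (entries $\rho^k_{ij}$, $0\le k\le N_T$),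 $\mathcal{W}=(\mathbb{R}^4)^{N_T\times N_h\times N_h}$ (entries $w^k_{ij}=(w^{k,1}_{ij},\dots,w^{k,4}_{ij})$, $0\le k\le N_T-1$), $\mathcal{U}=\mathbb{R}^{N_T\times N_h\times N_h}$ (entries $\phi^k_{ij}$, $0\le k\le N_T-1$). $A:\mathcal{M}\to\mathcal{U}$, $B:\mathcal{W}\to\mathcal{U}$ are $$(A\rho)^k_{ij}=(D_t\rho_{ij})^k-\nu(\Delta_h\rho^{k+1})_{ij},\quad (Bw)^k_{ij}=(D_1w^{k,1})_{(i-1)j}+(D_1w^{k,2})_{ij}+(D_2w^{k,3})_{i(j-1)}+(D_2w^{k,4})_{ij}.$$ $A^*,B^*$ are the adjoints; $C^*(\rho,w)=A\rho+Bw$; $\|C\|$ is the operator norm. **Hamiltonian and energy.** With $q^+=\max(q,0)$, $q^-=\max(-q,0)$, $$H_h(t,x,q_1,q_2,q_3,q_4,\eta)=\frac{((q_1^-)^2+(q_2^+)^2+(q_3^-)^2+(q_4^+)^2)^{\beta/2}}{\beta(\eta+\epsilon)^\alpha},\qquad \eta\ge 0.$$ With $K=\mathbb{R}_+\times\mathbb{R}_-\times\mathbb{R}_+\times\mathbb{R}_-$ (closed half-lines), for $\eta\ge0$, $$E_h(t,x,\rho,w,\eta)=\begin{cases}(\eta+\epsilon)^{\alpha(\beta'-1)}\frac{|w|^{\beta'}}{\beta'\rho^{\beta'-1}},&\rho>0,\ w\in K,\\0,&(\rho,w)=(0,0),\\ \infty,&\text{otherwise}\end{cases}$$ (this is the perspective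 function of the Legendre dual $L_h(t,x,v,\eta)=\sup_q(-q\cdot v-H_h(t,x,q,\eta))$). $F:[0,T]\times\mathbb{T}^2\times[0,\infty)\to\mathbb{R}$, $G:\mathbb{T}^2\times[0,\infty)\to\mathbb{R}$ are given (taken as $+\infty$ for $\rho<0$), and for $\rho,\eta\in\mathcal{M}$, $\eta\ge0$ entrywise, $w\in\mathcal{W}$, $$J(\rho,w,\eta)=\sum_{i,j}\sum_{k=0}^{N_T-1}\Big[E_h(t_k,x_{ij},\rho^{k+1}_{ij},w^k_{ij},\eta^{k+1}_{ij})+F(t_k,x_{ij},\rho^{k+1}_{ij})\Big]+\frac1{\Delta t}\sum_{i,j}G(x_{ij},\rho^{N_T}_{ij})+\mathbf{1}_{\rho^0=\rho_0},$$ where $\mathbf{1}_{\rho^0=\rho_0}$ is $0$ if $\rho^0=\rho_0$ and $+\infty$ otherwise. The set-valued operator $\mathcal{K}$ on $\mathcal{M}\times\mathcal{W}$ is $$\mathcal{K}(\rho,w)=\begin{cases}\partial_{(\rho,w)}J(\rho,w,\eta)\big|_{\eta=\rho},&\rho\ge0,\\ \emptyset,&\text{otherwise},\end{cases}$$ i.e. first take the convex subdifferential of $J(\cdot,\cdot,\eta)$ at $(\rho,w)$ with $\eta$ fixed, then set $\eta=\rho$. **Discrete mean-field game system (S).** For $0\le i,j\le N_h-1$, $0\le k\le N_T-1$: $$\begin{cases}-(D_t\phi_{ij})^k-\nu(\Delta_h\phi^k)_{ij}+H_h(t_k,x_{ij},[D_h\phi^k]_{ij},\rho^{k+1}_{ij})=f(t_k,x_{ij},\rho^{k+1}_{ij}),\\(D_t\rho_{ij})^k-\nu(\Delta_h\rho^{k+1})_{ij}-\mathcal{B}_{ij}(t_k,\phi^k,\rho^{k+1},\rho^{k+1})=0,\\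 \rho^0_{ij}=(\rho_0)_{ij},\quad\phi^{N_T}_{ij}=g(x_{ij},\rho^{N_T}_{ij}),\end{cases}$$ where, writing $P^m_{ij}=\rho_{ij}\,\partial_{q_m}H_h(t,x_{ij},[D_h\phi]_{ij},\eta_{ij})$, $$\mathcal{B}_{ij}(t,\phi,\rho,\eta)=\frac1h\Big[(P^1_{ij}-P^1_{(i-1)j})+(P^2_{(i+1)j}-P^2_{ij})+(P^3_{ij}-P^3_{i(j-1)})+(P^4_{i(j+1)}-P^4_{ij})\Big].$$ Here $f=\partial_\rho F$ and $g=\partial_\rho G$ for $\rho>0$, and (S) is understood for $\rho$ with $\rho^{k+1}_{ij}>0$ for all $0\le k\le N_T-1$ and all $i,j$. *)

theory Defs
  imports "HOL-Analysis.Analysis" "HOL-Library.Set_Algebras" "Berlekamp_Zassenhaus.Finite_Field"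
begin

section \<open>Set-valued operators on Euclidean spaces\<close>

definition sv_inverse :: "('a \<Rightarrow> 'b set) \<Rightarrow> 'b \<Rightarrow> 'a set" where
  "sv_inverse T y = {x. y \<in> T x}"

definition monotone_operator :: "('a::real_inner \<Rightarrow> 'a set) \<Rightarrow> bool" where
  "monotone_operator T \<longleftrightarrow>
     (\<forall>x y. \<forall>u \<in> T x. \<forall>v \<in> T y. 0 \<le> (x - y) \<bullet> (u - v))"

definition maximally_monotone :: "('a::real_inner \<Rightarrow> 'a set) \<Rightarrow> bool" where
  "maximally_monotone T \<longleftrightarrow> monotone_operator T \<and>
     (\<forall>S. monotone_operator S \<longrightarrow> (\<forall>x. T x \<subseteq> S x) \<longrightarrow> S = T)"

text \<open>\<open>resolvent \<sigma> T\<close> is the set-valued map \<open>(I + \<sigma> T)\<^sup>-\<^sup>1\<close>.\<close>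

definition resolvent :: "real \<Rightarrow> ('a::real_inner \<Rightarrow> 'a set) \<Rightarrow> 'a \<Rightarrow> 'a set" where
  "resolvent \<sigma> T = sv_inverse (\<lambda>x. {x + \<sigma> *\<^sub>R u | u. u \<in> T x})"

text \<open>Convex subdifferential; empty outside the effective domain.\<close>

definition subdifferential :: "('a::real_inner \<Rightarrow> ereal) \<Rightarrow> 'a \<Rightarrow> 'a set" where
  "subdifferential f x =
     {p. \<bar>f x\<bar> \<noteq> \<infinity> \<and> (\<forall>y. f x + ereal (p \<bullet> (y - x)) \<le> f y)}"


section \<open>Grids and grid functions\<close>

text \<open>
  The number of cells per direction is \<open>CARD('n)\<close> and the number of time steps is \<open>CARD('t)\<close>.
  Spatial indices live in the ring of integers modulo \<open>CARD('n)\<close>.  For time, \<open>'t mod_ring\<close> and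
  \<open>'t option mod_ring\<close> serve only as index sets \<open>{0..<CARD('t)}\<close> and \<open>{0..CARD('t)}\<close>
  (as \<open>CARD('t option) = CARD('t) + 1\<close>); no cyclic arithmetic is used on them.
\<close>

type_synonym 'n slice = "real ^ 'n mod_ring ^ 'n mod_ring"
type_synonym ('t, 'n) Mspace = "real ^ 'n mod_ring ^ 'n mod_ring ^ ('t option) mod_ring"
type_synonym ('t, 'n) Uspace = "real ^ 'n mod_ring ^ 'n mod_ring ^ 't mod_ring"
type_synonym ('t, 'n) Wspace = "(real ^ 4) ^ 'n mod_ring ^ 'n mod_ring ^ 't mod_ring"

text \<open>Cyclic neighbours. The literal \<open>1\<close> is avoided because it is unavailable for a one-cell grid.\<close>

definition up :: "'n::finite mod_ring \<Rightarrow> 'n mod_ring" where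
  "up i = i + of_int_mod_ring 1"

definition dn :: "'n::finite mod_ring \<Rightarrow> 'n mod_ring" where
  "dn i = i - of_int_mod_ring 1"

text \<open>The time levels \<open>k\<close> and \<open>k + 1\<close> (for a step \<open>k < CARD('t)\<close>) and the final level, as indices
  of the \<open>CARD('t) + 1\<close> time levels.\<close>

definition level :: "'t::finite mod_ring \<Rightarrow> ('t option) mod_ring" where
  "level k = of_int_mod_ring (to_int_mod_ring k)"

definition next_level :: "'t::finite mod_ring \<Rightarrow> ('t option) mod_ring" where
  "next_level k = of_int_mod_ring (to_int_mod_ring k + 1)"

definition final_level :: "('t::finite option) mod_ring" where
  "final_level = of_int_mod_ring (int CARD('t))"

definition grid_time :: "real \<Rightarrow> 't::finite mod_ring \<Rightarrow> real" where
  "grid_time dt k = real_of_int (to_int_mod_ring k) * dt"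

definition grid_point :: "real \<Rightarrow> 'n::finite mod_ring \<Rightarrow> 'n mod_ring \<Rightarrow> real \<times> real" where
  "grid_point h i j = (real_of_int (to_int_mod_ring i) * h, real_of_int (to_int_mod_ring j) * h)"

text \<open>Functions on the torus are functions on the plane that are 1-periodic in each variable.\<close>

definition torus_periodic :: "(real \<times> real \<Rightarrow> 'b) \<Rightarrow> bool" where
  "torus_periodic u \<longleftrightarrow> (\<forall>x. u (x + (1, 0)) = u x \<and> u (x + (0, 1)) = u x)"

definition torus_density :: "(real \<times> real \<Rightarrow> real) \<Rightarrow> bool" where
  "torus_density r \<longleftrightarrow> torus_periodic r \<and> (\<forall>x. 0 \<le> r x) \<and>
     r absolutely_integrable_on cbox (0, 0) (1, 1) \<and> integral (cbox (0, 0) (1, 1)) r = 1"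

definition cell_average :: "real \<Rightarrow> (real \<times> real \<Rightarrow> real) \<Rightarrow> 'n::finite slice" where
  "cell_average h r = (\<chi> i j. 1 / h\<^sup>2 *
     integral {x. max \<bar>fst x - fst (grid_point h i j)\<bar> \<bar>snd x - snd (grid_point h i j)\<bar> \<le> h / 2} r)"


section \<open>Difference operators\<close>

definition D1 :: "real \<Rightarrow> 'n::finite slice \<Rightarrow> 'n slice" where
  "D1 h u = (\<chi> i j. (u $ up i $ j - u $ i $ j) / h)"

definition D2 :: "real \<Rightarrow> 'n::finite slice \<Rightarrow> 'n slice" where
  "D2 h u = (\<chi> i j. (u $ i $ up j - u $ i $ j) / h)"

definition Dh :: "real \<Rightarrow> 'n::finite slice \<Rightarrow> 'n mod_ring \<Rightarrow> 'n mod_ring \<Rightarrow> real ^ 4" where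
  "Dh h u i j =
     vector [D1 h u $ i $ j, D1 h u $ dn i $ j, D2 h u $ i $ j, D2 h u $ i $ dn j]"

definition Lap :: "real \<Rightarrow> 'n::finite slice \<Rightarrow> 'n slice" where
  "Lap h u = (\<chi> i j.
     (u $ dn i $ j + u $ up i $ j + u $ i $ dn j + u $ i $ up j - 4 * u $ i $ j) / (4 * h\<^sup>2))"

definition Dt :: "real \<Rightarrow> ('t::finite, 'n::finite) Mspace \<Rightarrow> ('t, 'n) Uspace" where
  "Dt dt u = (\<chi> k i j. (u $ next_level k $ i $ j - u $ level k $ i $ j) / dt)"

definition opA :: "real \<Rightarrow> real \<Rightarrow> real \<Rightarrow> ('t::finite, 'n::finite) Mspace \<Rightarrow> ('t, 'n) Uspace" where
  "opA \<nu> h dt \<rho> = (\<chi> k i j. Dt dt \<rho> $ k $ i $ j - \<nu> * Lap h (\<rho> $ next_level k) $ i $ j)"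

definition wcomp :: "4 \<Rightarrow> (real ^ 4) ^ 'n::finite mod_ring ^ 'n mod_ring \<Rightarrow> 'n slice" where
  "wcomp m v = (\<chi> i j. v $ i $ j $ m)"

definition opB :: "real \<Rightarrow> ('t::finite, 'n::finite) Wspace \<Rightarrow> ('t, 'n) Uspace" where
  "opB h w = (\<chi> k i j.
     D1 h (wcomp 1 (w $ k)) $ dn i $ j + D1 h (wcomp 2 (w $ k)) $ i $ j +
     D2 h (wcomp 3 (w $ k)) $ i $ dn j + D2 h (wcomp 4 (w $ k)) $ i $ j)"

definition opC ::
  "real \<Rightarrow> real \<Rightarrow> real \<Rightarrow> ('t::finite, 'n::finite) Uspace \<Rightarrow> ('t, 'n) Mspace \<times> ('t, 'n) Wspace" where
  "opC \<nu> h dt \<phi> = (adjoint (opA \<nu> h dt) \<phi>, adjoint (opB h) \<phi>)"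

definition opCstar ::
  "real \<Rightarrow> real \<Rightarrow> real \<Rightarrow> ('t::finite, 'n::finite) Mspace \<times> ('t, 'n) Wspace \<Rightarrow> ('t, 'n) Uspace" where
  "opCstar \<nu> h dt z = opA \<nu> h dt (fst z) + opB h (snd z)"


section \<open>Hamiltonian and energy\<close>

text \<open>The Hamiltonian and the energy density do not depend on time and space, so these arguments are
  dropped.\<close>

definition Hh :: "real \<Rightarrow> real \<Rightarrow> real \<Rightarrow> real ^ 4 \<Rightarrow> real \<Rightarrow> real" where
  "Hh \<epsilon> \<beta> \<alpha> q \<eta> =
     ((max (- q $ 1) 0)\<^sup>2 + (max (q $ 2) 0)\<^sup>2 + (max (- q $ 3) 0)\<^sup>2 + (max (q $ 4) 0)\<^sup>2) powr (\<beta> / 2)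
       / (\<beta> * (\<eta> + \<epsilon>) powr \<alpha>)"

text \<open>Partial derivative of the Hamiltonian in the momentum component \<open>m\<close>.\<close>

definition dHh :: "real \<Rightarrow> real \<Rightarrow> real \<Rightarrow> 4 \<Rightarrow> real ^ 4 \<Rightarrow> real \<Rightarrow> real" where
  "dHh \<epsilon> \<beta> \<alpha> m q \<eta> = deriv (\<lambda>s. Hh \<epsilon> \<beta> \<alpha> (\<chi> l. if l = m then s else q $ l) \<eta>) (q $ m)"

definition Kcone :: "(real ^ 4) set" where
  "Kcone = {w. 0 \<le> w $ 1 \<and> w $ 2 \<le> 0 \<and> 0 \<le> w $ 3 \<and> w $ 4 \<le> 0}"

definition Eh :: "real \<Rightarrow> real \<Rightarrow> real \<Rightarrow> real \<Rightarrow> real ^ 4 \<Rightarrow> real \<Rightarrow> ereal" where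
  "Eh \<epsilon> \<beta> \<alpha> \<rho> w \<eta> = (let \<beta>' = \<beta> / (\<beta> - 1) in
     if \<rho> > 0 \<and> w \<in> Kcone then
       ereal ((\<eta> + \<epsilon>) powr (\<alpha> * (\<beta>' - 1)) * norm w powr \<beta>' / (\<beta>' * \<rho> powr (\<beta>' - 1)))
     else if \<rho> = 0 \<and> w = 0 then 0
     else \<infinity>)"

definition ext_nonneg :: "(real \<Rightarrow> real) \<Rightarrow> real \<Rightarrow> ereal" where
  "ext_nonneg u \<rho> = (if \<rho> < 0 then \<infinity> else ereal (u \<rho>))"

definition J ::
  "real \<Rightarrow> real \<Rightarrow> real \<Rightarrow> real \<Rightarrow> real \<Rightarrow> (real \<Rightarrow> real \<times> real \<Rightarrow> real \<Rightarrow> real) \<Rightarrow>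
   (real \<times> real \<Rightarrow> real \<Rightarrow> real) \<Rightarrow> 'n::finite slice \<Rightarrow>
   ('t::finite, 'n) Mspace \<Rightarrow> ('t, 'n) Wspace \<Rightarrow> ('t, 'n) Mspace \<Rightarrow> ereal" where
  "J h dt \<epsilon> \<beta> \<alpha> F G r0 \<rho> w \<eta> =
     (\<Sum>i\<in>UNIV. \<Sum>j\<in>UNIV. \<Sum>k\<in>UNIV.
        Eh \<epsilon> \<beta> \<alpha> (\<rho> $ next_level k $ i $ j) (w $ k $ i $ j) (\<eta> $ next_level k $ i $ j)
        + ext_nonneg (F (grid_time dt k) (grid_point h i j)) (\<rho> $ next_level k $ i $ j))
     + ereal (1 / dt) * (\<Sum>i\<in>UNIV. \<Sum>j\<in>UNIV.
         ext_nonneg (G (grid_point h i j)) (\<rho> $ final_level $ i $ j))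
     + (if \<rho> $ 0 = r0 then 0 else \<infinity>)"

text \<open>The subdifferential is taken jointly in \<open>(\<rho>, w)\<close> with \<open>\<eta>\<close> frozen at the value of \<open>\<rho>\<close> at the
  base point.\<close>

definition opK ::
  "real \<Rightarrow> real \<Rightarrow> real \<Rightarrow> real \<Rightarrow> real \<Rightarrow> (real \<Rightarrow> real \<times> real \<Rightarrow> real \<Rightarrow> real) \<Rightarrow>
   (real \<times> real \<Rightarrow> real \<Rightarrow> real) \<Rightarrow> 'n::finite slice \<Rightarrow>
   ('t::finite, 'n) Mspace \<times> ('t, 'n) Wspace \<Rightarrow> (('t, 'n) Mspace \<times> ('t, 'n) Wspace) set" where
  "opK h dt \<epsilon> \<beta> \<alpha> F G r0 = (\<lambda>(\<rho>, w).
     if \<forall>k i j. 0 \<le> \<rho> $ k $ i $ j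
     then subdifferential (\<lambda>(\<rho>', w'). J h dt \<epsilon> \<beta> \<alpha> F G r0 \<rho>' w' \<rho>) (\<rho>, w)
     else {})"

definition opM :: "('t::finite, 'n::finite) Uspace \<Rightarrow> ('t, 'n) Uspace set" where
  "opM \<phi> = {0}"

definition opN ::
  "real \<Rightarrow> real \<Rightarrow> real \<Rightarrow> real \<Rightarrow> real \<Rightarrow> (real \<Rightarrow> real \<times> real \<Rightarrow> real \<Rightarrow> real) \<Rightarrow>
   (real \<times> real \<Rightarrow> real \<Rightarrow> real) \<Rightarrow> 'n::finite slice \<Rightarrow>
   ('t::finite, 'n) Mspace \<times> ('t, 'n) Wspace \<Rightarrow> (('t, 'n) Mspace \<times> ('t, 'n) Wspace) set" where
  "opN h dt \<epsilon> \<beta> \<alpha> F G r0 = sv_inverse (opK h dt \<epsilon> \<beta> \<alpha> F G r0)"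


section \<open>Inclusions, mean-field game system and algorithm\<close>

text \<open>In the following predicates \<open>A\<close>, \<open>B\<close>, \<open>C\<close>, \<open>Cs\<close>, \<open>K\<close>, \<open>M\<close>, \<open>N\<close> are parameters, to be
  instantiated by the operators above.\<close>

definition solves_I ::
  "('m::euclidean_space \<Rightarrow> 'u::euclidean_space) \<Rightarrow> ('w::euclidean_space \<Rightarrow> 'u) \<Rightarrow>
   ('m \<times> 'w \<Rightarrow> ('m \<times> 'w) set) \<Rightarrow> 'u \<Rightarrow> 'm \<Rightarrow> 'w \<Rightarrow> bool" where
  "solves_I A B K \<phi> \<rho> w \<longleftrightarrow> (adjoint A \<phi>, adjoint B \<phi>) \<in> K (\<rho>, w) \<and> A \<rho> + B w = 0"

definition solves_P ::
  "('u::euclidean_space \<Rightarrow> 'z::euclidean_space) \<Rightarrow> ('z \<Rightarrow> 'u) \<Rightarrow>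
   ('u \<Rightarrow> 'u set) \<Rightarrow> ('z \<Rightarrow> 'z set) \<Rightarrow> 'u \<Rightarrow> bool" where
  "solves_P C Cs M N \<phi> \<longleftrightarrow> 0 \<in> M \<phi> + Cs ` N (C \<phi>)"

definition primal_dual_pair ::
  "('u::euclidean_space \<Rightarrow> 'z::euclidean_space) \<Rightarrow> ('z \<Rightarrow> 'u) \<Rightarrow>
   ('u \<Rightarrow> 'u set) \<Rightarrow> ('z \<Rightarrow> 'z set) \<Rightarrow> 'u \<Rightarrow> 'z \<Rightarrow> bool" where
  "primal_dual_pair C Cs M N \<phi> z \<longleftrightarrow> z \<in> N (C \<phi>) \<and> - Cs z \<in> M \<phi>"

definition solves_D ::
  "('u::euclidean_space \<Rightarrow> 'z::euclidean_space) \<Rightarrow> ('z \<Rightarrow> 'u) \<Rightarrow>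
   ('u \<Rightarrow> 'u set) \<Rightarrow> ('z \<Rightarrow> 'z set) \<Rightarrow> 'z \<Rightarrow> bool" where
  "solves_D C Cs M N z \<longleftrightarrow> (\<exists>\<phi>. primal_dual_pair C Cs M N \<phi> z)"

definition transport ::
  "real \<Rightarrow> real \<Rightarrow> real \<Rightarrow> real \<Rightarrow> 'n::finite slice \<Rightarrow> 'n slice \<Rightarrow> 'n slice \<Rightarrow> 'n slice" where
  "transport h \<epsilon> \<beta> \<alpha> \<phi> \<rho> \<eta> =
     (let P = (\<lambda>m i j. \<rho> $ i $ j * dHh \<epsilon> \<beta> \<alpha> m (Dh h \<phi> i j) (\<eta> $ i $ j)) in
      \<chi> i j. 1 / h *
        ((P 1 i j - P 1 (dn i) j) + (P 2 (up i) j - P 2 i j) +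
         (P 3 i j - P 3 i (dn j)) + (P 4 i (up j) - P 4 i j)))"

definition mfg_system ::
  "real \<Rightarrow> real \<Rightarrow> real \<Rightarrow> real \<Rightarrow> real \<Rightarrow> real \<Rightarrow> (real \<Rightarrow> real \<times> real \<Rightarrow> real \<Rightarrow> real) \<Rightarrow>
   (real \<times> real \<Rightarrow> real \<Rightarrow> real) \<Rightarrow> 'n::finite slice \<Rightarrow>
   ('t::finite, 'n) Mspace \<Rightarrow> ('t, 'n) Mspace \<Rightarrow> bool" where
  "mfg_system \<nu> h dt \<epsilon> \<beta> \<alpha> f g r0 \<phi> \<rho> \<longleftrightarrow>
     (\<forall>k i j. 0 < \<rho> $ next_level k $ i $ j) \<and>
     (\<forall>k i j. - Dt dt \<phi> $ k $ i $ j - \<nu> * Lap h (\<phi> $ level k) $ i $ j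
        + Hh \<epsilon> \<beta> \<alpha> (Dh h (\<phi> $ level k) i j) (\<rho> $ next_level k $ i $ j)
        = f (grid_time dt k) (grid_point h i j) (\<rho> $ next_level k $ i $ j)) \<and>
     (\<forall>k i j. Dt dt \<rho> $ k $ i $ j - \<nu> * Lap h (\<rho> $ next_level k) $ i $ j
        - transport h \<epsilon> \<beta> \<alpha> (\<phi> $ level k) (\<rho> $ next_level k) (\<rho> $ next_level k) $ i $ j = 0) \<and>
     \<rho> $ 0 = r0 \<and>
     (\<forall>i j. \<phi> $ final_level $ i $ j = g (grid_point h i j) (\<rho> $ final_level $ i $ j))"

text \<open>Extension of \<open>\<phi>\<close> to the final time level by the terminal condition.\<close>

definition extend_terminal ::
  "real \<Rightarrow> (real \<times> real \<Rightarrow> real \<Rightarrow> real) \<Rightarrow> ('t::finite, 'n::finite) Mspace \<Rightarrow>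
   ('t, 'n) Uspace \<Rightarrow> ('t, 'n) Mspace" where
  "extend_terminal h g \<rho> \<phi> = (\<chi> k i j.
     if k = final_level then g (grid_point h i j) (\<rho> $ final_level $ i $ j)
     else \<phi> $ of_int_mod_ring (to_int_mod_ring k) $ i $ j)"

text \<open>Iterates of the algorithm; equality with a singleton states that the resolvent is single-valued
  at the given point and takes the given value there.\<close>

definition pdhg_iterates ::
  "('m::euclidean_space \<Rightarrow> 'u::euclidean_space) \<Rightarrow> ('w::euclidean_space \<Rightarrow> 'u) \<Rightarrow>
   ('m \<times> 'w \<Rightarrow> ('m \<times> 'w) set) \<Rightarrow> real \<Rightarrow> real \<Rightarrow>
   (nat \<Rightarrow> 'u) \<Rightarrow> (nat \<Rightarrow> 'm) \<Rightarrow> (nat \<Rightarrow> 'w) \<Rightarrow> bool" where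
  "pdhg_iterates A B K \<tau> \<sigma> \<phi> \<rho> w \<longleftrightarrow> (\<forall>n.
     \<phi> (Suc n) = \<phi> n - \<tau> *\<^sub>R (A (\<rho> n) + B (w n)) \<and>
     (let \<phi>t = 2 *\<^sub>R \<phi> (Suc n) - \<phi> n in
      resolvent \<sigma> K (\<rho> n + \<sigma> *\<^sub>R adjoint A \<phi>t, w n + \<sigma> *\<^sub>R adjoint B \<phi>t)
        = {(\<rho> (Suc n), w (Suc n))}))"

end

theory Submission
  imports Defs
begin

text \<open>
  For fixed \<open>\<eta>\<close>, a pair \<open>(a, p)\<close> is a subgradient of the energy plus potential at \<open>(\<rho>, w)\<close> in one cell
  iff \<open>w = \<rho> \<nabla>\<theta>(p)\<close> and \<open>a + \<theta>(p)\<close> is a subgradient of the potential at \<open>\<rho>\<close>, where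
  \<open>\<theta>(p) = H (- p)\<close>; this is the equality case of Young's inequality.  Monotonicity of \<open>\<K>\<close> thereby
  reduces to that of the planar map \<open>(\<rho>, x) \<mapsto> (- x\<^sup>\<beta> / \<beta>, \<rho> x\<^sup>\<beta>\<^sup>-\<^sup>1) / (\<rho> + \<epsilon>)\<^sup>\<alpha>\<close>, and maximality to solving
  the resolvent equation cell by cell.  Solutions of the inclusion come from Brouwer's theorem on a
  truncated domain; a Slater point bounds the multiplier and conservation of mass bounds the density,
  so the truncation is inactive.  For \<open>\<nu> > 0\<close> the implicit diffusion makes the density positive,
  where potentials are differentiable.  The algorithm is a proximal point iteration in a modified
  metric, hence Fejer monotone.
\<close>

section \<open>Monotone operators and the primal-dual iteration\<close>

text \<open>Because \<eta> is replaced by \<rho> only after the subdifferential has been taken,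
  \<open>opK\<close> is not presented as the subdifferential of one function, so neither its
  maximality nor solvability can be read off from a minimisation problem; both are obtained from
  fixed points. The energy is singular at density zero, and a fixed-point map in (\<rho>, w) would
  inherit this. With the dual variable p of the flux in place of w the graph reads w = \<rho>
  \<open>vel \<rho> p\<close>, which is continuous up to \<rho> = 0. In the discrete inclusion p and
  the dual variable a of the density are linear images of \<phi>, so \<rho> and \<phi> are the only
  unknowns left. The prescribed initial slice leaves the component of a at level 0 arbitrary.
  Estimates of \<phi> may therefore use the adjoint of A at the later levels only; they close
  because this adjoint contains the terminal value zero, from which \<phi> is recovered backwards in
  time.\<close>

lemma monotone_operatorD:
  "monotone_operator T \<Longrightarrow> u \<in> T x \<Longrightarrow> v \<in> T y \<Longrightarrow> 0 \<le> (x - y) \<bullet> (u - v)"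
  unfolding monotone_operator_def by blast

section \<open>Minty's criterion and its consequences\<close>

lemma inner_le_0_imp_eq:
  fixes x y :: "'a::real_inner"
  assumes "(x - y) \<bullet> (x - y) \<le> 0"
  shows "x = y"
proof -
  have "(x - y) \<bullet> (x - y) = 0" by (rule order_antisym[OF assms inner_ge_zero])
  then show ?thesis by simp
qed

text \<open>The easy half of Minty's theorem. If \<open>S\<close> extends \<open>T\<close> and
  \<open>y\<close> is in \<open>S x\<close>, compare with the solution of
  \<open>x' + v = x + y\<close>: then \<open>y - v\<close> is the negative of \<open>x - x'\<close>,
  and monotonicity of \<open>S\<close> makes the square of \<open>x - x'\<close>
  nonpositive.\<close>

lemma maximally_monotone_if_surj:
  fixes T :: "'a::real_inner \<Rightarrow> 'a set"
  assumes mono: "monotone_operator T" and surj: "\<And>u. \<exists>x. \<exists>v\<in>T x. x + v = u"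
  shows "maximally_monotone T"
  unfolding maximally_monotone_def
proof (intro conjI allI impI mono)
  fix S assume S: "monotone_operator S" and TS: "\<forall>x. T x \<subseteq> S x"
  have "y \<in> T x" if y: "y \<in> S x" for x y
  proof -
    obtain x' v where v: "v \<in> T x'" and eq: "x' + v = x + y" using surj by blast
    have "0 \<le> (x - x') \<bullet> (y - v)"
      using monotone_operatorD[OF S y] v TS by blast
    moreover have "y - v = - (x - x')" using eq by (simp add: algebra_simps)
    ultimately have "(x - x') \<bullet> (x - x') \<le> 0" by (metis inner_minus_right neg_0_le_iff_le)
    then have "x = x'" by (simp add: inner_le_0_imp_eq)
    then show ?thesis using v eq by simp
  qed
  then show "S = T" using TS by blast
qed

text \<open>Adding the single pair (x, u) to the graph keeps it monotone, so a maximal graph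
  contains it already.\<close>

lemma maximally_monotone_mem:
  fixes T :: "'a::real_inner \<Rightarrow> 'a set"
  assumes max: "maximally_monotone T"
    and rel: "\<And>y v. v \<in> T y \<Longrightarrow> 0 \<le> (x - y) \<bullet> (u - v)"
  shows "u \<in> T x"
proof -
  define S where "S y = (if y = x then insert u (T y) else T y)" for y
  have T: "monotone_operator T" using max by (simp add: maximally_monotone_def)
  have rel': "0 \<le> (y - x) \<bullet> (v - u)" if "v \<in> T y" for y v
    using rel[OF that] by (simp add: inner_diff algebra_simps)
  have "monotone_operator S"
    unfolding monotone_operator_def S_def
    using monotone_operatorD[OF T] rel rel' by (auto split: if_splits)
  then have "S = T" using max unfolding maximally_monotone_def S_def by auto
  then show ?thesis by (metis S_def insertI1)
qed

lemma maximally_monotone_sv_inverse: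
  fixes T :: "'a::real_inner \<Rightarrow> 'a set"
  assumes "maximally_monotone T"
  shows "maximally_monotone (sv_inverse T)"
  unfolding maximally_monotone_def
proof (intro conjI allI impI)
  have T: "monotone_operator T" using assms by (simp add: maximally_monotone_def)
  show "monotone_operator (sv_inverse T)"
    unfolding monotone_operator_def sv_inverse_def mem_Collect_eq
    using monotone_operatorD[OF T] by (subst inner_commute) blast
  fix S assume S: "monotone_operator S" and TS: "\<forall>x. sv_inverse T x \<subseteq> S x"
  have "x \<in> sv_inverse T y" if "x \<in> S y" for x y
  proof -
    have "y \<in> T x"
    proof (rule maximally_monotone_mem[OF assms])
      fix x' v assume "v \<in> T x'"
      then have "x' \<in> S v" using TS by (auto simp: sv_inverse_def)
      from monotone_operatorD[OF S that this] show "0 \<le> (x - x') \<bullet> (y - v)"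
        by (simp add: inner_commute)
    qed
    then show ?thesis by (simp add: sv_inverse_def)
  qed
  then show "S = sv_inverse T" using TS by blast
qed

text \<open>The relations required by \<open>maximally_monotone_mem\<close> are closed inequalities
  and survive limits.\<close>

lemma maximally_monotone_closed:
  fixes T :: "'a::real_inner \<Rightarrow> 'a set"
  assumes "maximally_monotone T" "\<And>n. u n \<in> T (x n)" "x \<longlonglongrightarrow> x'" "u \<longlonglongrightarrow> u'"
  shows "u' \<in> T x'"
proof (rule maximally_monotone_mem[OF assms(1)])
  fix y v assume v: "v \<in> T y"
  have "(\<lambda>n. (x n - y) \<bullet> (u n - v)) \<longlonglongrightarrow> (x' - y) \<bullet> (u' - v)"
    using assms by (intro tendsto_intros)
  moreover have "0 \<le> (x n - y) \<bullet> (u n - v)" for n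
    using monotone_operatorD assms(1,2) v by (metis maximally_monotone_def)
  ultimately show "0 \<le> (x' - y) \<bullet> (u' - v)"
    using LIMSEQ_le_const by blast
qed

lemma maximally_monotone_opM: "maximally_monotone opM"
  by (rule maximally_monotone_if_surj) (auto simp: opM_def monotone_operator_def)

lemma resolvent_unique:
  fixes T :: "'a::real_inner \<Rightarrow> 'a set"
  assumes T: "monotone_operator T" and "\<sigma> > 0" and x: "x \<in> resolvent \<sigma> T u" and y: "y \<in> resolvent \<sigma> T u"
  shows "x = y"
proof -
  obtain v w where v: "v \<in> T x" "u = x + \<sigma> *\<^sub>R v" and w: "w \<in> T y" "u = y + \<sigma> *\<^sub>R w"
    using x y unfolding resolvent_def sv_inverse_def mem_Collect_eq by blast
  have eq: "x - y = - (\<sigma> *\<^sub>R (v - w))"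
    using v(2) w(2) by (simp add: algebra_simps)
  have "0 \<le> \<sigma> * ((x - y) \<bullet> (v - w))"
    using monotone_operatorD[OF T v(1) w(1)] \<open>\<sigma> > 0\<close> by simp
  also have "\<dots> = - ((x - y) \<bullet> (x - y))"
    by (subst (3) eq) simp
  finally show ?thesis by (simp add: inner_le_0_imp_eq)
qed

text \<open>The iteration is the proximal point method for the monotone operator
  \<open>(\<phi>, z) \<mapsto> (C\<^sup>* z, K z - C \<phi>)\<close> in the metric given by the quadratic form below, which the step size
  condition makes positive definite.\<close>

definition pdhg_form :: "('u::real_inner \<Rightarrow> 'z::real_inner) \<Rightarrow> real \<Rightarrow> real \<Rightarrow> 'u \<times> 'z \<Rightarrow> real" where
  "pdhg_form C \<tau> \<sigma> x =
     (fst x \<bullet> fst x) / \<tau> - 2 * (C (fst x) \<bullet> snd x) + (snd x \<bullet> snd x) / \<sigma>"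

lemma pdhg_form_coercive:
  fixes C :: "'u::euclidean_space \<Rightarrow> 'z::euclidean_space"
  assumes C: "linear C" and "\<tau> > 0" "\<sigma> > 0" and step: "\<tau> * \<sigma> < 1 / (onorm C)\<^sup>2"
  obtains \<kappa> where "\<kappa> > 0" "\<And>x. \<kappa> * (norm x)\<^sup>2 \<le> pdhg_form C \<tau> \<sigma> x"
proof
  define L where "L = onorm C"
  \<comment> \<open>Cauchy-Schwarz and the inequality of means bound twice the cross term of the
    form by \<open>\<theta>\<close> times its diagonal part; \<open>\<theta> < 1\<close> is the step
    size condition.\<close>
  define \<theta> where "\<theta> = L * sqrt (\<tau> * \<sigma>)"
  have bl: "bounded_linear C" using C by (simp add: linear_conv_bounded_linear)
  have L0: "L \<ge> 0" unfolding L_def by (rule onorm_pos_le[OF bl])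
  \<comment> \<open>In HOL \<open>1 / 0 = 0\<close>, so the step size condition itself excludes a
    vanishing operator norm.\<close>
  have Lpos: "L > 0"
  proof (rule ccontr)
    assume "\<not> L > 0"
    then have "L = 0" using L0 by simp
    then have "\<tau> * \<sigma> < 0" using step by (simp add: L_def)
    then show False using \<open>\<tau> > 0\<close> \<open>\<sigma> > 0\<close> by (simp add: mult_less_0_iff)
  qed
  have "\<theta>\<^sup>2 = L\<^sup>2 * (\<tau> * \<sigma>)"
    using \<open>\<tau> > 0\<close> \<open>\<sigma> > 0\<close> by (simp add: \<theta>_def power_mult_distrib)
  also have "\<dots> < 1" using step Lpos by (simp add: L_def field_simps)
  finally have "\<theta>\<^sup>2 < 1\<^sup>2" by simp
  then have th1: "\<theta> < 1" using power2_less_imp_less by fastforce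
  have th0: "\<theta> \<ge> 0" unfolding \<theta>_def using L0 \<open>\<tau> > 0\<close> \<open>\<sigma> > 0\<close> by simp
  define \<kappa> where "\<kappa> = (1 - \<theta>) * min (1 / \<tau>) (1 / \<sigma>)"
  show "\<kappa> > 0" using th1 \<open>\<tau> > 0\<close> \<open>\<sigma> > 0\<close> by (simp add: \<kappa>_def)
  fix x :: "'u \<times> 'z"
  define a where "a = norm (fst x)" define b where "b = norm (snd x)"
  have ab0: "a \<ge> 0" "b \<ge> 0" by (simp_all add: a_def b_def)
  have "C (fst x) \<bullet> snd x \<le> norm (C (fst x)) * norm (snd x)" by (rule norm_cauchy_schwarz)
  also have "\<dots> \<le> L * a * b"
    unfolding L_def a_def b_def by (intro mult_right_mono onorm[OF bl]) simp
  finally have i1: "C (fst x) \<bullet> snd x \<le> L * a * b" .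
  have "0 \<le> (a / sqrt \<tau> - b / sqrt \<sigma>)\<^sup>2" by simp
  also have "\<dots> = a\<^sup>2 / \<tau> + b\<^sup>2 / \<sigma> - 2 * a * b / (sqrt \<tau> * sqrt \<sigma>)"
    using \<open>\<tau> > 0\<close> \<open>\<sigma> > 0\<close> by (simp add: power2_diff power_divide)
  finally have "2 * a * b / (sqrt \<tau> * sqrt \<sigma>) \<le> a\<^sup>2 / \<tau> + b\<^sup>2 / \<sigma>" by simp
  then have "\<theta> * (2 * a * b / (sqrt \<tau> * sqrt \<sigma>)) \<le> \<theta> * (a\<^sup>2 / \<tau> + b\<^sup>2 / \<sigma>)"
    using th0 by (rule mult_left_mono)
  moreover have "\<theta> * (2 * a * b / (sqrt \<tau> * sqrt \<sigma>)) = 2 * (L * a * b)"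
    using \<open>\<tau> > 0\<close> \<open>\<sigma> > 0\<close> by (simp add: \<theta>_def real_sqrt_mult)
  ultimately have i2: "2 * (L * a * b) \<le> \<theta> * (a\<^sup>2 / \<tau> + b\<^sup>2 / \<sigma>)" by simp
  have "min (1/\<tau>) (1/\<sigma>) * (a\<^sup>2 + b\<^sup>2) \<le> a\<^sup>2 / \<tau> + b\<^sup>2 / \<sigma>"
  proof -
    have "min (1/\<tau>) (1/\<sigma>) * a\<^sup>2 \<le> 1/\<tau> * a\<^sup>2" "min (1/\<tau>) (1/\<sigma>) * b\<^sup>2 \<le> 1/\<sigma> * b\<^sup>2"
      by (intro mult_right_mono; simp)+
    then show ?thesis by (simp add: distrib_left)
  qed
  then have "\<kappa> * (a\<^sup>2 + b\<^sup>2) \<le> (1 - \<theta>) * (a\<^sup>2 / \<tau> + b\<^sup>2 / \<sigma>)"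
    unfolding \<kappa>_def mult.assoc using th1 by (intro mult_left_mono) auto
  also have "\<dots> = (a\<^sup>2 / \<tau> + b\<^sup>2 / \<sigma>) - \<theta> * (a\<^sup>2 / \<tau> + b\<^sup>2 / \<sigma>)"
    unfolding left_diff_distrib by simp
  also have "\<dots> \<le> a\<^sup>2 / \<tau> + b\<^sup>2 / \<sigma> - 2 * (C (fst x) \<bullet> snd x)"
    using i1 i2 by linarith
  also have "\<dots> = pdhg_form C \<tau> \<sigma> x"
    by (simp add: pdhg_form_def a_def b_def power2_norm_eq_inner)
  finally show "\<kappa> * (norm x)\<^sup>2 \<le> pdhg_form C \<tau> \<sigma> x"
    by (simp add: a_def b_def norm_prod_def)
qed

text \<open>Expand the form at the sum of \<open>(\<phi>1, z1) - (\<phi>', z')\<close> and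
  \<open>(\<phi>0, z0) - (\<phi>1, z1)\<close>. After the equation for \<open>\<phi>1\<close> is
  inserted, the mixed term is twice the pairing that monotonicity of \<open>K\<close> at
  \<open>z1\<close> and \<open>z'\<close> makes nonnegative. The extrapolation
  \<open>2 *\<^sub>R \<phi>1 - \<phi>0\<close> supplies the term \<open>- C c \<bullet> b\<close>
  that comes from the cross term of the metric.\<close>

lemma pdhg_fejer:
  fixes C :: "'u::euclidean_space \<Rightarrow> 'z::euclidean_space"
  assumes C: "linear C" and adj: "\<And>\<phi> z. C \<phi> \<bullet> z = \<phi> \<bullet> Cs z" and Cs: "linear Cs"
    and K: "monotone_operator K" and "\<tau> > 0" "\<sigma> > 0"
    and sol: "C \<phi>' \<in> K z'" "Cs z' = 0"
    and step1: "\<phi>1 = \<phi>0 - \<tau> *\<^sub>R Cs z0"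
    and step2: "(z0 - z1) /\<^sub>R \<sigma> + C (2 *\<^sub>R \<phi>1 - \<phi>0) \<in> K z1"
  shows "pdhg_form C \<tau> \<sigma> ((\<phi>1, z1) - (\<phi>', z')) + pdhg_form C \<tau> \<sigma> ((\<phi>0, z0) - (\<phi>1, z1))
    \<le> pdhg_form C \<tau> \<sigma> ((\<phi>0, z0) - (\<phi>', z'))"
proof -
  define a where "a = \<phi>1 - \<phi>'" define b where "b = z1 - z'"
  define c where "c = \<phi>0 - \<phi>1" define d where "d = z0 - z1"
  have Cadd: "C (x + y) = C x + C y" "C (x - y) = C x - C y" "C (r *\<^sub>R x) = r *\<^sub>R C x" for x y r
    using C by (simp_all add: linear_add linear_diff linear_scale)
  have Csadd: "Cs (x + y) = Cs x + Cs y" "Cs (x - y) = Cs x - Cs y" "Cs (r *\<^sub>R x) = r *\<^sub>R Cs x" for x y r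
    using Cs by (simp_all add: linear_add linear_diff linear_scale)
  have "0 \<le> b \<bullet> (d /\<^sub>R \<sigma> + C (2 *\<^sub>R \<phi>1 - \<phi>0) - C \<phi>')"
    unfolding b_def d_def by (rule monotone_operatorD[OF K step2 sol(1)])
  also have "C (2 *\<^sub>R \<phi>1 - \<phi>0) - C \<phi>' = C a - C c"
    unfolding a_def c_def by (simp add: Cadd scaleR_2)
  then have "b \<bullet> (d /\<^sub>R \<sigma> + C (2 *\<^sub>R \<phi>1 - \<phi>0) - C \<phi>') = (b \<bullet> d) / \<sigma> + C a \<bullet> b - C c \<bullet> b"
    by (simp add: inner_simps inner_commute divide_inverse_commute
        flip: add_diff_eq)
  finally have m: "0 \<le> (b \<bullet> d) / \<sigma> + C a \<bullet> b - C c \<bullet> b" .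
  have "c /\<^sub>R \<tau> = Cs z0" using step1 \<open>\<tau> > 0\<close> by (simp add: c_def)
  then have "(a \<bullet> c) / \<tau> = a \<bullet> Cs z0" by (simp add: divide_inverse_commute flip: inner_scaleR_right)
  also have "\<dots> = a \<bullet> Cs d + a \<bullet> Cs b"
    using sol(2) by (simp add: b_def d_def Csadd inner_simps)
  finally have e: "(a \<bullet> c) / \<tau> = C a \<bullet> d + C a \<bullet> b" by (simp add: adj)
  have x0: "(\<phi>0, z0) - (\<phi>', z') = (a + c, b + d)" "(\<phi>1, z1) - (\<phi>', z') = (a, b)"
    "(\<phi>0, z0) - (\<phi>1, z1) = (c, d)" by (simp_all add: a_def b_def c_def d_def)
  have "pdhg_form C \<tau> \<sigma> (a + c, b + d) - pdhg_form C \<tau> \<sigma> (a, b) - pdhg_form C \<tau> \<sigma> (c, d)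
      = 2 * ((a \<bullet> c) / \<tau> - C a \<bullet> d - C c \<bullet> b + (b \<bullet> d) / \<sigma>)"
    by (simp add: pdhg_form_def Cadd inner_add_left inner_add_right inner_commute add_divide_distrib)
  also have "\<dots> \<ge> 0" using m unfolding e by simp
  finally show ?thesis unfolding x0 by simp
qed

text \<open>Opial's argument: bounded iterates have a cluster point, vanishing increments and the
  closed graph make it a solution, and the Fejer inequality relative to this solution carries
  convergence from the subsequence to the whole sequence.\<close>

lemma pdhg_convergence:
  fixes C :: "'u::euclidean_space \<Rightarrow> 'z::euclidean_space"
  assumes C: "linear C" and adj: "\<And>\<phi> z. C \<phi> \<bullet> z = \<phi> \<bullet> Cs z" and Cs: "linear Cs"
    and K: "maximally_monotone K" and pos: "\<tau> > 0" "\<sigma> > 0"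
    and step: "\<tau> * \<sigma> < 1 / (onorm C)\<^sup>2"
    and sol: "C \<phi>' \<in> K z'" "Cs z' = 0"
    and step1: "\<And>n. \<phi> (Suc n) = \<phi> n - \<tau> *\<^sub>R Cs (z n)"
    and step2: "\<And>n. (z n - z (Suc n)) /\<^sub>R \<sigma> + C (2 *\<^sub>R \<phi> (Suc n) - \<phi> n) \<in> K (z (Suc n))"
  obtains \<phi>l zl where "\<phi> \<longlonglongrightarrow> \<phi>l" "z \<longlonglongrightarrow> zl" "C \<phi>l \<in> K zl" "Cs zl = 0"
proof -
  define x where "x n = (\<phi> n, z n)" for n
  define Q where "Q = pdhg_form C \<tau> \<sigma>"
  obtain \<kappa> where \<kappa>: "\<kappa> > 0" "\<And>y. \<kappa> * (norm y)\<^sup>2 \<le> Q y"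
    using pdhg_form_coercive[OF C pos step] unfolding Q_def by blast
  have Q0: "Q y \<ge> 0" for y
    using \<kappa>(2)[of y] \<kappa>(1) by (meson mult_nonneg_nonneg order_trans less_imp_le zero_le_power2)
  have mono: "monotone_operator K" using K by (simp add: maximally_monotone_def)
  \<comment> \<open>Stated for every solution, because it serves for the given one and again for the
    cluster point.\<close>
  have fejer: "Q (x (Suc n) - (\<phi>', z')) + Q (x n - x (Suc n)) \<le> Q (x n - (\<phi>', z'))"
    if "C \<phi>' \<in> K z'" "Cs z' = 0" for \<phi>' z' n
    unfolding Q_def x_def
    by (rule pdhg_fejer[OF C adj Cs mono pos that step1 step2])
  have dec: "decseq (\<lambda>n. Q (x n - (\<phi>', z')))" if "C \<phi>' \<in> K z'" "Cs z' = 0" for \<phi>' z'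
  proof (rule decseq_SucI)
    fix n
    show "Q (x (Suc n) - (\<phi>', z')) \<le> Q (x n - (\<phi>', z'))"
      using fejer[OF that, of n] Q0[of "x n - x (Suc n)"] by linarith
  qed
  have tends: "x \<longlonglongrightarrow> y" if "(\<lambda>n. Q (x n - y)) \<longlonglongrightarrow> 0" for y
  proof -
    have "(\<lambda>n. (norm (x n - y))\<^sup>2) \<longlonglongrightarrow> 0"
    proof (rule tendsto_sandwich[where f = "\<lambda>_. 0" and h = "\<lambda>n. Q (x n - y) / \<kappa>"])
      show "(\<lambda>n. Q (x n - y) / \<kappa>) \<longlonglongrightarrow> 0"
        using tendsto_divide[OF that tendsto_const, of \<kappa>] \<kappa>(1) by simp
      show "\<forall>\<^sub>F n in sequentially. (norm (x n - y))\<^sup>2 \<le> Q (x n - y) / \<kappa>"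
        using \<kappa> by (simp add: field_simps)
    qed auto
    from tendsto_real_sqrt[OF this] have "(\<lambda>n. norm (x n - y)) \<longlonglongrightarrow> 0" by simp
    then show ?thesis by (simp add: LIM_zero_cancel tendsto_norm_zero_iff)
  qed
  have "Bseq x"
  proof (rule BseqI')
    fix n
    have "\<kappa> * (norm (x n - (\<phi>', z')))\<^sup>2 \<le> Q (x n - (\<phi>', z'))" by (rule \<kappa>(2))
    also have "\<dots> \<le> Q (x 0 - (\<phi>', z'))" using dec[OF sol] by (simp add: decseq_def)
    finally have "(norm (x n - (\<phi>', z')))\<^sup>2 \<le> Q (x 0 - (\<phi>', z')) / \<kappa>"
      using \<kappa>(1) by (simp add: field_simps)
    then have "norm (x n - (\<phi>', z')) \<le> sqrt (Q (x 0 - (\<phi>', z')) / \<kappa>)"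
      by (rule real_le_rsqrt)
    then show "norm (x n) \<le> sqrt (Q (x 0 - (\<phi>', z')) / \<kappa>) + norm (\<phi>', z')"
      using norm_triangle_sub[of "x n" "(\<phi>', z')"] by linarith
  qed
  then have "bounded (range x)" by (simp add: Bseq_eq_bounded)
  then obtain l r where r: "strict_mono r" "(x \<circ> r) \<longlonglongrightarrow> l"
    using bounded_imp_convergent_subsequence by blast
  obtain \<phi>l zl where l: "l = (\<phi>l, zl)" by force
  have dQ: "(\<lambda>n. Q (x n - x (Suc n))) \<longlonglongrightarrow> 0"
  proof -
    let ?q = "\<lambda>n. Q (x n - (\<phi>', z'))"
    obtain q where q: "?q \<longlonglongrightarrow> q"
      using decseq_convergent[OF dec[OF sol], of 0] Q0 by blast
    have "(\<lambda>n. ?q n - ?q (Suc n)) \<longlonglongrightarrow> q - q"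
      by (intro tendsto_diff q LIMSEQ_Suc)
    then have q0: "(\<lambda>n. ?q n - ?q (Suc n)) \<longlonglongrightarrow> 0" by simp
    have le: "Q (x n - x (Suc n)) \<le> ?q n - ?q (Suc n)" for n
      using fejer[OF sol, of n] by linarith
    show ?thesis
      by (rule tendsto_sandwich[OF _ _ tendsto_const q0]) (use Q0 le in auto)
  qed
  have d0: "(\<lambda>n. x n - x (Suc n)) \<longlonglongrightarrow> 0"
  proof -
    have "(\<lambda>n. (norm (x n - x (Suc n)))\<^sup>2) \<longlonglongrightarrow> 0"
    proof (rule tendsto_sandwich[where f = "\<lambda>_. 0" and h = "\<lambda>n. Q (x n - x (Suc n)) / \<kappa>"])
      show "(\<lambda>n. Q (x n - x (Suc n)) / \<kappa>) \<longlonglongrightarrow> 0"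
        using tendsto_divide[OF dQ tendsto_const, of \<kappa>] \<kappa>(1) by simp
      show "\<forall>\<^sub>F n in sequentially. (norm (x n - x (Suc n)))\<^sup>2 \<le> Q (x n - x (Suc n)) / \<kappa>"
        using \<kappa> by (simp add: field_simps)
    qed auto
    from tendsto_real_sqrt[OF this] show ?thesis by (simp add: tendsto_norm_zero_iff)
  qed
  have dr: "(\<lambda>n. x (r n) - x (Suc (r n))) \<longlonglongrightarrow> 0"
    using LIMSEQ_subseq_LIMSEQ[OF d0 r(1)] by (simp add: o_def)
  have xr: "(\<lambda>n. x (r n)) \<longlonglongrightarrow> l" using r(2) by (simp add: o_def)
  have xSr: "(\<lambda>n. x (Suc (r n))) \<longlonglongrightarrow> l"
    using tendsto_diff[OF xr dr] by simp
  have lim: "(\<lambda>n. \<phi> (r n)) \<longlonglongrightarrow> \<phi>l" "(\<lambda>n. z (r n)) \<longlonglongrightarrow> zl"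
    "(\<lambda>n. \<phi> (Suc (r n))) \<longlonglongrightarrow> \<phi>l" "(\<lambda>n. z (Suc (r n))) \<longlonglongrightarrow> zl"
    using tendsto_fst[OF xr] tendsto_snd[OF xr] tendsto_fst[OF xSr] tendsto_snd[OF xSr]
    by (simp_all add: x_def l)
  have blC: "bounded_linear C" and blCs: "bounded_linear Cs"
    using C Cs by (simp_all add: linear_conv_bounded_linear)
  have "(\<lambda>n. (z (r n) - z (Suc (r n))) /\<^sub>R \<sigma> + C (2 *\<^sub>R \<phi> (Suc (r n)) - \<phi> (r n)))
      \<longlonglongrightarrow> (zl - zl) /\<^sub>R \<sigma> + C (2 *\<^sub>R \<phi>l - \<phi>l)"
    by (intro tendsto_intros bounded_linear.tendsto[OF blC] lim)
  then have u: "(\<lambda>n. (z (r n) - z (Suc (r n))) /\<^sub>R \<sigma> + C (2 *\<^sub>R \<phi> (Suc (r n)) - \<phi> (r n)))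
      \<longlonglongrightarrow> C \<phi>l"
    by (simp add: scaleR_2)
  have K1: "C \<phi>l \<in> K zl"
    by (rule maximally_monotone_closed[OF K step2 lim(4) u])
  have "(\<lambda>n. (\<phi> (r n) - \<phi> (Suc (r n))) /\<^sub>R \<tau>) \<longlonglongrightarrow> (\<phi>l - \<phi>l) /\<^sub>R \<tau>"
    by (intro tendsto_intros lim)
  moreover have "(\<phi> (r n) - \<phi> (Suc (r n))) /\<^sub>R \<tau> = Cs (z (r n))" for n
    using pos by (simp add: step1)
  moreover have "(\<lambda>n. Cs (z (r n))) \<longlonglongrightarrow> Cs zl"
    by (intro bounded_linear.tendsto[OF blCs] lim)
  ultimately have K2: "Cs zl = 0" using LIMSEQ_unique by fastforce
  have "(\<lambda>n. Q (x n - l)) \<longlonglongrightarrow> 0"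
  proof -
    obtain q where q: "(\<lambda>n. Q (x n - l)) \<longlonglongrightarrow> q"
      using decseq_convergent[OF dec[OF K1 K2], of 0] Q0 unfolding l by blast
    have "(\<lambda>n. Q (x (r n) - l)) \<longlonglongrightarrow> Q (l - l)"
      unfolding Q_def pdhg_form_def
      by (intro tendsto_intros bounded_linear.tendsto[OF blC] xr) (use pos in auto)
    moreover have "(\<lambda>n. Q (x (r n) - l)) \<longlonglongrightarrow> q"
      using LIMSEQ_subseq_LIMSEQ[OF q r(1)] by (simp add: o_def)
    ultimately have "Q (l - l) = q" by (rule LIMSEQ_unique)
    moreover have "Q (l - l) = 0" using C by (simp add: Q_def pdhg_form_def linear_0)
    ultimately show ?thesis using q by simp
  qed
  then have xl: "x \<longlonglongrightarrow> l" by (rule tends)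
  show thesis
  proof (rule that[OF _ _ K1 K2])
    show "\<phi> \<longlonglongrightarrow> \<phi>l" using tendsto_fst[OF xl] by (simp add: x_def l)
    show "z \<longlonglongrightarrow> zl" using tendsto_snd[OF xl] by (simp add: x_def l)
  qed
qed

section \<open>Convex analysis in one cell\<close>

text \<open>If \<open>u\<close> were nonzero, one could move from the interior point
  \<open>p\<close> along \<open>- u\<close> without leaving the ball, against the variational
  inequality. This is how a truncation by projection onto a ball is shown to be inactive.\<close>

lemma inward_normal_eq_0:
  fixes u p :: "'a::real_inner"
  assumes "norm p < Q" and proj: "\<And>y. norm y \<le> Q \<Longrightarrow> 0 \<le> u \<bullet> (y - p)"
  shows "u = 0"
proof (rule ccontr)
  assume nz: "u \<noteq> 0"
  define t where "t = (Q - norm p) / norm u"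
  have t: "t > 0" using assms(1) nz by (simp add: t_def)
  have "norm (p - t *\<^sub>R u) \<le> norm p + t * norm u" using norm_triangle_ineq4[of p "t *\<^sub>R u"] t by simp
  also have "\<dots> = Q" using nz by (simp add: t_def)
  finally have "0 \<le> u \<bullet> (- (t *\<^sub>R u))" using proj[of "p - t *\<^sub>R u"] by simp
  then have "u \<bullet> u \<le> 0" using t by (simp add: mult_le_0_iff)
  then show False using nz by (meson inner_gt_zero_iff not_le)
qed

text \<open>The Euclidean projection onto \<open>Kcone\<close>, written in coordinates.\<close>

definition projK :: "real ^ 4 \<Rightarrow> real ^ 4" where
  "projK p = (\<chi> m. if m = 1 \<or> m = 3 then max (p $ m) 0 else min (p $ m) 0)"

lemma projK_nth: "projK p $ m = (if m = 1 \<or> m = 3 then max (p $ m) 0 else min (p $ m) 0)"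
  by (simp add: projK_def)

lemma Kcone_iff: "w \<in> Kcone \<longleftrightarrow> (\<forall>m. if m = 1 \<or> m = 3 then 0 \<le> w $ m else w $ m \<le> 0)"
  by (auto simp: Kcone_def forall_4)

lemma projK_in_Kcone: "projK p \<in> Kcone"
  by (simp add: Kcone_iff projK_nth)

lemma scaleR_in_Kcone: "w \<in> Kcone \<Longrightarrow> 0 \<le> c \<Longrightarrow> c *\<^sub>R w \<in> Kcone"
  by (simp add: Kcone_def mult_nonneg_nonpos)

lemma inner_projK_self: "p \<bullet> projK p = (norm (projK p))\<^sup>2"
  unfolding power2_norm_eq_inner inner_vec_def
  by (intro sum.cong refl) (auto simp: projK_nth max_def min_def)

text \<open>The difference \<open>p - projK p\<close> lies in the polar cone of
  \<open>Kcone\<close>.\<close>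

lemma inner_le_projK:
  assumes "w \<in> Kcone"
  shows "p \<bullet> w \<le> projK p \<bullet> w"
  unfolding inner_vec_def
proof (rule sum_mono)
  fix m :: 4
  show "p $ m \<bullet> w $ m \<le> projK p $ m \<bullet> w $ m"
    using assms unfolding Kcone_iff
    by (cases "m = 1 \<or> m = 3")
      (auto simp: projK_nth intro: mult_right_mono mult_right_mono_neg)
qed

lemma continuous_on_projK [continuous_intros]:
  assumes "continuous_on S f"
  shows "continuous_on S (\<lambda>x. projK (f x))"
  unfolding projK_def
proof (rule continuous_on_vec_lambda)
  fix m :: 4
  show "continuous_on S (\<lambda>x. if m = 1 \<or> m = 3 then max (f x $ m) 0 else min (f x $ m) 0)"
    by (cases "m = 1 \<or> m = 3") (auto intro!: continuous_intros assms)
qed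

text \<open>Subgradients of \<open>\<Psi>\<close> plus the indicator function of the interval \<open>I\<close>.\<close>

definition subgrad_on :: "real set \<Rightarrow> (real \<Rightarrow> real) \<Rightarrow> real \<Rightarrow> real \<Rightarrow> bool" where
  "subgrad_on I \<Psi> r s \<longleftrightarrow> r \<in> I \<and> (\<forall>y\<in>I. \<Psi> r + s * (y - r) \<le> \<Psi> y)"

section \<open>One-dimensional subgradients and proximal maps\<close>

lemma subgrad_on_mono:
  assumes "subgrad_on I \<Psi> r s" "subgrad_on I \<Psi> r' s'"
  shows "0 \<le> (s - s') * (r - r')"
proof -
  have "\<Psi> r + s * (r' - r) \<le> \<Psi> r'" "\<Psi> r' + s' * (r - r') \<le> \<Psi> r"
    using assms by (auto simp: subgrad_on_def)
  then show ?thesis by (simp add: algebra_simps)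
qed

text \<open>For \<open>y\<close> beyond \<open>R\<close> the value at \<open>R\<close> lies below
  the chord from \<open>r\<close> to \<open>y\<close>, so the line supporting the function up to
  \<open>R\<close> stays below it afterwards. Hence an upper bound \<open>R\<close> that is not
  attained leaves no trace.\<close>

lemma subgrad_on_extend:
  assumes cvx: "convex_on {0..} \<Psi>" and s: "subgrad_on {0..R} \<Psi> r s" and "r < R"
  shows "subgrad_on {0..} \<Psi> r s"
  unfolding subgrad_on_def
proof (intro conjI ballI)
  show r: "r \<in> {0..}" using s by (simp add: subgrad_on_def)
  fix y :: real assume y: "y \<in> {0..}"
  show "\<Psi> r + s * (y - r) \<le> \<Psi> y"
  proof (cases "y \<le> R")
    case True then show ?thesis using s y by (simp add: subgrad_on_def)
  next
    case False
    define t where "t = (R - r) / (y - r)"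
    have t: "0 < t" "t \<le> 1" using False \<open>r < R\<close> by (auto simp: t_def field_simps)
    have ty: "t * (y - r) = R - r" using False \<open>r < R\<close> by (simp add: t_def)
    have R: "(1 - t) * r + t * y = R" using ty by (simp add: algebra_simps)
    have "\<Psi> r + s * (R - r) \<le> \<Psi> R"
      using s \<open>r < R\<close> r by (auto simp: subgrad_on_def)
    also have "\<Psi> R \<le> (1 - t) * \<Psi> r + t * \<Psi> y"
      using convex_onD[OF cvx, of t r y] t r y R by simp
    finally have "t * (\<Psi> r + s * (y - r)) \<le> t * \<Psi> y"
      by (simp add: ty[symmetric] algebra_simps)
    then show ?thesis using t by simp
  qed
qed

lemma subgrad_on_deriv:
  assumes d: "(\<Psi> has_real_derivative d) (at r)" and r: "r > 0" and s: "subgrad_on {0..} \<Psi> r s"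
  shows "s = d"
proof -
  have "((\<lambda>y. \<Psi> y - s * y) has_real_derivative d - s) (at r)"
    by (auto intro!: derivative_eq_intros d)
  then have "d - s = 0"
  proof (rule DERIV_local_min[OF _ r], intro allI impI)
    fix y assume "\<bar>r - y\<bar> < r"
    then have "\<Psi> r + s * (y - r) \<le> \<Psi> y" using s by (auto simp: subgrad_on_def)
    then show "\<Psi> r - s * r \<le> \<Psi> y - s * y" by (simp add: algebra_simps)
  qed
  then show ?thesis by simp
qed

text \<open>Convexity bounds the difference quotients towards \<open>y\<close> by
  \<open>\<Psi> y - \<Psi> r\<close>; let the step tend to 0 from the right.\<close>

lemma deriv_subgrad_on:
  assumes cvx: "convex_on {0..} \<Psi>" and d: "(\<Psi> has_real_derivative d) (at r)" and r: "r > 0"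
  shows "subgrad_on {0..} \<Psi> r d"
  unfolding subgrad_on_def
proof (intro conjI ballI)
  show "r \<in> {0..}" using r by simp
  fix y :: real assume y: "y \<in> {0..}"
  have "((\<lambda>t. \<Psi> (r + t * (y - r))) has_real_derivative d * (y - r)) (at 0)"
    by (rule DERIV_chain2[where g = "\<lambda>t. r + t * (y - r)" and f = \<Psi>])
      (auto intro!: derivative_eq_intros d)
  then have "((\<lambda>t. (\<Psi> (r + t * (y - r)) - \<Psi> r) / t) \<longlongrightarrow> d * (y - r)) (at 0)"
    by (simp add: has_field_derivative_iff)
  then have lim: "((\<lambda>t. (\<Psi> (r + t * (y - r)) - \<Psi> r) / t) \<longlongrightarrow> d * (y - r)) (at_right 0)"
    by (rule tendsto_mono[rotated]) (simp add: at_le)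
  have "d * (y - r) \<le> \<Psi> y - \<Psi> r"
  proof (rule tendsto_upperbound[OF lim])
    have "\<forall>\<^sub>F t in at_right (0::real). 0 < t \<and> t < 1"
      by (simp add: eventually_at_right_field) (metis zero_less_one)
    then show "\<forall>\<^sub>F t in at_right 0. (\<Psi> (r + t * (y - r)) - \<Psi> r) / t \<le> \<Psi> y - \<Psi> r"
    proof (rule eventually_mono)
      fix t :: real assume t: "0 < t \<and> t < 1"
      have "\<Psi> ((1 - t) *\<^sub>R r + t *\<^sub>R y) \<le> (1 - t) * \<Psi> r + t * \<Psi> y"
        by (rule convex_onD[OF cvx]) (use t r y in auto)
      moreover have "(1 - t) *\<^sub>R r + t *\<^sub>R y = r + t * (y - r)" by (simp add: algebra_simps)
      ultimately have "\<Psi> (r + t * (y - r)) - \<Psi> r \<le> (\<Psi> y - \<Psi> r) * t"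
        by (simp add: algebra_simps)
      then show "(\<Psi> (r + t * (y - r)) - \<Psi> r) / t \<le> \<Psi> y - \<Psi> r"
        using t by (simp add: pos_divide_le_eq)
    qed
  qed simp
  then show "\<Psi> r + d * (y - r) \<le> \<Psi> y" by simp
qed

text \<open>The witness minimises \<open>\<Psi> y + (y - c)\<^sup>2 / 2\<close> over the interval.
  As \<open>\<Psi>\<close> is merely convex, the optimality condition comes from comparing with
  points on the segment towards \<open>y\<close>.\<close>

lemma prox_exists:
  fixes \<Psi> :: "real \<Rightarrow> real"
  assumes cvx: "convex_on {0..} \<Psi>" and cont: "continuous_on {0..} \<Psi>" and "R > 0"
  shows "\<exists>r. subgrad_on {0..R} \<Psi> r (c - r)"
proof -
  have "\<exists>r\<in>{0..R}. \<forall>y\<in>{0..R}. \<Psi> r + (r - c)\<^sup>2 / 2 \<le> \<Psi> y + (y - c)\<^sup>2 / 2"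
    by (rule continuous_attains_inf)
      (use \<open>R > 0\<close> in \<open>auto intro!: continuous_intros continuous_on_subset[OF cont]\<close>)
  then obtain r where r: "0 \<le> r" "r \<le> R"
    and min: "\<And>y. 0 \<le> y \<Longrightarrow> y \<le> R \<Longrightarrow> \<Psi> r + (r - c)\<^sup>2 / 2 \<le> \<Psi> y + (y - c)\<^sup>2 / 2"
    by auto
  have "\<Psi> r + (c - r) * (y - r) \<le> \<Psi> y" if y: "0 \<le> y" "y \<le> R" for y
  proof (rule field_le_epsilon)
    fix e :: real assume "e > 0"
    \<comment> \<open>Small enough for the quadratic error \<open>t * (y - r)\<^sup>2 / 2\<close> to
      be at most \<open>e\<close>; the added 1 avoids division by zero.\<close>
    define t where "t = min 1 (e / (1 + (y - r)\<^sup>2))"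
    have p: "1 + (y - r)\<^sup>2 > 0" by (simp add: add_pos_nonneg)
    have t: "0 < t" "t \<le> 1" using \<open>e > 0\<close> p by (simp_all add: t_def)
    have "t \<le> e / (1 + (y - r)\<^sup>2)" by (simp add: t_def)
    then have "t * (1 + (y - r)\<^sup>2) \<le> e" using p by (simp add: pos_le_divide_eq)
    then have te: "t * (y - r)\<^sup>2 / 2 \<le> e"
      using t \<open>e > 0\<close> by (simp add: algebra_simps)
    define z where "z = (1 - t) * r + t * y"
    have z: "0 \<le> z" "z \<le> R"
    proof -
      show "0 \<le> z" using t r y by (simp add: z_def)
      have "z \<le> (1 - t) * R + t * R"
        unfolding z_def using t r y by (intro add_mono mult_left_mono) auto
      then show "z \<le> R" by (simp add: algebra_simps)
    qed
    have "\<Psi> r + (r - c)\<^sup>2 / 2 \<le> \<Psi> z + (z - c)\<^sup>2 / 2" by (rule min[OF z])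
    also have "\<Psi> z \<le> (1 - t) * \<Psi> r + t * \<Psi> y"
      using convex_onD[OF cvx, of t r y] t r y by (simp add: z_def)
    also have "(z - c)\<^sup>2 / 2 = (r - c)\<^sup>2 / 2 - t * ((c - r) * (y - r)) + t * (t * (y - r)\<^sup>2 / 2)"
      by (simp add: z_def power2_eq_square field_simps)
    finally have "t * (\<Psi> r + (c - r) * (y - r)) \<le> t * (\<Psi> y + t * (y - r)\<^sup>2 / 2)"
      by (simp add: algebra_simps)
    then have "\<Psi> r + (c - r) * (y - r) \<le> \<Psi> y + t * (y - r)\<^sup>2 / 2" using t by simp
    then show "\<Psi> r + (c - r) * (y - r) \<le> \<Psi> y + e" using te by linarith
  qed
  then show ?thesis using r by (intro exI[of _ r]) (auto simp: subgrad_on_def)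
qed

text \<open>The proximal map of \<open>\<Psi>\<close> restricted to \<open>{0..R}\<close>. By
  \<open>subgrad_on_mono\<close> there is at most one such point, so the choice is immaterial; the
  restriction gives values in a compact interval, as Brouwer's theorem requires.\<close>

definition prox :: "real \<Rightarrow> (real \<Rightarrow> real) \<Rightarrow> real \<Rightarrow> real" where
  "prox R \<Psi> c = (SOME r. subgrad_on {0..R} \<Psi> r (c - r))"

lemma prox_subgrad:
  assumes "convex_on {0..} \<Psi>" "continuous_on {0..} \<Psi>" "R > 0"
  shows "subgrad_on {0..R} \<Psi> (prox R \<Psi> c) (c - prox R \<Psi> c)"
  unfolding prox_def by (rule someI_ex[OF prox_exists[OF assms]])

text \<open>Proximal maps are nonexpansive, by monotonicity of the two subgradients.\<close>

lemma continuous_on_prox: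
  assumes \<Psi>: "convex_on {0..} \<Psi>" "continuous_on {0..} \<Psi>" "R > 0" and f: "continuous_on S f"
  shows "continuous_on S (\<lambda>x. prox R \<Psi> (f x))"
proof -
  have lip: "\<bar>prox R \<Psi> c - prox R \<Psi> d\<bar> \<le> \<bar>c - d\<bar>" for c d
  proof -
    let ?r = "prox R \<Psi> c - prox R \<Psi> d"
    have "?r * ?r \<le> (c - d) * ?r"
      using subgrad_on_mono[OF prox_subgrad[OF \<Psi>, of c] prox_subgrad[OF \<Psi>, of d]]
      by (simp add: algebra_simps)
    also have "\<dots> \<le> \<bar>c - d\<bar> * \<bar>?r\<bar>" by (metis abs_ge_self abs_mult)
    finally have "\<bar>?r\<bar> * \<bar>?r\<bar> \<le> \<bar>c - d\<bar> * \<bar>?r\<bar>" by simp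
    then show ?thesis
      by (cases "?r = 0") (simp, metis mult_right_le_imp_le zero_less_abs_iff)
  qed
  have "continuous_on UNIV (prox R \<Psi>)"
    unfolding continuous_on_iff dist_real_def
    using lip by (meson le_less_trans)
  from continuous_on_compose2[OF this f] show ?thesis by simp
qed

text \<open>The point 1 is a convex combination of 0 and \<open>R\<close>. The bound serves to
  exclude that a truncated density sits at the upper end \<open>R\<close>.\<close>

lemma convex_slope_lower_bound:
  fixes \<Psi> :: "real \<Rightarrow> real"
  assumes "convex_on {0..} \<Psi>" "1 < R"
  shows "\<Psi> 1 + (\<Psi> 1 - \<Psi> 0) * (R - 1) \<le> \<Psi> R"
proof -
  have "\<Psi> ((1 - 1 / R) *\<^sub>R 0 + (1 / R) *\<^sub>R R) \<le> (1 - 1 / R) * \<Psi> 0 + 1 / R * \<Psi> R"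
    by (rule convex_onD[OF assms(1)]) (use assms(2) in auto)
  then have "R * \<Psi> 1 \<le> R * ((1 - 1 / R) * \<Psi> 0 + 1 / R * \<Psi> R)"
    using assms(2) by (intro mult_left_mono) auto
  then show ?thesis using assms(2) by (simp add: algebra_simps)
qed

text \<open>\<open>theta\<close> is the Hamiltonian at \<open>- p\<close> and \<open>velocity\<close> its gradient in \<open>p\<close>.\<close>

definition theta :: "real \<Rightarrow> real \<Rightarrow> real \<Rightarrow> real \<Rightarrow> real ^ 4 \<Rightarrow> real" where
  "theta \<epsilon> \<beta> \<alpha> \<eta> p = norm (projK p) powr \<beta> / (\<beta> * (\<eta> + \<epsilon>) powr \<alpha>)"

definition velocity :: "real \<Rightarrow> real \<Rightarrow> real \<Rightarrow> real \<Rightarrow> real ^ 4 \<Rightarrow> real ^ 4" where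
  "velocity \<epsilon> \<beta> \<alpha> \<eta> p = (norm (projK p) powr (\<beta> - 2) / (\<eta> + \<epsilon>) powr \<alpha>) *\<^sub>R projK p"

text \<open>The finite values of \<open>Eh\<close>. At \<open>r = 0\<close> and \<open>w = 0\<close>
  the power of \<open>norm w\<close> is 0, so the value 0 of \<open>Eh\<close> needs no separate
  case.\<close>

definition energy :: "real \<Rightarrow> real \<Rightarrow> real \<Rightarrow> real \<Rightarrow> real \<Rightarrow> real ^ 4 \<Rightarrow> real" where
  "energy \<epsilon> \<beta> \<alpha> \<eta> r w =
     (\<eta> + \<epsilon>) powr (\<alpha> * (\<beta> / (\<beta> - 1) - 1)) * norm w powr (\<beta> / (\<beta> - 1))
       / (\<beta> / (\<beta> - 1) * r powr (\<beta> / (\<beta> - 1) - 1))"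

definition energy_dom :: "real \<Rightarrow> real ^ 4 \<Rightarrow> bool" where
  "energy_dom r w \<longleftrightarrow> 0 < r \<and> w \<in> Kcone \<or> r = 0 \<and> w = 0"

lemma Eh_eq: "Eh \<epsilon> \<beta> \<alpha> r w \<eta> = (if energy_dom r w then ereal (energy \<epsilon> \<beta> \<alpha> \<eta> r w) else \<infinity>)"
  by (auto simp: Eh_def energy_dom_def energy_def Let_def)

lemma norm_projK_uminus_sq:
  "(norm (projK (- q)))\<^sup>2 =
     (max (- q $ 1) 0)\<^sup>2 + (max (q $ 2) 0)\<^sup>2 + (max (- q $ 3) 0)\<^sup>2 + (max (q $ 4) 0)\<^sup>2"
proof -
  have "min (- x) 0 = - max x 0" for x :: real by simp
  then show ?thesis
    unfolding power2_norm_eq_inner inner_vec_def sum_4 projK_nth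
    by (simp add: power2_eq_square)
qed

lemma norm_powr_eq: "norm x powr b = ((norm x)\<^sup>2) powr (b / 2)"
proof (cases "norm x = 0")
  case False
  then show ?thesis using powr_powr[of "norm x" 2 "b / 2"] by simp
qed simp

text \<open>The upwind parts in the Hamiltonian are the moduli of the components of
  \<open>projK (- q)\<close>.\<close>

lemma Hh_eq_theta: "Hh \<epsilon> \<beta> \<alpha> q \<eta> = theta \<epsilon> \<beta> \<alpha> \<eta> (- q)"
  by (simp add: Hh_def theta_def norm_powr_eq norm_projK_uminus_sq)

lemma DERIV_max_sq: "((\<lambda>s. (max s 0)\<^sup>2) has_real_derivative 2 * max s 0) (at s)" for s :: real
proof (cases "s = 0")
  case True
  have "((\<lambda>h. (max h 0)\<^sup>2 / h) \<longlongrightarrow> 0) (at (0::real))"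
  proof (rule Lim_null_comparison)
    show "((\<lambda>h. \<bar>h\<bar>) \<longlongrightarrow> 0) (at (0::real))" by (auto intro!: tendsto_eq_intros)
    show "\<forall>\<^sub>F h in at (0::real). norm ((max h 0)\<^sup>2 / h) \<le> \<bar>h\<bar>"
      by (rule always_eventually) (auto simp: max_def power2_eq_square)
  qed
  then show ?thesis using True by (simp add: has_field_derivative_iff)
next
  case False
  show ?thesis
  proof (cases "s > 0")
    case True
    have "((\<lambda>s. s\<^sup>2) has_real_derivative 2 * max s 0) (at s)"
      using True by (auto intro!: derivative_eq_intros)
    then show ?thesis
      by (rule has_field_derivative_transform_within_open[where S = "{0<..}"]) (use True in auto)
  next
    case neg: False
    have "((\<lambda>s. 0) has_real_derivative 2 * max s 0) (at s)"
      using neg by (auto intro!: derivative_eq_intros)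
    then show ?thesis
      by (rule has_field_derivative_transform_within_open[where S = "{..<0}"]) (use neg False in auto)
  qed
qed

text \<open>The exponent exceeds one half, so the function is differentiable even where it vanishes.\<close>

lemma DERIV_max_sq_powr:
  fixes b c s :: real
  assumes "c \<ge> 0" "b > 1"
  shows "((\<lambda>s. ((max s 0)\<^sup>2 + c) powr (b / 2)) has_real_derivative
     b * ((max s 0)\<^sup>2 + c) powr (b / 2 - 1) * max s 0) (at s)"
proof (cases "(max s 0)\<^sup>2 + c = 0")
  case False
  then have pos: "(max s 0)\<^sup>2 + c > 0" using \<open>c \<ge> 0\<close> by (simp add: order_less_le)
  have "((\<lambda>s. ((max s 0)\<^sup>2 + c) powr (b / 2)) has_real_derivative
      ((b / 2) * ((max s 0)\<^sup>2 + c) powr (b / 2 - 1)) * (2 * max s 0 + 0)) (at s)"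
    by (rule DERIV_chain2[where f = "\<lambda>x. x powr (b / 2)" and g = "\<lambda>s. (max s 0)\<^sup>2 + c"])
      (intro has_real_derivative_powr pos DERIV_add DERIV_max_sq DERIV_const)+
  then show ?thesis by (simp add: algebra_simps)
next
  case True
  then have c: "c = 0" and s: "s \<le> 0"
    using \<open>c \<ge> 0\<close> add_nonneg_eq_0_iff[of "(max s 0)\<^sup>2" c] by (auto simp: max_def split: if_splits)
  have "((\<lambda>y. ((max y 0)\<^sup>2) powr (b / 2) / (y - s)) \<longlongrightarrow> 0) (at s)"
  proof (rule Lim_null_comparison)
    have "((\<lambda>y. \<bar>y - s\<bar> powr (b - 1)) \<longlongrightarrow> \<bar>s - s\<bar> powr (b - 1)) (at s)"
      by (intro tendsto_intros) (use \<open>b > 1\<close> in auto)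
    then show "((\<lambda>y. \<bar>y - s\<bar> powr (b - 1)) \<longlongrightarrow> 0) (at s)" by simp
    show "\<forall>\<^sub>F y in at s. norm (((max y 0)\<^sup>2) powr (b / 2) / (y - s)) \<le> \<bar>y - s\<bar> powr (b - 1)"
      unfolding eventually_at_filter
    proof (rule always_eventually, intro allI impI)
      fix y assume y: "y \<noteq> s"
      have "((max y 0)\<^sup>2) powr (b / 2) = (max y 0) powr b"
        using norm_powr_eq[of "max y 0" b] by simp
      also have "\<dots> \<le> \<bar>y - s\<bar> powr b"
        by (rule powr_mono2) (use s \<open>b > 1\<close> in auto)
      also have "\<dots> = \<bar>y - s\<bar> powr (b - 1) * \<bar>y - s\<bar>"
        using y by (simp add: powr_diff)
      finally show "norm (((max y 0)\<^sup>2) powr (b / 2) / (y - s)) \<le> \<bar>y - s\<bar> powr (b - 1)"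
        using y by (simp add: field_simps)
    qed
  qed
  then show ?thesis using c s by (simp add: has_field_derivative_iff max_def)
qed

section \<open>Young's inequality and monotonicity in one cell\<close>

locale congestion =
  fixes \<epsilon> \<beta> \<alpha> :: real
  assumes eps_pos: "\<epsilon> > 0" and beta_gt_1: "1 < \<beta>"
    and alpha_pos: "0 < \<alpha>" and alpha_le: "\<alpha> \<le> 4 * (\<beta> - 1) / \<beta>"
begin

abbreviation "\<theta> \<equiv> theta \<epsilon> \<beta> \<alpha>"
abbreviation "vel \<equiv> velocity \<epsilon> \<beta> \<alpha>"
abbreviation "en \<equiv> energy \<epsilon> \<beta> \<alpha>"

lemma theta_partial:
  "((\<lambda>s. \<theta> \<eta> (\<chi> l. if l = m then s else p $ l)) has_real_derivative vel \<eta> p $ m) (at (p $ m))"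
  if "\<eta> \<ge> 0"
proof -
  define c where "c = (\<Sum>l\<in>UNIV - {m}. (projK p $ l)\<^sup>2)"
  \<comment> \<open>With this sign the positive and the negative part of a component both take the
    form \<open>max (sg * s) 0\<close>, up to the factor \<open>sg\<close>.\<close>
  define sg :: real where "sg = (if m = 1 \<or> m = 3 then 1 else -1)"
  have c0: "c \<ge> 0" by (simp add: c_def sum_nonneg)
  have sq: "(norm (projK (\<chi> l. if l = m then s else p $ l)))\<^sup>2 = (max (sg * s) 0)\<^sup>2 + c" for s
  proof -
    let ?q = "\<chi> l. if l = m then s else p $ l"
    have "(norm (projK ?q))\<^sup>2 = (\<Sum>l\<in>UNIV. (projK ?q $ l)\<^sup>2)"
      unfolding power2_norm_eq_inner inner_vec_def by (simp add: power2_eq_square)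
    also have "\<dots> = (projK ?q $ m)\<^sup>2 + (\<Sum>l\<in>UNIV - {m}. (projK ?q $ l)\<^sup>2)"
      by (simp add: sum.remove)
    also have "(\<Sum>l\<in>UNIV - {m}. (projK ?q $ l)\<^sup>2) = c"
      unfolding c_def by (intro sum.cong) (auto simp: projK_nth)
    also have "(projK ?q $ m)\<^sup>2 = (max (sg * s) 0)\<^sup>2"
      by (auto simp: projK_nth sg_def max_def min_def)
    finally show ?thesis .
  qed
  have p: "(\<chi> l. if l = m then p $ m else p $ l) = p" by (simp add: vec_eq_iff)
  have np: "(norm (projK p))\<^sup>2 = (max (sg * p $ m) 0)\<^sup>2 + c"
    using sq[of "p $ m"] unfolding p .
  have d: "((\<lambda>s. ((max (sg * s) 0)\<^sup>2 + c) powr (\<beta> / 2)) has_real_derivative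
      (\<beta> * ((max (sg * p $ m) 0)\<^sup>2 + c) powr (\<beta> / 2 - 1) * max (sg * p $ m) 0) * sg) (at (p $ m))"
    by (rule DERIV_chain2[OF DERIV_max_sq_powr[OF c0 beta_gt_1], where g = "\<lambda>s. sg * s"])
      (auto intro!: derivative_eq_intros)
  have v: "max (sg * p $ m) 0 * sg = projK p $ m"
    by (auto simp: projK_nth sg_def max_def min_def)
  have n: "((norm (projK p))\<^sup>2) powr (\<beta> / 2 - 1) = norm (projK p) powr (\<beta> - 2)"
    using norm_powr_eq[of "projK p" "\<beta> - 2"] by (simp add: diff_divide_distrib)
  have "((\<lambda>s. ((max (sg * s) 0)\<^sup>2 + c) powr (\<beta> / 2)) has_real_derivative
      \<beta> * norm (projK p) powr (\<beta> - 2) * projK p $ m) (at (p $ m))"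
    using d unfolding np[symmetric] n by (simp add: v mult.assoc)
  from DERIV_cmult[OF this, of "1 / (\<beta> * (\<eta> + \<epsilon>) powr \<alpha>)"]
  show ?thesis
    using beta_gt_1 by (simp add: theta_def norm_powr_eq[of _ \<beta>] sq velocity_def)
qed

lemma dHh_eq:
  assumes "\<eta> \<ge> 0"
  shows "dHh \<epsilon> \<beta> \<alpha> m q \<eta> = - (vel \<eta> (- q) $ m)"
proof -
  have "((\<lambda>s. \<theta> \<eta> (\<chi> l. if l = m then - s else (- q) $ l)) has_real_derivative
      vel \<eta> (- q) $ m * - 1) (at (q $ m))"
  proof (rule DERIV_chain2[where g = uminus and f = "\<lambda>s. \<theta> \<eta> (\<chi> l. if l = m then s else (- q) $ l)"])
    show "((\<lambda>s. \<theta> \<eta> (\<chi> l. if l = m then s else (- q) $ l)) has_real_derivative vel \<eta> (- q) $ m)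
        (at (- q $ m))"
      using theta_partial[OF assms, of m "- q"] by simp
  qed (auto intro!: derivative_eq_intros)
  moreover have "(\<chi> l. if l = m then - s else (- q) $ l) = - (\<chi> l. if l = m then s else q $ l)" for s
    by (simp add: vec_eq_iff)
  ultimately show ?thesis
    by (simp add: dHh_def Hh_eq_theta DERIV_imp_deriv)
qed

lemma vel_in_Kcone: "vel \<eta> p \<in> Kcone"
  unfolding velocity_def by (intro scaleR_in_Kcone projK_in_Kcone) simp

lemma conj_exponents: "1 < \<beta> / (\<beta> - 1)" "1 / \<beta> + 1 / (\<beta> / (\<beta> - 1)) = 1"
  "\<beta> / (\<beta> - 1) / \<beta> = \<beta> / (\<beta> - 1) - 1" "(\<beta> - 1) * (\<beta> / (\<beta> - 1)) = \<beta>"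
  using beta_gt_1 by (auto simp: field_simps)

lemma energy_nonneg: "0 \<le> en \<eta> r w"
  using beta_gt_1 by (simp add: energy_def)

text \<open>Projection onto the cone and Cauchy-Schwarz reduce the claim to the scalar Young
  inequality for \<open>norm (projK p)\<close> and \<open>norm w / r\<close>.\<close>

lemma young:
  assumes "\<eta> \<ge> 0" "energy_dom r w"
  shows "p \<bullet> w \<le> en \<eta> r w + r * \<theta> \<eta> p"
proof (cases "r = 0")
  case True
  then have "w = 0" using assms by (simp add: energy_dom_def)
  then show ?thesis using True energy_nonneg[of \<eta> 0 0] by simp
next
  case False
  define b' where "b' = \<beta> / (\<beta> - 1)"
  define m where "m = (\<eta> + \<epsilon>) powr \<alpha>"
  have r: "r > 0" and w: "w \<in> Kcone" using False assms(2) by (auto simp: energy_dom_def)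
  have s: "\<eta> + \<epsilon> > 0" using assms(1) eps_pos by simp
  have m: "m > 0" using s by (simp add: m_def)
  define x where "x = norm (projK p)" define y where "y = norm w / r"
  have xy: "x \<ge> 0" "y \<ge> 0" using r by (simp_all add: x_def y_def)
  note ce = conj_exponents[folded b'_def]
  have "p \<bullet> w \<le> projK p \<bullet> w" by (rule inner_le_projK[OF w])
  also have "\<dots> \<le> x * norm w" unfolding x_def by (rule norm_cauchy_schwarz)
  also have "\<dots> = r * (x * y)" using r by (simp add: y_def)
  \<comment> \<open>With the weight split in this way between the factors, Young's inequality
    returns exactly the powers of \<open>m\<close> that occur in \<open>\<theta>\<close> and
    \<open>en\<close>.\<close>
  also have "x * y = (x * m powr (- 1 / \<beta>)) * (y * m powr (1 / \<beta>))"
    using m by (simp add: powr_minus field_simps)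
  also have "\<dots> \<le> (x * m powr (- 1 / \<beta>)) powr \<beta> / \<beta> + (y * m powr (1 / \<beta>)) powr b' / b'"
    by (rule Youngs_inequality[OF beta_gt_1 ce(1,2)]) (use xy in auto)
  also have "(x * m powr (- 1 / \<beta>)) powr \<beta> = x powr \<beta> / m"
  proof -
    have "(m powr (- 1 / \<beta>)) powr \<beta> = m powr (- 1)"
      using beta_gt_1 by (subst powr_powr) simp
    moreover have "(x * m powr (- 1 / \<beta>)) powr \<beta> = x powr \<beta> * (m powr (- 1 / \<beta>)) powr \<beta>"
      using xy by (simp only: powr_mult powr_ge_zero)
    ultimately show ?thesis using m by (simp add: powr_minus_divide)
  qed
  also have "(y * m powr (1 / \<beta>)) powr b' = y powr b' * m powr (b' - 1)"
    using xy ce(3) by (simp add: powr_mult powr_powr)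
  finally have "p \<bullet> w \<le> r * (x powr \<beta> / m / \<beta> + y powr b' * m powr (b' - 1) / b')"
    using r by simp
  also have "r * (x powr \<beta> / m / \<beta>) = r * \<theta> \<eta> p"
    by (simp add: theta_def x_def m_def)
  then have "r * (x powr \<beta> / m / \<beta> + y powr b' * m powr (b' - 1) / b') =
      r * \<theta> \<eta> p + r * (y powr b' * m powr (b' - 1) / b')" by (simp add: distrib_left)
  also have "r * (y powr b' * m powr (b' - 1) / b') = en \<eta> r w"
  proof -
    have "r powr (b' - 1) = r powr b' / r" using r by (simp add: powr_diff)
    then show ?thesis
      using r by (simp add: energy_def b'_def[symmetric] y_def m_def powr_powr powr_divide mult_ac)
  qed
  finally show ?thesis by simp
qed

lemma norm_vel: "norm (vel \<eta> p) = norm (projK p) powr (\<beta> - 1) / (\<eta> + \<epsilon>) powr \<alpha>"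
proof (cases "norm (projK p) = 0")
  case False
  then have "norm (projK p) powr (\<beta> - 2) * norm (projK p) = norm (projK p) powr (\<beta> - 1)"
    using powr_add[of "norm (projK p)" "\<beta> - 2" 1] by simp
  then show ?thesis by (simp add: velocity_def)
qed (simp add: velocity_def)

lemma inner_vel: "p \<bullet> vel \<eta> p = norm (projK p) powr \<beta> / (\<eta> + \<epsilon>) powr \<alpha>"
proof (cases "norm (projK p) = 0")
  case False
  then have "norm (projK p) powr (\<beta> - 2) * (norm (projK p))\<^sup>2 = norm (projK p) powr \<beta>"
    using powr_add[of "norm (projK p)" "\<beta> - 2" 2] by simp
  then show ?thesis by (simp add: velocity_def inner_projK_self)
qed (simp add: velocity_def)

text \<open>Both sides are \<open>r\<close> times the same weighted power of
  \<open>norm (projK p)\<close>; the energy and the Hamiltonian take the shares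
  \<open>1 / b'\<close> and \<open>1 / \<beta>\<close> of it.\<close>

lemma young_eq:
  assumes "\<eta> \<ge> 0" "r \<ge> 0"
  shows "p \<bullet> (r *\<^sub>R vel \<eta> p) = en \<eta> r (r *\<^sub>R vel \<eta> p) + r * \<theta> \<eta> p"
proof (cases "r = 0")
  case True then show ?thesis by (simp add: energy_def)
next
  case False
  define b' where "b' = \<beta> / (\<beta> - 1)"
  define m where "m = (\<eta> + \<epsilon>) powr \<alpha>"
  have r: "r > 0" using False assms by simp
  have s: "\<eta> + \<epsilon> > 0" using assms(1) eps_pos by simp
  have m: "m > 0" using s by (simp add: m_def)
  define x where "x = norm (projK p)"
  have x: "x \<ge> 0" by (simp add: x_def)
  note ce = conj_exponents[folded b'_def]
  have "en \<eta> r (r *\<^sub>R vel \<eta> p) =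
      m powr (b' - 1) * (r * (x powr (\<beta> - 1) / m)) powr b' / (b' * r powr (b' - 1))"
    using r by (simp add: energy_def norm_vel b'_def m_def powr_powr x_def)
  also have "(r * (x powr (\<beta> - 1) / m)) powr b' = r powr b' * (x powr \<beta> / m powr b')"
    using r m x ce(4) by (simp add: powr_mult powr_divide powr_powr)
  also have "m powr (b' - 1) * (r powr b' * (x powr \<beta> / m powr b')) / (b' * r powr (b' - 1))
      = r * (x powr \<beta> / m) * (1 / b')"
    using r m by (simp add: powr_diff field_simps)
  finally have "en \<eta> r (r *\<^sub>R vel \<eta> p) + r * \<theta> \<eta> p = r * (x powr \<beta> / m) * (1 / b' + 1 / \<beta>)"
    by (simp add: theta_def x_def m_def add_divide_distrib algebra_simps)
  also have "1 / b' + 1 / \<beta> = 1" using ce(2) by simp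
  finally show ?thesis by (simp add: inner_vel x_def m_def)
qed

lemma young_eq_imp:
  assumes "\<eta> \<ge> 0" and dom: "energy_dom r w" and eq: "en \<eta> r w + r * \<theta> \<eta> p \<le> p \<bullet> w"
  shows "w = r *\<^sub>R vel \<eta> p"
proof (cases "r = 0")
  case True then show ?thesis using dom by (simp add: energy_dom_def)
next
  case False
  then have r: "r > 0" using dom by (auto simp: energy_dom_def)
  text \<open>For fixed \<open>w\<close>, equality means that \<open>p\<close> minimises the gap in Young's inequality.\<close>
  have "w $ m = r * vel \<eta> p $ m" for m
  proof -
    define P where "P s = (\<chi> l. if l = m then s else p $ l)" for s
    have Pw: "P s \<bullet> w = s * w $ m + (\<Sum>l\<in>UNIV - {m}. p $ l * w $ l)" for s
      unfolding inner_vec_def P_def by (simp add: sum.remove[of UNIV m])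
    have Pp: "P (p $ m) = p" by (simp add: P_def vec_eq_iff)
    have "((\<lambda>s. r * \<theta> \<eta> (P s) - P s \<bullet> w) has_real_derivative r * vel \<eta> p $ m - w $ m) (at (p $ m))"
      unfolding Pw by (auto intro!: derivative_eq_intros theta_partial[OF assms(1), of m p, folded P_def])
    then have "r * vel \<eta> p $ m - w $ m = 0"
    proof (rule DERIV_local_min[where d = 1])
      have "r * \<theta> \<eta> p - p \<bullet> w \<le> r * \<theta> \<eta> (P s) - P s \<bullet> w" for s
        using eq young[OF assms(1) dom, of "P s"] by linarith
      then show "\<forall>y. \<bar>p $ m - y\<bar> < 1 \<longrightarrow>
          r * \<theta> \<eta> (P (p $ m)) - P (p $ m) \<bullet> w \<le> r * \<theta> \<eta> (P y) - P y \<bullet> w"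
        by (simp add: Pp)
    qed simp
    then show ?thesis by simp
  qed
  then show ?thesis by (simp add: vec_eq_iff)
qed

lemma energy_dom_vel: "r \<ge> 0 \<Longrightarrow> energy_dom r (r *\<^sub>R vel \<eta> p)"
  using vel_in_Kcone scaleR_in_Kcone by (auto simp: energy_dom_def)

text \<open>The description is uniform in \<open>r \<ge> 0\<close>, although the energy is singular at \<open>r = 0\<close>.\<close>

lemma cell_subdifferential_iff:
  assumes "\<eta> \<ge> 0" and I: "I \<subseteq> {0..}"
  shows "energy_dom r w \<and> r \<in> I \<and>
      (\<forall>r'\<in>I. \<forall>w'. energy_dom r' w' \<longrightarrow>
        en \<eta> r w + \<Psi> r + (a * (r' - r) + p \<bullet> (w' - w)) \<le> en \<eta> r' w' + \<Psi> r')
    \<longleftrightarrow> w = r *\<^sub>R vel \<eta> p \<and> subgrad_on I \<Psi> r (a + \<theta> \<eta> p)" (is "?L \<longleftrightarrow> ?R")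
proof
  assume L: ?L
  \<comment> \<open>Testing with the flux \<open>r' *\<^sub>R vel \<eta> p\<close>, for which
    Young's inequality is an equality, eliminates \<open>w'\<close> and leaves an inequality in
    \<open>r'\<close> alone. At \<open>r' = r\<close> it forces equality in Young's inequality for
    \<open>w\<close>.\<close>
  have *: "en \<eta> r w + r * \<theta> \<eta> p - p \<bullet> w + (\<Psi> r + (a + \<theta> \<eta> p) * (r' - r)) \<le> \<Psi> r'" if "r' \<in> I" for r'
  proof -
    have r': "r' \<ge> 0" using that I by auto
    have "en \<eta> r w + \<Psi> r + (a * (r' - r) + p \<bullet> (r' *\<^sub>R vel \<eta> p - w))
        \<le> en \<eta> r' (r' *\<^sub>R vel \<eta> p) + \<Psi> r'"
      using L that energy_dom_vel[OF r'] by blast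
    then show ?thesis
      using young_eq[OF assms(1) r', of p] by (simp add: inner_diff_right algebra_simps)
  qed
  have w: "w = r *\<^sub>R vel \<eta> p"
    using *[of r] L by (intro young_eq_imp[OF assms(1)]) auto
  have "r \<ge> 0" using L I by auto
  then show ?R using w * L young_eq[OF assms(1), of r p] by (auto simp: subgrad_on_def)
next
  assume R: ?R
  then have r: "r \<in> I" "r \<ge> 0" using I by (auto simp: subgrad_on_def)
  have "en \<eta> r w + \<Psi> r + (a * (r' - r) + p \<bullet> (w' - w)) \<le> en \<eta> r' w' + \<Psi> r'"
    if "r' \<in> I" "energy_dom r' w'" for r' w'
  proof -
    have "\<Psi> r + (a + \<theta> \<eta> p) * (r' - r) \<le> \<Psi> r'" using R that by (auto simp: subgrad_on_def)
    moreover have "p \<bullet> w = en \<eta> r w + r * \<theta> \<eta> p" using R young_eq[OF assms(1) r(2), of p] by simp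
    moreover have "p \<bullet> w' \<le> en \<eta> r' w' + r' * \<theta> \<eta> p" by (rule young[OF assms(1) that(2)])
    ultimately show ?thesis by (simp add: inner_diff_right algebra_simps)
  qed
  then show ?L using R r energy_dom_vel[OF r(2)] by auto
qed

text \<open>Along a segment the derivative is a quadratic form, positive semidefinite as soon as
  \<open>\<alpha> \<rho> / (\<rho> + \<epsilon>) \<le> 4 (\<beta> - 1) / \<beta>\<close>: this is where the bound on \<open>\<alpha>\<close> enters.\<close>

lemma radial_monotone:
  assumes "r1 \<ge> 0" "r2 \<ge> 0" "x1 \<ge> 0" "x2 \<ge> 0"
  shows "0 \<le> (x1 - x2) * (r1 * x1 powr (\<beta> - 1) / (r1 + \<epsilon>) powr \<alpha> - r2 * x2 powr (\<beta> - 1) / (r2 + \<epsilon>) powr \<alpha>)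
    - (r1 - r2) * (x1 powr \<beta> / (\<beta> * (r1 + \<epsilon>) powr \<alpha>) - x2 powr \<beta> / (\<beta> * (r2 + \<epsilon>) powr \<alpha>))"
\<comment> \<open>Unless both radii vanish, the radius is positive inside the segment, so its powers
  are differentiable there; at the ends continuity is enough.\<close>
proof (cases "x1 = 0 \<and> x2 = 0")
  case True then show ?thesis by simp
next
  case False
  define u where "u = r1 - r2" define v where "v = x1 - x2"
  define r where "r t = r2 + t * u" for t
  define x where "x t = x2 + t * v" for t
  define g where "g t = v * (r t * x t powr (\<beta> - 1) * (r t + \<epsilon>) powr (- \<alpha>))
    - u * (x t powr \<beta> / \<beta> * (r t + \<epsilon>) powr (- \<alpha>))" for t
  have r0: "r t \<ge> 0" if "0 \<le> t" "t \<le> 1" for t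
  proof -
    have "r t = (1 - t) * r2 + t * r1" by (simp add: r_def u_def algebra_simps)
    then show ?thesis using assms that by simp
  qed
  have x0: "x t \<ge> 0" if "0 \<le> t" "t \<le> 1" for t
  proof -
    have "x t = (1 - t) * x2 + t * x1" by (simp add: x_def v_def algebra_simps)
    then show ?thesis using assms that by simp
  qed
  have xp: "x t > 0" if "0 < t" "t < 1" for t
  proof -
    have "x t = (1 - t) * x2 + t * x1" by (simp add: x_def v_def algebra_simps)
    then show ?thesis using assms that False
      by (metis add_nonneg_pos add_pos_nonneg diff_gt_0_iff_gt less_eq_real_def mult_nonneg_nonneg mult_pos_pos)
  qed
  have "g 0 \<le> g 1"
  proof (rule DERIV_nonneg_imp_increasing_open[where f = g and a = 0 and b = 1])
    have cr: "continuous_on {0..1} r" and cx: "continuous_on {0..1} x"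
      unfolding r_def x_def by (intro continuous_intros)+
    have cxp: "continuous_on {0..1} (\<lambda>t. x t powr b)" if "b > 0" for b
      by (rule continuous_on_powr') (use x0 cx that in auto)
    have "r t + \<epsilon> > 0" if "t \<in> {0..1}" for t using r0[of t] eps_pos that by auto
    then have crp: "continuous_on {0..1} (\<lambda>t. (r t + \<epsilon>) powr (- \<alpha>))"
      by (intro continuous_on_powr' continuous_intros cr) force
    show "continuous_on {0..1} g"
      unfolding g_def using beta_gt_1 by (intro continuous_intros cr cxp crp) auto
    fix t :: real assume t: "0 < t" "t < 1"
    define R where "R = r t" define X where "X = x t" define s where "s = R + \<epsilon>"
    have R: "R \<ge> 0" using r0 t by (simp add: R_def)
    have X: "X > 0" using xp t by (simp add: X_def)
    have s: "s > 0" "s \<ge> R" using R eps_pos by (simp_all add: s_def)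
    define D where "D = v * (u * X powr (\<beta> - 1) * s powr (- \<alpha>)
        + R * ((\<beta> - 1) * X powr (\<beta> - 2) * v) * s powr (- \<alpha>)
        + R * X powr (\<beta> - 1) * (- \<alpha> * s powr (- \<alpha> - 1) * u))
      - u * (X powr (\<beta> - 1) * v * s powr (- \<alpha>) + X powr \<beta> / \<beta> * (- \<alpha> * s powr (- \<alpha> - 1) * u))"
    have dr: "(r has_real_derivative u) (at t)" and dx: "(x has_real_derivative v) (at t)"
      unfolding r_def x_def by (auto intro!: derivative_eq_intros)
    have ds: "((\<lambda>t. (r t + \<epsilon>) powr (- \<alpha>)) has_real_derivative - \<alpha> * s powr (- \<alpha> - 1) * u) (at t)"
      by (rule DERIV_chain2[where f = "\<lambda>y. y powr (- \<alpha>)" and g = "\<lambda>t. r t + \<epsilon>"])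
        (use s in \<open>auto simp: s_def R_def intro!: derivative_eq_intros dr has_real_derivative_powr\<close>)
    have dxb: "((\<lambda>t. x t powr c) has_real_derivative c * X powr (c - 1) * v) (at t)" for c
      unfolding X_def
      by (rule DERIV_chain2[where f = "\<lambda>y. y powr c"])
        (use X in \<open>auto simp: X_def intro!: dx has_real_derivative_powr\<close>)
    have dxb1: "((\<lambda>t. x t powr (\<beta> - 1)) has_real_derivative (\<beta> - 1) * X powr (\<beta> - 2) * v) (at t)"
      using dxb[of "\<beta> - 1"] by simp
    have dxb0: "((\<lambda>t. x t powr \<beta> / \<beta>) has_real_derivative X powr (\<beta> - 1) * v) (at t)"
      using DERIV_cdivide[OF dxb[of \<beta>], of \<beta>] beta_gt_1 by simp
    have "(g has_real_derivative D) (at t)"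
      unfolding g_def
      by (rule derivative_eq_intros dr ds dxb1 dxb0 refl)+
        (simp add: D_def R_def X_def s_def algebra_simps)
    moreover have "0 \<le> D"
    proof -
      have e: "X powr (\<beta> - 1) = X powr (\<beta> - 2) * X" "X powr \<beta> = X powr (\<beta> - 2) * X\<^sup>2"
        "s powr (- \<alpha>) = s powr (- \<alpha> - 1) * s"
        using X s powr_add[of X "\<beta> - 2" 1] powr_add[of X "\<beta> - 2" 2] powr_add[of s "- \<alpha> - 1" 1]
        by simp_all
      have "D = X powr (\<beta> - 2) * s powr (- \<alpha> - 1) *
          (\<alpha> / \<beta> * (u * X)\<^sup>2 - \<alpha> * R * u * v * X + (\<beta> - 1) * R * s * v\<^sup>2)"
        unfolding D_def e by (simp add: algebra_simps power2_eq_square)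
      also have "\<dots> \<ge> 0"
      proof (intro mult_nonneg_nonneg)
        \<comment> \<open>Complete the square in \<open>u * X\<close>; the remainder is nonnegative
          by this inequality together with \<open>R \<le> s\<close>.\<close>
        have "\<alpha> * \<beta> / 4 \<le> \<beta> - 1" using alpha_le beta_gt_1 by (simp add: field_simps)
        then have "\<alpha> * \<beta> / 4 * (R * R * v\<^sup>2) \<le> (\<beta> - 1) * (R * s * v\<^sup>2)"
          using alpha_pos beta_gt_1 R s by (intro mult_mono) auto
        moreover have "0 \<le> \<alpha> / \<beta> * (u * X - \<beta> * R * v / 2)\<^sup>2"
          using alpha_pos beta_gt_1 by simp
        moreover have "\<alpha> / \<beta> * (u * X - \<beta> * R * v / 2)\<^sup>2 =
            \<alpha> / \<beta> * (u * X)\<^sup>2 - \<alpha> * R * u * v * X + \<alpha> * \<beta> / 4 * (R * R * v\<^sup>2)"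
          using beta_gt_1 by (simp add: power2_eq_square field_simps)
        ultimately show "0 \<le> \<alpha> / \<beta> * (u * X)\<^sup>2 - \<alpha> * R * u * v * X + (\<beta> - 1) * R * s * v\<^sup>2"
          by (simp add: mult.assoc)
      qed auto
      finally show ?thesis .
    qed
    ultimately show "\<exists>y. (g has_real_derivative y) (at t) \<and> 0 \<le> y" by blast
  qed simp
  moreover have "g 1 - g 0 = (x1 - x2) * (r1 * x1 powr (\<beta> - 1) / (r1 + \<epsilon>) powr \<alpha> - r2 * x2 powr (\<beta> - 1) / (r2 + \<epsilon>) powr \<alpha>)
    - (r1 - r2) * (x1 powr \<beta> / (\<beta> * (r1 + \<epsilon>) powr \<alpha>) - x2 powr \<beta> / (\<beta> * (r2 + \<epsilon>) powr \<alpha>))"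
    by (simp add: g_def r_def x_def u_def v_def powr_minus_divide algebra_simps)
  ultimately show ?thesis by linarith
qed

text \<open>Only the mixed products of \<open>p1\<close> with \<open>vel r2 p2\<close> and of
  \<open>p2\<close> with \<open>vel r1 p1\<close> are estimated, by projection and Cauchy-Schwarz;
  the unmixed ones equal their radial values. What remains is \<open>radial_monotone\<close> for the
  norms of the projections.\<close>

lemma cell_monotone:
  assumes "r1 \<ge> 0" "r2 \<ge> 0"
  shows "0 \<le> (p1 - p2) \<bullet> (r1 *\<^sub>R vel r1 p1 - r2 *\<^sub>R vel r2 p2) - (r1 - r2) * (\<theta> r1 p1 - \<theta> r2 p2)"
proof -
  define x1 where "x1 = norm (projK p1)" define x2 where "x2 = norm (projK p2)"
  have cross: "p \<bullet> vel r q \<le> norm (projK p) * norm (projK q) powr (\<beta> - 1) / (r + \<epsilon>) powr \<alpha>" for p q r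
  proof -
    have "p \<bullet> vel r q \<le> projK p \<bullet> vel r q" by (rule inner_le_projK[OF vel_in_Kcone])
    also have "\<dots> \<le> norm (projK p) * norm (vel r q)" by (rule norm_cauchy_schwarz)
    finally show ?thesis by (simp add: norm_vel)
  qed
  have pw: "x powr \<beta> = x * x powr (\<beta> - 1)" if "x \<ge> 0" for x
    using that powr_add[of x 1 "\<beta> - 1"] by (cases "x = 0") auto
  have x: "x1 \<ge> 0" "x2 \<ge> 0" by (simp_all add: x1_def x2_def)
  define c1 where "c1 = x1 powr (\<beta> - 1) / (r1 + \<epsilon>) powr \<alpha>"
  define c2 where "c2 = x2 powr (\<beta> - 1) / (r2 + \<epsilon>) powr \<alpha>"
  have "(x1 - x2) * (r1 * c1 - r2 * c2) = r1 * (x1 * c1 - x2 * c1) + r2 * (x2 * c2 - x1 * c2)"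
    by (simp add: algebra_simps)
  also have "\<dots> \<le> r1 * (p1 \<bullet> vel r1 p1 - p2 \<bullet> vel r1 p1) + r2 * (p2 \<bullet> vel r2 p2 - p1 \<bullet> vel r2 p2)"
    using assms cross[of p2 r1 p1] cross[of p1 r2 p2] x
    by (intro add_mono mult_left_mono diff_mono)
      (simp_all add: inner_vel c1_def c2_def pw flip: x1_def x2_def)
  also have "\<dots> = (p1 - p2) \<bullet> (r1 *\<^sub>R vel r1 p1 - r2 *\<^sub>R vel r2 p2)"
    by (simp add: inner_diff algebra_simps)
  finally show ?thesis
    using radial_monotone[OF assms x] by (simp add: theta_def c1_def c2_def flip: x1_def x2_def)
qed

section \<open>Continuity and the resolvent of one cell\<close>

lemma continuous_on_powr_scaleR:
  fixes f :: "'a::topological_space \<Rightarrow> 'b::real_normed_vector"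
  assumes "continuous_on S f"
  shows "continuous_on S (\<lambda>x. norm (f x) powr (\<beta> - 2) *\<^sub>R f x)"
proof -
  have "continuous_on UNIV (\<lambda>y::'b. norm y powr (\<beta> - 2) *\<^sub>R y)"
    unfolding continuous_on_eq_continuous_within
  proof
    fix y :: 'b
    show "isCont (\<lambda>y. norm y powr (\<beta> - 2) *\<^sub>R y) y"
    proof (cases "y = 0")
      case False
      then show ?thesis by (intro continuous_intros) auto
    next
      \<comment> \<open>The exponent \<open>\<beta> - 2\<close> may be negative, but the product has
        norm \<open>norm z powr (\<beta> - 1)\<close>, which tends to 0.\<close>
      case True
      have "((\<lambda>z::'b. norm z powr (\<beta> - 2) *\<^sub>R z) \<longlongrightarrow> 0) (at 0)"
      proof (rule Lim_null_comparison)
        have "((\<lambda>z::'b. norm z powr (\<beta> - 1)) \<longlongrightarrow> norm (0::'b) powr (\<beta> - 1)) (at 0)"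
          by (intro tendsto_powr2 tendsto_intros) (use beta_gt_1 in auto)
        then show "((\<lambda>z::'b. norm z powr (\<beta> - 1)) \<longlongrightarrow> 0) (at 0)" by simp
        show "\<forall>\<^sub>F z::'b in at 0. norm (norm z powr (\<beta> - 2) *\<^sub>R z) \<le> norm z powr (\<beta> - 1)"
        proof (rule always_eventually, rule allI)
          fix z :: 'b
          show "norm (norm z powr (\<beta> - 2) *\<^sub>R z) \<le> norm z powr (\<beta> - 1)"
            using powr_add[of "norm z" "\<beta> - 2" 1] by (cases "z = 0") auto
        qed
      qed
      then show ?thesis using True by (simp add: isCont_def)
    qed
  qed
  from continuous_on_compose2[OF this assms] show ?thesis by simp
qed

lemma continuous_on_theta:
  assumes "continuous_on S r" "continuous_on S p" "\<And>x. x \<in> S \<Longrightarrow> 0 \<le> r x"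
  shows "continuous_on S (\<lambda>x. \<theta> (r x) (p x))"
proof -
  have pos: "r x + \<epsilon> > 0" if "x \<in> S" for x using assms(3)[OF that] eps_pos by simp
  have 1: "continuous_on S (\<lambda>x. norm (projK (p x)) powr \<beta>)"
    by (rule continuous_on_powr') (use beta_gt_1 in \<open>auto intro!: continuous_intros assms\<close>)
  have 2: "continuous_on S (\<lambda>x. (r x + \<epsilon>) powr \<alpha>)"
    by (rule continuous_on_powr') (use pos in \<open>force intro!: continuous_intros assms\<close>)+
  show ?thesis
    unfolding theta_def
    by (rule continuous_on_divide[OF 1 continuous_on_mult[OF continuous_on_const 2]])
      (use pos beta_gt_1 in force)
qed

lemma continuous_on_vel:
  assumes "continuous_on S r" "continuous_on S p" "\<And>x. x \<in> S \<Longrightarrow> 0 \<le> r x"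
  shows "continuous_on S (\<lambda>x. vel (r x) (p x))"
proof -
  have pos: "r x + \<epsilon> > 0" if "x \<in> S" for x using assms(3)[OF that] eps_pos by simp
  have "continuous_on S (\<lambda>x. (r x + \<epsilon>) powr \<alpha>)"
    by (rule continuous_on_powr') (use pos in \<open>force intro!: continuous_intros assms\<close>)+
  then have 1: "continuous_on S (\<lambda>x. 1 / (r x + \<epsilon>) powr \<alpha>)"
    by (rule continuous_on_divide[OF continuous_on_const]) (use pos in force)
  have "continuous_on S (\<lambda>x. (1 / (r x + \<epsilon>) powr \<alpha>) *\<^sub>R
      (norm (projK (p x)) powr (\<beta> - 2) *\<^sub>R projK (p x)))"
    by (rule continuous_on_scaleR[OF 1 continuous_on_powr_scaleR[OF continuous_on_projK[OF assms(2)]]])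
  then show ?thesis by (simp add: velocity_def)
qed

lemma norm_projK_le: "norm (projK p) \<le> norm p"
  unfolding norm_vec_def
  by (intro L2_set_mono) (auto simp: projK_nth max_def min_def)

lemma theta_le:
  assumes "\<eta> \<ge> 0" "norm p \<le> Q"
  shows "\<theta> \<eta> p \<le> Q powr \<beta> / (\<beta> * \<epsilon> powr \<alpha>)"
proof -
  have "norm (projK p) \<le> Q" using norm_projK_le[of p] assms(2) by linarith
  then have "norm (projK p) powr \<beta> \<le> Q powr \<beta>" using beta_gt_1 by (intro powr_mono2) auto
  moreover have "\<epsilon> powr \<alpha> \<le> (\<eta> + \<epsilon>) powr \<alpha>" using assms(1) eps_pos alpha_pos by (intro powr_mono2) auto
  ultimately show ?thesis
    unfolding theta_def using beta_gt_1 eps_pos by (intro frac_le) auto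
qed

text \<open>Eliminating \<open>a = (a0 - r) / \<sigma>\<close> leaves the unknowns \<open>r\<close>
  and \<open>p\<close>. With \<open>r\<close> truncated by \<open>prox\<close> and \<open>p\<close>
  by projection onto a ball, Brouwer's theorem applies, and a priori bounds show that neither
  truncation is active.\<close>

lemma cell_resolvent:
  assumes cvx: "convex_on {0..} \<Psi>" and cont: "continuous_on {0..} \<Psi>" and \<sigma>: "\<sigma> > 0"
  shows "\<exists>r a p. r + \<sigma> * a = a0 \<and> r *\<^sub>R vel r p + \<sigma> *\<^sub>R p = p0 \<and> subgrad_on {0..} \<Psi> r (a + \<theta> r p)"
proof -
  \<comment> \<open>Pairing the equation for \<open>p\<close> with \<open>p\<close> gives
    \<open>\<sigma> * norm p \<le> norm p0\<close>, because \<open>p \<bullet> vel r p\<close> is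
    nonnegative; the 1 makes the bound strict.\<close>
  define Q where "Q = norm p0 / \<sigma> + 1"
  \<comment> \<open>Larger than the subgradient condition at \<open>r = R\<close>, tested with the
    point 1, allows. The middle term is the bound of \<open>theta_le\<close> on the ball, the last
    one comes from \<open>convex_slope_lower_bound\<close>.\<close>
  define R where "R = 2 + \<bar>a0\<bar> + \<sigma> * (Q powr \<beta> / (\<beta> * \<epsilon> powr \<alpha>)) + \<sigma> * \<bar>\<Psi> 1 - \<Psi> 0\<bar>"
  have Q: "Q > 0" using \<sigma> by (simp add: Q_def add_nonneg_pos)
  have R1: "R > 1" using \<sigma> beta_gt_1 by (simp add: R_def add_pos_nonneg)
  then have R0: "R > 0" by simp
  define \<Phi> where "\<Phi> x = \<sigma> * \<Psi> x" for x
  have \<Phi>: "convex_on {0..} \<Phi>" "continuous_on {0..} \<Phi>"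
    unfolding \<Phi>_def using \<sigma> cvx cont by (auto intro!: convex_on_cmul continuous_intros)
  let ?S = "{0..R} \<times> cball (0::real^4) Q"
  define f where "f z = (prox R \<Phi> (a0 + \<sigma> * \<theta> (fst z) (snd z)),
      closest_point (cball 0 Q) (snd z - (fst z *\<^sub>R vel (fst z) (snd z) + \<sigma> *\<^sub>R snd z - p0)))" for z
  have B: "cball (0::real^4) Q \<noteq> {}" using Q by simp
  have "continuous_on ?S f"
    unfolding f_def
    by (intro continuous_on_Pair continuous_on_prox[OF \<Phi> R0] continuous_intros
        continuous_on_theta continuous_on_vel
        continuous_on_compose2[OF continuous_on_closest_point[OF convex_cball closed_cball B, of UNIV]])
      auto
  moreover have "f \<in> ?S \<rightarrow> ?S"
    using prox_subgrad[OF \<Phi> R0] closest_point_in_set[OF closed_cball B]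
    by (auto simp: f_def subgrad_on_def)
  ultimately obtain z where z: "z \<in> ?S" "f z = z"
    using brouwer[of ?S f] R0 Q by (auto simp: compact_Times convex_Times)
  define r p where "r = fst z" and "p = snd z"
  define u where "u = r *\<^sub>R vel r p + \<sigma> *\<^sub>R p - p0"
  have r: "0 \<le> r" "r \<le> R" and p: "norm p \<le> Q" using z(1) by (auto simp: r_def p_def)
  have pr: "prox R \<Phi> (a0 + \<sigma> * \<theta> r p) = r" and cp: "closest_point (cball 0 Q) (p - u) = p"
    using z(2) by (auto simp: f_def r_def p_def u_def prod_eq_iff)
  have proj: "u \<bullet> (y - p) \<ge> 0" if "norm y \<le> Q" for y
    using closest_point_dot[OF convex_cball closed_cball, of y 0 Q "p - u"] that by (simp add: cp)
  have pQ: "norm p < Q"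
  proof (cases "p = 0")
    case True then show ?thesis using Q by simp
  next
    case False
    have "u \<bullet> p \<le> 0" using proj[of 0] Q by simp
    then have "\<sigma> * (norm p)\<^sup>2 \<le> p0 \<bullet> p - r * (p \<bullet> vel r p)"
      by (simp add: u_def inner_simps power2_norm_eq_inner inner_commute algebra_simps)
    also have "\<dots> \<le> p0 \<bullet> p" using r by (simp add: inner_vel)
    also have "\<dots> \<le> norm p0 * norm p" by (rule norm_cauchy_schwarz)
    finally have "(\<sigma> * norm p) * norm p \<le> norm p0 * norm p" by (simp add: power2_eq_square mult.assoc)
    then have "\<sigma> * norm p \<le> norm p0" using False by simp
    then have "norm p \<le> norm p0 / \<sigma>" using \<sigma> by (simp add: field_simps)
    then show ?thesis by (simp add: Q_def)
  qed
  have u0: "u = 0" using pQ proj by (rule inward_normal_eq_0)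
  have sub: "subgrad_on {0..R} \<Phi> r (a0 + \<sigma> * \<theta> r p - r)"
    using prox_subgrad[OF \<Phi> R0, of "a0 + \<sigma> * \<theta> r p"] by (simp add: pr)
  have "r < R"
  proof (rule ccontr)
    assume "\<not> r < R" then have rR: "r = R" using r by simp
    have "\<Phi> R + (a0 + \<sigma> * \<theta> R p - R) * (1 - R) \<le> \<Phi> 1"
      using sub R1 by (auto simp: subgrad_on_def rR)
    moreover have "\<Phi> 1 + \<sigma> * (\<Psi> 1 - \<Psi> 0) * (R - 1) \<le> \<Phi> R"
      using mult_left_mono[OF convex_slope_lower_bound[OF cvx R1], of \<sigma>] \<sigma>
      by (simp add: \<Phi>_def algebra_simps)
    ultimately have "0 \<le> (a0 + \<sigma> * \<theta> R p - R - \<sigma> * (\<Psi> 1 - \<Psi> 0)) * (R - 1)"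
      by (simp add: algebra_simps)
    then have "0 \<le> a0 + \<sigma> * \<theta> R p - R - \<sigma> * (\<Psi> 1 - \<Psi> 0)" using R1 by (simp add: zero_le_mult_iff)
    moreover have "\<sigma> * \<theta> R p \<le> \<sigma> * (Q powr \<beta> / (\<beta> * \<epsilon> powr \<alpha>))"
      using theta_le[OF _ p] R0 \<sigma> by (intro mult_left_mono) auto
    moreover have "- (\<sigma> * (\<Psi> 1 - \<Psi> 0)) \<le> \<sigma> * \<bar>\<Psi> 1 - \<Psi> 0\<bar>"
      using \<sigma> by (metis abs_ge_minus_self mult_le_cancel_left_pos mult_minus_right)
    ultimately show False unfolding R_def by linarith
  qed
  then have sub': "subgrad_on {0..} \<Phi> r (a0 + \<sigma> * \<theta> r p - r)"
    by (rule subgrad_on_extend[OF \<Phi>(1) sub])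
  have "subgrad_on {0..} \<Psi> r ((a0 - r) / \<sigma> + \<theta> r p)"
    unfolding subgrad_on_def
  proof (intro conjI ballI)
    show "r \<in> {0..}" using r by simp
    fix y :: real assume "y \<in> {0..}"
    then have "\<sigma> * \<Psi> r + (a0 + \<sigma> * \<theta> r p - r) * (y - r) \<le> \<sigma> * \<Psi> y"
      using sub' by (auto simp: subgrad_on_def \<Phi>_def)
    moreover have "\<sigma> * (\<Psi> r + ((a0 - r) / \<sigma> + \<theta> r p) * (y - r))
        = \<sigma> * \<Psi> r + (a0 + \<sigma> * \<theta> r p - r) * (y - r)"
      using \<sigma> by (simp add: field_simps)
    ultimately have "\<sigma> * (\<Psi> r + ((a0 - r) / \<sigma> + \<theta> r p) * (y - r)) \<le> \<sigma> * \<Psi> y"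
      by linarith
    then show "\<Psi> r + ((a0 - r) / \<sigma> + \<theta> r p) * (y - r) \<le> \<Psi> y" using \<sigma> by simp
  qed
  moreover have "r + \<sigma> * ((a0 - r) / \<sigma>) = a0" using \<sigma> by simp
  moreover have "r *\<^sub>R vel r p + \<sigma> *\<^sub>R p = p0" using u0 by (simp add: u_def)
  ultimately show ?thesis by blast
qed

end

section \<open>Grid operators and their adjoints\<close>

lemma of_int_mod_ring_add: "of_int_mod_ring (a + b) = of_int_mod_ring a + (of_int_mod_ring b :: 'a::finite mod_ring)"
  by transfer (simp add: mod_simps)

lemma to_int_mod_ring_bounds: "0 \<le> to_int_mod_ring (k :: 'a::finite mod_ring)"
  "to_int_mod_ring (k :: 'a::finite mod_ring) < int CARD('a)"
  using range_to_int_mod_ring[where 'a = 'a] by (metis atLeastLessThan_iff rangeI)+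

lemma to_int_mod_ring_inject: "to_int_mod_ring a = to_int_mod_ring b \<longleftrightarrow> a = b"
  by (metis of_int_mod_ring_to_int_mod_ring)

lemma to_int_level [simp]: "to_int_mod_ring (level k) = to_int_mod_ring (k :: 't::finite mod_ring)"
  unfolding level_def
  by (rule to_int_mod_ring_of_int_mod_ring)
    (use to_int_mod_ring_bounds[of k] in \<open>auto simp: card_option\<close>)

lemma to_int_next_level [simp]:
  "to_int_mod_ring (next_level k) = to_int_mod_ring (k :: 't::finite mod_ring) + 1"
  unfolding next_level_def
  by (rule to_int_mod_ring_of_int_mod_ring)
    (use to_int_mod_ring_bounds[of k] in \<open>auto simp: card_option\<close>)

lemma to_int_final_level [simp]:
  "to_int_mod_ring (final_level :: 't::finite option mod_ring) = int CARD('t)"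
  unfolding final_level_def
  by (rule to_int_mod_ring_of_int_mod_ring) (auto simp: card_option)

text \<open>Inverse to \<open>next_level\<close> away from level 0; at level 0 it wraps around to
  the last step.\<close>

definition prev_step :: "'t::finite option mod_ring \<Rightarrow> 't mod_ring" where
  "prev_step l = of_int_mod_ring (to_int_mod_ring l - 1)"

lemma prev_step_next_level [simp]: "prev_step (next_level k) = k"
  by (simp add: prev_step_def)

lemma next_level_neq_0 [simp]: "next_level k \<noteq> 0"
proof
  assume "next_level k = 0"
  then have "to_int_mod_ring (next_level k) = 0" by simp
  then show False using to_int_mod_ring_bounds(1)[of k] by (simp del: to_int_mod_ring_hom.hom_0_iff)
qed

lemma level_neq_final [simp]: "level k \<noteq> final_level" "final_level \<noteq> level k"
  by (metis less_irrefl to_int_final_level to_int_level to_int_mod_ring_bounds(2))+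

lemma next_level_surj: "l \<noteq> 0 \<Longrightarrow> next_level (prev_step l) = l"
proof -
  assume "l \<noteq> 0"
  then have "to_int_mod_ring l \<noteq> 0"
    by (metis to_int_mod_ring_hom.hom_zero to_int_mod_ring_inject)
  then have "to_int_mod_ring l > 0" using to_int_mod_ring_bounds(1)[of l] by linarith
  then have "to_int_mod_ring (prev_step l) = to_int_mod_ring l - 1"
    unfolding prev_step_def using to_int_mod_ring_bounds[of l]
    by (intro to_int_mod_ring_of_int_mod_ring) (auto simp: card_option)
  then show ?thesis by (simp flip: to_int_mod_ring_inject)
qed

lemma level_surj:
  fixes l :: "'t::finite option mod_ring"
  assumes "l \<noteq> final_level"
  shows "level (of_int_mod_ring (to_int_mod_ring l)) = l"
proof -
  have "to_int_mod_ring l \<noteq> int CARD('t)"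
    using assms by (metis to_int_final_level to_int_mod_ring_inject)
  then have "to_int_mod_ring (of_int_mod_ring (to_int_mod_ring l) :: 't mod_ring) = to_int_mod_ring l"
    using to_int_mod_ring_bounds[of l]
    by (intro to_int_mod_ring_of_int_mod_ring) (auto simp: card_option)
  then show ?thesis by (simp flip: to_int_mod_ring_inject)
qed

text \<open>Together with \<open>sum_levels\<close> this is summation by parts in time: the next
  levels of the steps omit level 0, their own levels omit the final one.\<close>

lemma sum_next_levels: "(\<Sum>l\<in>UNIV. f l) = f 0 + (\<Sum>k\<in>UNIV. f (next_level k))"
proof -
  have "bij_betw next_level UNIV (- {0})"
    by (rule bij_betw_byWitness[where f' = prev_step]) (auto simp: next_level_surj)
  then have "(\<Sum>k\<in>UNIV. f (next_level k)) = sum f (- {0})"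
    by (rule sum.reindex_bij_betw)
  then show ?thesis by (subst sum.remove[of UNIV 0]) (auto simp: Compl_eq_Diff_UNIV)
qed

lemma sum_levels: "(\<Sum>l\<in>UNIV. f l) = f final_level + (\<Sum>k\<in>UNIV. f (level k))"
proof -
  have "bij_betw level UNIV (- {final_level})"
    by (rule bij_betw_byWitness[where f' = "\<lambda>l. of_int_mod_ring (to_int_mod_ring l)"])
      (auto simp: level_surj)
  then have "(\<Sum>k\<in>UNIV. f (level k)) = sum f (- {final_level})"
    by (rule sum.reindex_bij_betw)
  then show ?thesis by (subst sum.remove[of UNIV final_level]) (auto simp: Compl_eq_Diff_UNIV)
qed

lemma level_induct:
  assumes "P 0" "\<And>k. P (level k) \<Longrightarrow> P (next_level k)"
  shows "P l"
proof (induction "nat (to_int_mod_ring l)" arbitrary: l)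
  case 0
  then have "to_int_mod_ring l = 0" using to_int_mod_ring_bounds(1)[of l] by simp
  then have "l = 0" by simp
  then show ?case using assms(1) by simp
next
  case (Suc n)
  then have "l \<noteq> 0" by auto
  then have l: "next_level (prev_step l) = l" by (rule next_level_surj)
  have "n = nat (to_int_mod_ring (level (prev_step l)))"
    using Suc(2) to_int_next_level[of "prev_step l"] by (simp add: l)
  from Suc(1)[OF this] show ?case using assms(2) l by metis
qed

lemma level_back_induct:
  fixes l :: "'t::finite option mod_ring"
  assumes "P final_level" "\<And>k. P (next_level k) \<Longrightarrow> P (level k)"
  shows "P l"
proof (induction "nat (int CARD('t) - to_int_mod_ring l)" arbitrary: l)
  case 0
  then have "to_int_mod_ring l = int CARD('t)"
    using to_int_mod_ring_bounds(2)[of l] by (simp add: card_option)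
  then have "l = final_level" by (simp flip: to_int_mod_ring_inject)
  then show ?case using assms(1) by simp
next
  case (Suc n)
  then have "l \<noteq> final_level" by auto
  then obtain k where l: "l = level k" by (metis level_surj)
  have "n = nat (int CARD('t) - to_int_mod_ring (next_level k))"
    using Suc(2) to_int_mod_ring_bounds(2)[of k] by (simp add: l)
  from Suc(1)[OF this] show ?case using assms(2) l by metis
qed

lemma up_dn [simp]: "up (dn i) = i" "dn (up i) = i"
  by (simp_all add: up_def dn_def)

lemma sum_up: "(\<Sum>i\<in>UNIV. f (up i)) = (\<Sum>i\<in>UNIV. f i)"
  by (rule sum.reindex_bij_betw, rule bij_betw_byWitness[where f' = dn]) auto

lemma sum_dn: "(\<Sum>i\<in>UNIV. f (dn i)) = (\<Sum>i\<in>UNIV. f i)"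
  by (rule sum.reindex_bij_betw, rule bij_betw_byWitness[where f' = up]) auto

text \<open>The unit step generates the cyclic group, so one starting point and one direction reach
  every index.\<close>

lemma up_reach:
  assumes "P i0" "\<And>i. P i \<Longrightarrow> P (up i)"
  shows "P (i :: 'n::finite mod_ring)"
proof -
  have "P (i0 + of_int_mod_ring (int n))" for n
  proof (induction n)
    case 0 show ?case using assms(1) by simp
  next
    case (Suc n)
    have "i0 + of_int_mod_ring (int (Suc n)) = up (i0 + of_int_mod_ring (int n))"
      unfolding up_def of_nat_Suc add.assoc of_int_mod_ring_add by (simp add: add.commute)
    then show ?case using assms(2)[OF Suc] by simp
  qed
  from this[of "nat (to_int_mod_ring (i - i0))"] show ?thesis
    by (simp add: to_int_mod_ring_bounds)
qed

text \<open>The cell \<open>(k, i, j)\<close> carries the flux of time step \<open>k\<close> and the density at level \<open>k + 1\<close>, the two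
  being coupled in the energy; the density at level 0 belongs to no cell.\<close>

type_synonym ('t, 'n) cell = "'t mod_ring \<times> 'n mod_ring \<times> 'n mod_ring"

definition cellM :: "('t::finite, 'n::finite) Mspace \<Rightarrow> ('t, 'n) cell \<Rightarrow> real" where
  "cellM \<rho> = (\<lambda>(k, i, j). \<rho> $ next_level k $ i $ j)"

definition cellW :: "('t::finite, 'n::finite) Wspace \<Rightarrow> ('t, 'n) cell \<Rightarrow> real ^ 4" where
  "cellW w = (\<lambda>(k, i, j). w $ k $ i $ j)"

definition mkM :: "'n::finite slice \<Rightarrow> (('t::finite, 'n) cell \<Rightarrow> real) \<Rightarrow> ('t, 'n) Mspace" where
  "mkM s f = (\<chi> l. if l = 0 then s else (\<chi> i j. f (prev_step l, i, j)))"

definition mkW :: "(('t::finite, 'n::finite) cell \<Rightarrow> real ^ 4) \<Rightarrow> ('t, 'n) Wspace" where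
  "mkW g = (\<chi> k i j. g (k, i, j))"

lemma cellM_mkM [simp]: "cellM (mkM s f) c = f c"
  by (cases c) (simp add: cellM_def mkM_def)

lemma mkM_0 [simp]: "mkM s f $ 0 = s"
  by (simp add: mkM_def)

lemma cellW_mkW [simp]: "cellW (mkW g) c = g c"
  by (cases c) (simp add: cellW_def mkW_def)

lemma cellM_arith [simp]: "cellM (a + b) c = cellM a c + cellM b c"
  "cellM (a - b) c = cellM a c - cellM b c" "cellM (r *\<^sub>R a) c = r * cellM a c"
  by (simp_all add: cellM_def split: prod.split)

lemma cellW_arith [simp]: "cellW (a + b) c = cellW a c + cellW b c"
  "cellW (a - b) c = cellW a c - cellW b c" "cellW (r *\<^sub>R a) c = r *\<^sub>R cellW a c"
  by (simp_all add: cellW_def split: prod.split)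

lemma continuous_on_cellM [continuous_intros]:
  "continuous_on S f \<Longrightarrow> continuous_on S (\<lambda>x. cellM (f x) c)"
  unfolding cellM_def by (cases c) (auto intro!: continuous_intros)

lemma continuous_on_cellW [continuous_intros]:
  "continuous_on S f \<Longrightarrow> continuous_on S (\<lambda>x. cellW (f x) c)"
  unfolding cellW_def by (cases c) (auto intro!: continuous_intros)

lemma Mspace_eqI: "\<rho> $ 0 = \<rho>' $ 0 \<Longrightarrow> (\<And>c. cellM \<rho> c = cellM \<rho>' c) \<Longrightarrow> \<rho> = \<rho>'"
  unfolding vec_eq_iff[of \<rho> \<rho>']
proof
  fix l assume 0: "\<rho> $ 0 = \<rho>' $ 0" and c: "\<And>c. cellM \<rho> c = cellM \<rho>' c"
  show "\<rho> $ l = \<rho>' $ l"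
  proof (cases "l = 0")
    case False
    then have l: "next_level (prev_step l) = l" by (rule next_level_surj)
    have "\<rho> $ l $ i $ j = \<rho>' $ l $ i $ j" for i j
      using c[of "(prev_step l, i, j)"] by (simp add: cellM_def l)
    then show ?thesis by (simp add: vec_eq_iff)
  qed (simp add: 0)
qed

lemma Wspace_eqI: "(\<And>c. cellW w c = cellW w' c) \<Longrightarrow> w = w'"
proof -
  assume c: "\<And>c. cellW w c = cellW w' c"
  have "w $ k $ i $ j = w' $ k $ i $ j" for k i j
    using c[of "(k, i, j)"] by (simp add: cellW_def)
  then show "w = w'" by (metis vec_eq_iff)
qed

lemma sum_cells: "(\<Sum>c\<in>UNIV. f c) = (\<Sum>k\<in>UNIV. \<Sum>i\<in>UNIV. \<Sum>j\<in>UNIV. f (k, i, j))"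
  by (simp add: sum.cartesian_product UNIV_Times_UNIV[symmetric] split_def del: UNIV_Times_UNIV)

lemma inner_slice: "(u :: 'n::finite slice) \<bullet> v = (\<Sum>i\<in>UNIV. \<Sum>j\<in>UNIV. u $ i $ j * v $ i $ j)"
  by (simp add: inner_vec_def)

lemma inner_Mspace: "\<rho> \<bullet> a = \<rho> $ 0 \<bullet> a $ 0 + (\<Sum>c\<in>UNIV. cellM \<rho> c * cellM a c)"
  unfolding inner_vec_def[of \<rho> a]
  by (subst sum_next_levels) (simp add: inner_slice sum_cells cellM_def)

lemma inner_Wspace: "w \<bullet> p = (\<Sum>c\<in>UNIV. cellW w c \<bullet> cellW p c)"
  unfolding inner_vec_def[of w p] inner_vec_def[of "w $ _"] inner_vec_def[of "w $ _ $ _" "_ $ _ $ _"]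
  by (simp add: sum_cells cellW_def inner_vec_def)

section \<open>Linearity and adjoints of the grid operators\<close>

lemma linear_Lap: "linear (Lap h)"
  by (rule linearI) (simp_all add: Lap_def vec_eq_iff algebra_simps flip: add_divide_distrib)

lemma linear_opA: "linear (opA \<nu> h dt)"
  by (rule linearI)
    (simp_all add: opA_def Dt_def vec_eq_iff linear_add[OF linear_Lap] linear_scale[OF linear_Lap]
      algebra_simps add_divide_distrib diff_divide_distrib)

lemma linear_opB: "linear (opB h)"
  by (rule linearI)
    (simp_all add: opB_def D1_def D2_def wcomp_def vec_eq_iff algebra_simps add_divide_distrib diff_divide_distrib)

lemma opA_nth: "opA \<nu> h dt \<rho> $ k =
    (1 / dt) *\<^sub>R (\<rho> $ next_level k - \<rho> $ level k) - \<nu> *\<^sub>R Lap h (\<rho> $ next_level k)"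
  by (simp add: opA_def Dt_def vec_eq_iff)

text \<open>Under summation over the cyclic indices, opposite shifts are exchanged.\<close>

lemma inner_Lap:
  fixes u v :: "'n::finite slice"
  shows "Lap h u \<bullet> v = u \<bullet> Lap h v"
proof -
  have 1: "(\<Sum>i\<in>UNIV. \<Sum>j\<in>UNIV. u $ dn i $ j * v $ i $ j) = (\<Sum>i\<in>UNIV. \<Sum>j\<in>UNIV. u $ i $ j * v $ up i $ j)"
    for u v :: "'n slice"
    using sum_up[of "\<lambda>i. \<Sum>j\<in>UNIV. u $ dn i $ j * v $ i $ j"] by simp
  have 2: "(\<Sum>i\<in>UNIV. \<Sum>j\<in>UNIV. u $ i $ dn j * v $ i $ j) = (\<Sum>i\<in>UNIV. \<Sum>j\<in>UNIV. u $ i $ j * v $ i $ up j)"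
    for u v :: "'n slice"
    by (rule sum.cong[OF refl], subst sum_up[symmetric]) simp
  have 3: "Lap h u \<bullet> v = ((\<Sum>i\<in>UNIV. \<Sum>j\<in>UNIV. u $ dn i $ j * v $ i $ j)
      + (\<Sum>i\<in>UNIV. \<Sum>j\<in>UNIV. u $ up i $ j * v $ i $ j)
      + (\<Sum>i\<in>UNIV. \<Sum>j\<in>UNIV. u $ i $ dn j * v $ i $ j)
      + (\<Sum>i\<in>UNIV. \<Sum>j\<in>UNIV. u $ i $ up j * v $ i $ j)
      - 4 * (\<Sum>i\<in>UNIV. \<Sum>j\<in>UNIV. u $ i $ j * v $ i $ j)) / (4 * h\<^sup>2)" for u v :: "'n slice"
    unfolding inner_slice Lap_def
    by (simp add: sum_divide_distrib[symmetric] sum.distrib sum_subtractf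
        algebra_simps diff_divide_distrib add_divide_distrib flip: sum_distrib_left)
  have "u \<bullet> Lap h v = Lap h v \<bullet> u" by (rule inner_commute)
  then show ?thesis
    unfolding 3 using 1[of u v] 2[of u v] 1[of v u] 2[of v u] by (simp add: mult.commute)
qed

text \<open>The adjoint of the time difference involves \<open>\<phi>\<close> with the value zero at the final level.\<close>

definition ext0 :: "('t::finite, 'n::finite) Uspace \<Rightarrow> ('t, 'n) Mspace" where
  "ext0 \<phi> = (\<chi> l. if l = final_level then 0 else \<phi> $ of_int_mod_ring (to_int_mod_ring l))"

lemma ext0_level [simp]: "ext0 \<phi> $ level k = \<phi> $ k" "ext0 \<phi> $ final_level = 0"
  by (simp_all add: ext0_def)

text \<open>Level 0 is left out: with the initial slice prescribed, that component of a subgradient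
  is unconstrained, see \<open>opK_iff\<close>.\<close>

lemma adjoint_opA_nth:
  fixes \<phi> :: "('t::finite, 'n::finite) Uspace"
  shows "adjoint (opA \<nu> h dt) \<phi> $ next_level k =
     (1 / dt) *\<^sub>R (\<phi> $ k - ext0 \<phi> $ next_level k) - \<nu> *\<^sub>R Lap h (\<phi> $ k)"
proof -
  define Z :: "('t, 'n) Uspace \<Rightarrow> ('t, 'n) Mspace" where
    "Z \<phi> = (\<chi> l. if l = 0 then - ((1 / dt) *\<^sub>R ext0 \<phi> $ 0) else
      (1 / dt) *\<^sub>R (\<phi> $ prev_step l - ext0 \<phi> $ l) - \<nu> *\<^sub>R Lap h (\<phi> $ prev_step l))" for \<phi>
  have "opA \<nu> h dt \<rho> \<bullet> \<phi> = \<rho> \<bullet> Z \<phi>" for \<rho> \<phi>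
  proof -
    have "(\<Sum>k\<in>UNIV. \<rho> $ level k \<bullet> \<phi> $ k) = (\<Sum>l\<in>UNIV. \<rho> $ l \<bullet> ext0 \<phi> $ l)"
      by (subst sum_levels) simp
    also have "\<dots> = \<rho> $ 0 \<bullet> ext0 \<phi> $ 0 + (\<Sum>k\<in>UNIV. \<rho> $ next_level k \<bullet> ext0 \<phi> $ next_level k)"
      by (rule sum_next_levels)
    finally have *: "(\<Sum>k\<in>UNIV. \<rho> $ level k \<bullet> \<phi> $ k) = \<dots>" .
    have "opA \<nu> h dt \<rho> \<bullet> \<phi> = (\<Sum>k\<in>UNIV. \<rho> $ next_level k \<bullet> \<phi> $ k) / dt
        - (\<Sum>k\<in>UNIV. \<rho> $ level k \<bullet> \<phi> $ k) / dt - \<nu> * (\<Sum>k\<in>UNIV. \<rho> $ next_level k \<bullet> Lap h (\<phi> $ k))"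
      unfolding inner_vec_def[of _ \<phi>] opA_nth
      by (simp add: inner_simps inner_Lap sum.distrib sum_subtractf sum_divide_distrib
          sum_distrib_left diff_divide_distrib)
    also have "\<dots> = \<rho> \<bullet> Z \<phi>"
      unfolding inner_vec_def[of \<rho> "Z \<phi>"]
      by (subst sum_next_levels, subst *)
        (simp add: Z_def inner_simps sum.distrib sum_subtractf sum_divide_distrib
          sum_distrib_left diff_divide_distrib add_divide_distrib)
    finally show ?thesis .
  qed
  then have "adjoint (opA \<nu> h dt) = Z" by (intro adjoint_unique allI)
  then show ?thesis by (simp add: Z_def)
qed

lemma vector_4:
  fixes x y z w :: "'a::zero"
  shows "(vector [x, y, z, w] :: 'a ^ 4) $ 1 = x" "(vector [x, y, z, w] :: 'a ^ 4) $ 2 = y"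
    "(vector [x, y, z, w] :: 'a ^ 4) $ 3 = z" "(vector [x, y, z, w] :: 'a ^ 4) $ 4 = w"
  by (simp_all add: vector_def)

lemma Dh_nth:
  "Dh h u i j $ 1 = (u $ up i $ j - u $ i $ j) / h" "Dh h u i j $ 2 = (u $ i $ j - u $ dn i $ j) / h"
  "Dh h u i j $ 3 = (u $ i $ up j - u $ i $ j) / h" "Dh h u i j $ 4 = (u $ i $ j - u $ i $ dn j) / h"
  by (simp_all add: Dh_def D1_def D2_def vector_4)

text \<open>Summation by parts, by shifting cyclic indices. The minus sign is the reason why
  \<open>theta\<close> is the Hamiltonian at the negated momentum.\<close>

lemma cellW_adjoint_opB:
  fixes \<phi> :: "('t::finite, 'n::finite) Uspace"
  shows "cellW (adjoint (opB h) \<phi>) (k, i, j) = - Dh h (\<phi> $ k) i j"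
proof -
  define Z :: "('t, 'n) Uspace \<Rightarrow> ('t, 'n) Wspace" where
    "Z \<phi> = (\<chi> k i j. - Dh h (\<phi> $ k) i j)" for \<phi>
  have "opB h w \<bullet> \<phi> = w \<bullet> Z \<phi>" for w \<phi>
  proof -
    have "opB h w $ k \<bullet> \<phi> $ k = (\<Sum>i\<in>UNIV. \<Sum>j\<in>UNIV. w $ k $ i $ j \<bullet> (- Dh h (\<phi> $ k) i j))" for k
    proof -
      let ?w = "\<lambda>m i j. w $ k $ i $ j $ m" and ?f = "\<lambda>i j. \<phi> $ k $ i $ j"
      have 1: "(\<Sum>i\<in>UNIV. \<Sum>j\<in>UNIV. ?w 1 (dn i) j * ?f i j) = (\<Sum>i\<in>UNIV. \<Sum>j\<in>UNIV. ?w 1 i j * ?f (up i) j)"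
        by (subst sum_up[symmetric]) simp
      have 2: "(\<Sum>i\<in>UNIV. \<Sum>j\<in>UNIV. ?w 2 (up i) j * ?f i j) = (\<Sum>i\<in>UNIV. \<Sum>j\<in>UNIV. ?w 2 i j * ?f (dn i) j)"
        by (subst sum_dn[symmetric]) simp
      have 3: "(\<Sum>i\<in>UNIV. \<Sum>j\<in>UNIV. ?w 3 i (dn j) * ?f i j) = (\<Sum>i\<in>UNIV. \<Sum>j\<in>UNIV. ?w 3 i j * ?f i (up j))"
        by (rule sum.cong[OF refl], subst sum_up[symmetric]) simp
      have 4: "(\<Sum>i\<in>UNIV. \<Sum>j\<in>UNIV. ?w 4 i (up j) * ?f i j) = (\<Sum>i\<in>UNIV. \<Sum>j\<in>UNIV. ?w 4 i j * ?f i (dn j))"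
        by (rule sum.cong[OF refl], subst sum_dn[symmetric]) simp
      have "opB h w $ k \<bullet> \<phi> $ k = ((\<Sum>i\<in>UNIV. \<Sum>j\<in>UNIV. ?w 1 i j * ?f i j)
          - (\<Sum>i\<in>UNIV. \<Sum>j\<in>UNIV. ?w 1 (dn i) j * ?f i j)
          + (\<Sum>i\<in>UNIV. \<Sum>j\<in>UNIV. ?w 2 (up i) j * ?f i j) - (\<Sum>i\<in>UNIV. \<Sum>j\<in>UNIV. ?w 2 i j * ?f i j)
          + (\<Sum>i\<in>UNIV. \<Sum>j\<in>UNIV. ?w 3 i j * ?f i j) - (\<Sum>i\<in>UNIV. \<Sum>j\<in>UNIV. ?w 3 i (dn j) * ?f i j)
          + (\<Sum>i\<in>UNIV. \<Sum>j\<in>UNIV. ?w 4 i (up j) * ?f i j) - (\<Sum>i\<in>UNIV. \<Sum>j\<in>UNIV. ?w 4 i j * ?f i j)) / h"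
        unfolding inner_slice opB_def D1_def D2_def wcomp_def
        by (simp add: sum_divide_distrib[symmetric] sum.distrib sum_subtractf
            algebra_simps diff_divide_distrib add_divide_distrib)
      also have "\<dots> = (\<Sum>i\<in>UNIV. \<Sum>j\<in>UNIV. w $ k $ i $ j \<bullet> (- Dh h (\<phi> $ k) i j))"
        unfolding 1 2 3 4 inner_vec_def[of "_ $ _ $ _ $ _"] sum_4
        by (simp add: Dh_nth sum_divide_distrib[symmetric] sum.distrib sum_subtractf sum_negf
            algebra_simps diff_divide_distrib add_divide_distrib)
      finally show ?thesis .
    qed
    then show ?thesis
      unfolding inner_vec_def[of _ \<phi>] inner_vec_def[of w] Z_def inner_vec_def[of "w $ _"]
      by (simp add: inner_vec_def)
  qed
  then have "adjoint (opB h) = Z" by (intro adjoint_unique allI)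
  then show ?thesis by (simp add: Z_def cellW_def)
qed

section \<open>The subdifferential operator\<close>

abbreviation one_slice :: "'n::finite slice" where "one_slice \<equiv> \<chi> i j. 1"

lemma Lap_const: "Lap h (\<chi> i j. c) = 0"
  by (simp add: Lap_def vec_eq_iff)

lemma Dh_const: "Dh h (\<chi> i j. c) i j = 0"
  unfolding vec_eq_iff forall_4 by (simp add: Dh_nth)

lemma mass_Lap: "Lap h u \<bullet> one_slice = 0"
  by (simp add: inner_Lap Lap_const)

text \<open>Test with the function that is 1 at step \<open>k\<close> and 0 at the other steps:
  being constant in space, it is annihilated by the adjoint of \<open>opB\<close>.\<close>

lemma mass_opB:
  fixes w :: "('t::finite, 'n::finite) Wspace"
  shows "opB h w $ k \<bullet> one_slice = 0"
proof -
  define \<phi> :: "('t, 'n) Uspace" where "\<phi> = (\<chi> k'. if k' = k then one_slice else \<chi> i j. 0)"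
  have "cellW (adjoint (opB h) \<phi>) c = 0" for c
  proof (cases c)
    case (fields k' i j)
    then show ?thesis by (cases "k' = k") (simp_all add: cellW_adjoint_opB \<phi>_def Dh_const)
  qed
  then have "w \<bullet> adjoint (opB h) \<phi> = 0" by (simp add: inner_Wspace)
  then have "opB h w \<bullet> \<phi> = 0" by (simp add: adjoint_works[OF linear_opB])
  moreover have "opB h w \<bullet> \<phi> = (\<Sum>k'\<in>UNIV. if k' = k then opB h w $ k \<bullet> one_slice else 0)"
    unfolding inner_vec_def[of _ \<phi>]
    by (intro sum.cong refl) (simp add: \<phi>_def inner_slice)
  ultimately show ?thesis by simp
qed

lemma mass_conserved:
  assumes "opA \<nu> h dt \<rho> + opB h w = 0" "dt > 0"
  shows "\<rho> $ l \<bullet> one_slice = \<rho> $ 0 \<bullet> one_slice"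
proof (induction l rule: level_induct)
  case (2 k)
  have "(opA \<nu> h dt \<rho> $ k + opB h w $ k) \<bullet> one_slice = 0"
    using assms(1) by (metis inner_zero_left vector_add_component zero_index)
  then have "(\<rho> $ next_level k - \<rho> $ level k) \<bullet> one_slice = 0"
    using \<open>dt > 0\<close> by (simp add: opA_nth inner_simps mass_opB mass_Lap)
  then show ?case using 2 by (simp add: inner_diff_left)
qed simp

lemma opB_const: "opB h (mkW (\<lambda>c. v)) = 0"
  by (simp add: opB_def mkW_def D1_def D2_def wcomp_def vec_eq_iff)

text \<open>The forward differences vanish in both directions, and \<open>up_reach\<close> connects
  all nodes.\<close>

lemma adjoint_opB_eq_0_imp:
  assumes "adjoint (opB h) \<phi> = 0" "h > 0"
  shows "\<phi> $ k $ i $ j = \<phi> $ k $ 0 $ 0"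
proof -
  have D: "Dh h (\<phi> $ k) i j = 0" for i j
    using cellW_adjoint_opB[of h \<phi> k i j] by (simp add: assms(1) cellW_def)
  have "Dh h (\<phi> $ k) i j $ 1 = 0" "Dh h (\<phi> $ k) i j $ 3 = 0" for i j using D by simp_all
  then have s: "\<phi> $ k $ up i $ j = \<phi> $ k $ i $ j" "\<phi> $ k $ i $ up j = \<phi> $ k $ i $ j" for i j
    using \<open>h > 0\<close> by (simp_all add: Dh_nth)
  have "\<phi> $ k $ i $ j = \<phi> $ k $ 0 $ j"
    by (rule up_reach[where ?i0.0 = 0 and P = "\<lambda>i. \<phi> $ k $ i $ j = \<phi> $ k $ 0 $ j"]) (simp_all add: s)
  also have "\<dots> = \<phi> $ k $ 0 $ 0"
    by (rule up_reach[where ?i0.0 = 0 and P = "\<lambda>j. \<phi> $ k $ 0 $ j = \<phi> $ k $ 0 $ 0"]) (simp_all add: s)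
  finally show ?thesis .
qed

text \<open>The final density level belongs to the cells of the last step, so the terminal cost,
  with its weight \<open>1 / dt\<close>, is added to the running cost there.\<close>

definition potential ::
  "real \<Rightarrow> real \<Rightarrow> (real \<Rightarrow> real \<times> real \<Rightarrow> real \<Rightarrow> real) \<Rightarrow> (real \<times> real \<Rightarrow> real \<Rightarrow> real) \<Rightarrow>
    ('t::finite, 'n::finite) cell \<Rightarrow> real \<Rightarrow> real" where
  "potential h dt F G = (\<lambda>(k, i, j) r. F (grid_time dt k) (grid_point h i j) r
     + (if next_level k = (final_level :: 't option mod_ring) then 1 / dt * G (grid_point h i j) r else 0))"

text \<open>\<open>\<Psi>\<close> is a parameter tied to \<open>potential\<close> by an equation, so
  that convexity and continuity can be assumed of it directly. Nonnegativity and positive mass of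
  the initial slice are what the cell averages of a torus density provide.\<close>

locale mfg_grid = congestion +
  fixes \<nu> h dt :: real and F :: "real \<Rightarrow> real \<times> real \<Rightarrow> real \<Rightarrow> real"
    and G :: "real \<times> real \<Rightarrow> real \<Rightarrow> real" and r0 :: "'n::finite slice"
    and \<Psi> :: "('t::finite, 'n) cell \<Rightarrow> real \<Rightarrow> real"
  assumes h_pos: "h > 0" and dt_pos: "dt > 0"
    and r0_nonneg: "0 \<le> r0 $ i $ j" and mass_pos: "0 < r0 \<bullet> one_slice"
    and Psi_def: "\<Psi> = potential h dt F G"
    and Psi_convex: "convex_on {0..} (\<Psi> c)" and Psi_cont: "continuous_on {0..} (\<Psi> c)"
begin

abbreviation "A \<equiv> (opA \<nu> h dt :: ('t, 'n) Mspace \<Rightarrow> ('t, 'n) Uspace)"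
abbreviation "B \<equiv> (opB h :: ('t, 'n) Wspace \<Rightarrow> ('t, 'n) Uspace)"
abbreviation "K \<equiv> (opK h dt \<epsilon> \<beta> \<alpha> F G r0 ::
  ('t, 'n) Mspace \<times> ('t, 'n) Wspace \<Rightarrow> (('t, 'n) Mspace \<times> ('t, 'n) Wspace) set)"

section \<open>Cellwise description and maximality of \<open>opK\<close>\<close>

definition admissible :: "('t, 'n) Mspace \<Rightarrow> ('t, 'n) Wspace \<Rightarrow> bool" where
  "admissible \<rho> w \<longleftrightarrow> \<rho> $ 0 = r0 \<and> (\<forall>c. energy_dom (cellM \<rho> c) (cellW w c))"

lemma J_eq:
  "J h dt \<epsilon> \<beta> \<alpha> F G r0 \<rho> w \<eta> =
    (if admissible \<rho> w
     then ereal (\<Sum>c\<in>UNIV. en (cellM \<eta> c) (cellM \<rho> c) (cellW w c) + \<Psi> c (cellM \<rho> c)) else \<infinity>)"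
proof (cases "admissible \<rho> w")
  case True
  have E: "energy_dom (\<rho> $ next_level k $ i $ j) (w $ k $ i $ j)" for k i j
    using True[unfolded admissible_def, THEN conjunct2, rule_format, of "(k, i, j)"]
    by (simp add: cellM_def cellW_def)
  have nn: "\<not> \<rho> $ next_level k $ i $ j < 0" for k i j
    using E[of k i j] by (auto simp: energy_dom_def)
  \<comment> \<open>There is at least one time step, so the final level is the next level of exactly
    one step \<open>k1\<close>, which carries the terminal cost.\<close>
  have "final_level \<noteq> (0 :: 't option mod_ring)"
  proof
    assume "final_level = (0 :: 't option mod_ring)"
    then show False using to_int_final_level[where 't = 't] by simp
  qed
  then obtain k1 :: "'t mod_ring" where k1: "next_level k1 = (final_level :: 't option mod_ring)"
    using next_level_surj by blast
  then have k1': "next_level k = (final_level :: 't option mod_ring) \<longleftrightarrow> k = k1" for k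
    by (metis prev_step_next_level)
  have G: "(\<Sum>k\<in>UNIV. \<Sum>i\<in>UNIV. \<Sum>j\<in>UNIV. if next_level k = (final_level :: 't option mod_ring)
        then 1 / dt * G (grid_point h i j) (\<rho> $ next_level k $ i $ j) else 0)
      = 1 / dt * (\<Sum>i\<in>UNIV. \<Sum>j\<in>UNIV. G (grid_point h i j) (\<rho> $ final_level $ i $ j))"
  proof -
    have "(\<Sum>k\<in>UNIV. \<Sum>i\<in>UNIV. \<Sum>j\<in>UNIV. if next_level k = (final_level :: 't option mod_ring)
        then 1 / dt * G (grid_point h i j) (\<rho> $ next_level k $ i $ j) else 0)
      = (\<Sum>k\<in>UNIV. if k = k1 then (\<Sum>i\<in>UNIV. \<Sum>j\<in>UNIV. 1 / dt * G (grid_point h i j) (\<rho> $ next_level k $ i $ j)) else 0)"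
      by (intro sum.cong refl) (simp add: k1')
    then show ?thesis by (simp add: k1 sum_distrib_left)
  qed
  have swap: "(\<Sum>i\<in>UNIV. \<Sum>j\<in>UNIV. \<Sum>k\<in>UNIV. f k i j) = (\<Sum>k\<in>UNIV. \<Sum>i\<in>UNIV. \<Sum>j\<in>UNIV. f k i j)"
    for f :: "'t mod_ring \<Rightarrow> 'n mod_ring \<Rightarrow> 'n mod_ring \<Rightarrow> real"
  proof -
    have "(\<Sum>i\<in>UNIV. \<Sum>j\<in>UNIV. \<Sum>k\<in>UNIV. f k i j) = (\<Sum>i\<in>UNIV. \<Sum>k\<in>UNIV. \<Sum>j\<in>UNIV. f k i j)"
      by (rule sum.cong[OF refl], rule sum.swap)
    also have "\<dots> = (\<Sum>k\<in>UNIV. \<Sum>i\<in>UNIV. \<Sum>j\<in>UNIV. f k i j)" by (rule sum.swap)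
    finally show ?thesis .
  qed
  have nn': "\<not> \<rho> $ final_level $ i $ j < 0" for i j using nn[of k1] by (simp add: k1)
  have "J h dt \<epsilon> \<beta> \<alpha> F G r0 \<rho> w \<eta> =
    ereal ((\<Sum>i\<in>UNIV. \<Sum>j\<in>UNIV. \<Sum>k\<in>UNIV.
        en (\<eta> $ next_level k $ i $ j) (\<rho> $ next_level k $ i $ j) (w $ k $ i $ j)
        + F (grid_time dt k) (grid_point h i j) (\<rho> $ next_level k $ i $ j))
     + 1 / dt * (\<Sum>i\<in>UNIV. \<Sum>j\<in>UNIV. G (grid_point h i j) (\<rho> $ final_level $ i $ j)))"
    using True unfolding J_def admissible_def by (simp add: Eh_eq E ext_nonneg_def nn nn')
  also have "\<dots> = ereal (\<Sum>c\<in>UNIV. en (cellM \<eta> c) (cellM \<rho> c) (cellW w c) + \<Psi> c (cellM \<rho> c))"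
    unfolding swap sum_cells G[symmetric]
    by (simp add: cellM_def cellW_def Psi_def potential_def sum.distrib add.assoc)
  finally show ?thesis using True by simp
next
  case False
  have "J h dt \<epsilon> \<beta> \<alpha> F G r0 \<rho> w \<eta> = \<infinity>"
  proof (cases "\<rho> $ 0 = r0")
    case True
    then obtain c where c: "\<not> energy_dom (cellM \<rho> c) (cellW w c)"
      using False by (auto simp: admissible_def)
    obtain k i j where kij: "c = (k, i, j)" by (cases c)
    have "\<not> energy_dom (\<rho> $ next_level k $ i $ j) (w $ k $ i $ j)"
      using c by (simp add: kij cellM_def cellW_def)
    then have "Eh \<epsilon> \<beta> \<alpha> (\<rho> $ next_level k $ i $ j) (w $ k $ i $ j) (\<eta> $ next_level k $ i $ j) = \<infinity>"
      by (simp add: Eh_eq)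
    then show ?thesis
      unfolding J_def by (auto simp: sum_Pinfty)
  qed (simp add: J_def)
  then show ?thesis using False by simp
qed

definition cell_cond :: "('t, 'n) Mspace \<Rightarrow> ('t, 'n) Wspace \<Rightarrow> ('t, 'n) Mspace \<Rightarrow> ('t, 'n) Wspace \<Rightarrow> ('t, 'n) cell \<Rightarrow> bool" where
  "cell_cond \<rho> w a p c \<longleftrightarrow> cellW w c = cellM \<rho> c *\<^sub>R vel (cellM \<rho> c) (cellW p c) \<and>
     subgrad_on {0..} (\<Psi> c) (cellM \<rho> c) (cellM a c + \<theta> (cellM \<rho> c) (cellW p c))"

lemma cell_cond_nonneg: "cell_cond \<rho> w a p c \<Longrightarrow> 0 \<le> cellM \<rho> c"
  by (auto simp: cell_cond_def subgrad_on_def)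

lemma nonneg_iff:
  assumes "\<rho> $ 0 = r0"
  shows "(\<forall>k i j. 0 \<le> \<rho> $ k $ i $ j) \<longleftrightarrow> (\<forall>c. 0 \<le> cellM \<rho> c)"
proof (intro iffI allI)
  fix l i j assume c: "\<forall>c. 0 \<le> cellM \<rho> c"
  show "0 \<le> \<rho> $ l $ i $ j"
  proof (cases "l = 0")
    case True then show ?thesis using assms r0_nonneg by simp
  next
    case False
    then show ?thesis using c[rule_format, of "(prev_step l, i, j)"] by (simp add: cellM_def next_level_surj)
  qed
qed (simp add: cellM_def split: prod.split)

lemma opK_iff:
  "(a, p) \<in> K (\<rho>, w) \<longleftrightarrow> \<rho> $ 0 = r0 \<and> (\<forall>c. cell_cond \<rho> w a p c)" (is "?L \<longleftrightarrow> ?R")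
proof
  assume L: ?L
  define Jr where "Jr = (\<lambda>\<rho>' w'. \<Sum>c\<in>UNIV. en (cellM \<rho> c) (cellM \<rho>' c) (cellW w' c) + \<Psi> c (cellM \<rho>' c))"
  have nn: "\<forall>k i j. 0 \<le> \<rho> $ k $ i $ j" using L by (auto simp: opK_def split: if_splits)
  have sub: "(a, p) \<in> subdifferential (\<lambda>(\<rho>', w'). J h dt \<epsilon> \<beta> \<alpha> F G r0 \<rho>' w' \<rho>) (\<rho>, w)"
    using L by (auto simp: opK_def split: if_splits)
  then have adm: "admissible \<rho> w" by (auto simp: subdifferential_def J_eq split: if_splits)
  have ineq: "Jr \<rho> w + (a \<bullet> (\<rho>' - \<rho>) + p \<bullet> (w' - w)) \<le> Jr \<rho>' w'" if "admissible \<rho>' w'" for \<rho>' w'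
  proof -
    have "ereal (Jr \<rho> w) + ereal ((a, p) \<bullet> ((\<rho>', w') - (\<rho>, w))) \<le> ereal (Jr \<rho>' w')"
    proof -
      have "J h dt \<epsilon> \<beta> \<alpha> F G r0 \<rho> w \<rho> + ereal ((a, p) \<bullet> ((\<rho>', w') - (\<rho>, w)))
          \<le> J h dt \<epsilon> \<beta> \<alpha> F G r0 \<rho>' w' \<rho>"
        using sub unfolding subdifferential_def mem_Collect_eq
        by (elim conjE allE[of _ "(\<rho>', w')"]) simp
      then show ?thesis unfolding J_eq Jr_def using adm that by simp
    qed
    then show ?thesis by simp
  qed
  have r0: "\<rho> $ 0 = r0" using adm by (simp add: admissible_def)
  have nnc: "0 \<le> cellM \<rho> d" for d using nn nonneg_iff[OF r0] by blast
  have "cell_cond \<rho> w a p c" for c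
    unfolding cell_cond_def
  proof (subst cell_subdifferential_iff[symmetric], goal_cases)
    case 3
    have dom: "energy_dom (cellM \<rho> d) (cellW w d)" for d using adm unfolding admissible_def by blast
    have "en (cellM \<rho> c) (cellM \<rho> c) (cellW w c) + \<Psi> c (cellM \<rho> c)
        + (cellM a c * (r' - cellM \<rho> c) + cellW p c \<bullet> (w' - cellW w c))
        \<le> en (cellM \<rho> c) r' w' + \<Psi> c r'" if r': "r' \<in> {0..}" and w': "energy_dom r' w'" for r' w'
    proof -
      \<comment> \<open>A competitor that differs from (\<rho>, w) in the cell \<open>c\<close>
        only, so that all other summands cancel.\<close>
      define \<rho>' where "\<rho>' = mkM r0 ((cellM \<rho>)(c := r'))"
      define v where "v = mkW ((cellW w)(c := w'))"
      have "admissible \<rho>' v" using dom w' by (simp add: admissible_def \<rho>'_def v_def)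
      note ineq[OF this]
      moreover have "a \<bullet> (\<rho>' - \<rho>) = (\<Sum>d\<in>UNIV. cellM a d * (cellM \<rho>' d - cellM \<rho> d))"
        by (simp add: inner_Mspace r0) (simp add: \<rho>'_def)
      moreover have "p \<bullet> (v - w) = (\<Sum>d\<in>UNIV. cellW p d \<bullet> (cellW v d - cellW w d))"
        by (simp add: inner_Wspace)
      ultimately have "0 \<le> (\<Sum>d\<in>UNIV. en (cellM \<rho> d) (cellM \<rho>' d) (cellW v d) + \<Psi> d (cellM \<rho>' d)
          - (en (cellM \<rho> d) (cellM \<rho> d) (cellW w d) + \<Psi> d (cellM \<rho> d)
          + (cellM a d * (cellM \<rho>' d - cellM \<rho> d) + cellW p d \<bullet> (cellW v d - cellW w d))))"
        (is "0 \<le> (\<Sum>d\<in>UNIV. ?g d)")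
        by (simp add: Jr_def sum.distrib sum_subtractf)
      also have "(\<Sum>d\<in>UNIV. ?g d) = (\<Sum>d\<in>UNIV. if d = c then ?g c else 0)"
        by (intro sum.cong refl) (auto simp: \<rho>'_def v_def)
      also have "\<dots> = ?g c" by simp
      finally show ?thesis by (simp add: \<rho>'_def v_def)
    qed
    then show ?case using dom nnc by auto
  qed (use nnc in auto)
  then show ?R using r0 by blast
next
  assume R: ?R
  then have r0: "\<rho> $ 0 = r0" and c: "cell_cond \<rho> w a p c" for c by blast+
  have nnc: "0 \<le> cellM \<rho> c" for c using cell_cond_nonneg[OF c] .
  have nn: "\<forall>k i j. 0 \<le> \<rho> $ k $ i $ j" using nonneg_iff[OF r0] nnc by blast
  have loc: "energy_dom (cellM \<rho> c) (cellW w c) \<and> cellM \<rho> c \<in> {0..} \<and>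
      (\<forall>r'\<in>{0..}. \<forall>w'. energy_dom r' w' \<longrightarrow>
        en (cellM \<rho> c) (cellM \<rho> c) (cellW w c) + \<Psi> c (cellM \<rho> c)
        + (cellM a c * (r' - cellM \<rho> c) + cellW p c \<bullet> (w' - cellW w c)) \<le> en (cellM \<rho> c) r' w' + \<Psi> c r')" for c
    by (subst cell_subdifferential_iff) (use c[of c] nnc in \<open>auto simp: cell_cond_def\<close>)
  have adm: "admissible \<rho> w" unfolding admissible_def using loc r0 by blast
  have "J h dt \<epsilon> \<beta> \<alpha> F G r0 \<rho> w \<rho> + ereal ((a, p) \<bullet> ((\<rho>', w') - (\<rho>, w)))
      \<le> J h dt \<epsilon> \<beta> \<alpha> F G r0 \<rho>' w' \<rho>" for \<rho>' w'
  proof (cases "admissible \<rho>' w'")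
    case True
    have "energy_dom (cellM \<rho>' c) (cellW w' c)" for c
      using True unfolding admissible_def by blast
    moreover from this have "cellM \<rho>' c \<in> {0..}" for c
      by (metis atLeast_iff energy_dom_def less_eq_real_def)
    ultimately have "(\<Sum>c\<in>UNIV. en (cellM \<rho> c) (cellM \<rho> c) (cellW w c) + \<Psi> c (cellM \<rho> c)
        + (cellM a c * (cellM \<rho>' c - cellM \<rho> c) + cellW p c \<bullet> (cellW w' c - cellW w c)))
       \<le> (\<Sum>c\<in>UNIV. en (cellM \<rho> c) (cellM \<rho>' c) (cellW w' c) + \<Psi> c (cellM \<rho>' c))"
      using loc by (intro sum_mono) blast
    moreover have "a \<bullet> (\<rho>' - \<rho>) = (\<Sum>d\<in>UNIV. cellM a d * (cellM \<rho>' d - cellM \<rho> d))"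
      using True by (simp add: inner_Mspace r0 admissible_def)
    moreover have "p \<bullet> (w' - w) = (\<Sum>d\<in>UNIV. cellW p d \<bullet> (cellW w' d - cellW w d))"
      by (simp add: inner_Wspace)
    ultimately show ?thesis using adm True by (simp add: J_eq sum.distrib)
  qed (simp add: J_eq)
  then show ?L using nn adm by (auto simp: opK_def subdifferential_def J_eq)
qed

text \<open>In each cell the monotonicity of the subgradients and \<open>cell_monotone\<close> are
  added, whereby the terms in \<open>\<theta>\<close> cancel. Level 0 contributes nothing, as both
  densities equal \<open>r0\<close> there.\<close>

lemma monotone_K: "monotone_operator K"
  unfolding monotone_operator_def
proof (intro allI ballI)
  fix x y u v assume "u \<in> K x" "v \<in> K y"
  obtain \<rho> w where x: "x = (\<rho>, w)" by force
  obtain \<rho>' w' where y: "y = (\<rho>', w')" by force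
  obtain a p where u: "u = (a, p)" by force
  obtain a' p' where v: "v = (a', p')" by force
  have r0: "\<rho> $ 0 = r0" "\<rho>' $ 0 = r0" and c: "cell_cond \<rho> w a p c" "cell_cond \<rho>' w' a' p' c" for c
    using \<open>u \<in> K x\<close> \<open>v \<in> K y\<close> unfolding x y u v opK_iff by blast+
  have "0 \<le> (cellM \<rho> c - cellM \<rho>' c) * (cellM a c - cellM a' c)
      + (cellW w c - cellW w' c) \<bullet> (cellW p c - cellW p' c)" for c
  proof -
    have "0 \<le> ((cellM a c + \<theta> (cellM \<rho> c) (cellW p c)) - (cellM a' c + \<theta> (cellM \<rho>' c) (cellW p' c)))
        * (cellM \<rho> c - cellM \<rho>' c)"
      using c[of c] unfolding cell_cond_def by (blast intro: subgrad_on_mono)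
    moreover have "0 \<le> (cellW p c - cellW p' c) \<bullet> (cellW w c - cellW w' c)
        - (cellM \<rho> c - cellM \<rho>' c) * (\<theta> (cellM \<rho> c) (cellW p c) - \<theta> (cellM \<rho>' c) (cellW p' c))"
      using cell_monotone[OF cell_cond_nonneg[OF c(1)[of c]] cell_cond_nonneg[OF c(2)[of c]]] c[of c]
      unfolding cell_cond_def by simp
    ultimately show ?thesis by (simp add: inner_commute algebra_simps)
  qed
  then have "0 \<le> (\<Sum>c\<in>UNIV. (cellM \<rho> c - cellM \<rho>' c) * (cellM a c - cellM a' c)
      + (cellW w c - cellW w' c) \<bullet> (cellW p c - cellW p' c))" by (simp add: sum_nonneg)
  then show "0 \<le> (x - y) \<bullet> (u - v)"
    by (simp add: x y u v inner_Mspace inner_Wspace r0 sum.distrib)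
qed

lemma resolvent_K_exists:
  assumes "\<sigma> > 0"
  shows "\<exists>x. x \<in> resolvent \<sigma> K u"
proof -
  obtain a0 p0 where u: "u = (a0, p0)" by force
  have "\<exists>r a p. r + \<sigma> * a = cellM a0 c \<and> r *\<^sub>R vel r p + \<sigma> *\<^sub>R p = cellW p0 c
      \<and> subgrad_on {0..} (\<Psi> c) r (a + \<theta> r p)" for c
    by (rule cell_resolvent[OF Psi_convex Psi_cont assms])
  then obtain r a p where *: "\<And>c. r c + \<sigma> * a c = cellM a0 c"
    "\<And>c. r c *\<^sub>R vel (r c) (p c) + \<sigma> *\<^sub>R p c = cellW p0 c"
    "\<And>c. subgrad_on {0..} (\<Psi> c) (r c) (a c + \<theta> (r c) (p c))" by metis
  define \<rho> where "\<rho> = mkM r0 r"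
  define w where "w = mkW (\<lambda>c. r c *\<^sub>R vel (r c) (p c))"
  \<comment> \<open>The subgradient component at level 0 is free and is chosen to solve the
    resolvent equation there.\<close>
  define A' where "A' = mkM ((1 / \<sigma>) *\<^sub>R (a0 $ 0 - r0)) a"
  have "(A', mkW p) \<in> K (\<rho>, w)"
    unfolding opK_iff cell_cond_def by (simp add: \<rho>_def w_def A'_def *(3))
  moreover have "\<rho> + \<sigma> *\<^sub>R A' = a0"
    using assms by (intro Mspace_eqI) (simp_all add: \<rho>_def A'_def *(1))
  moreover have "w + \<sigma> *\<^sub>R mkW p = p0"
    by (intro Wspace_eqI) (simp add: w_def *(2))
  ultimately show ?thesis
    unfolding resolvent_def sv_inverse_def u
    by (intro exI[of _ "(\<rho>, w)"]) force
qed

lemma maximally_monotone_K: "maximally_monotone K"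
proof (rule maximally_monotone_if_surj[OF monotone_K])
  fix u
  obtain x where "x \<in> resolvent 1 K u" using resolvent_K_exists[OF zero_less_one] by blast
  then have "u \<in> {x + 1 *\<^sub>R v | v. v \<in> K x}" by (simp add: resolvent_def sv_inverse_def)
  then obtain v where "v \<in> K x" "u = x + 1 *\<^sub>R v" by blast
  then show "\<exists>x. \<exists>v\<in>K x. x + v = u" by (intro exI[of _ x] bexI[of _ v]) simp_all
qed

end

section \<open>Equivalence with the mean-field game system\<close>

lemma extend_terminal_level [simp]: "extend_terminal h g \<rho> \<phi> $ level k = \<phi> $ k"
  by (simp add: extend_terminal_def vec_eq_iff)

text \<open>The two extensions differ by the terminal value \<open>g\<close>, which is the
  counterpart of the terminal cost in \<open>potential\<close>.\<close>

lemma extend_terminal_eq: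
  "extend_terminal h g \<rho> \<phi> $ l $ i $ j = ext0 \<phi> $ l $ i $ j
     + (if l = final_level then g (grid_point h i j) (\<rho> $ final_level $ i $ j) else 0)"
  by (simp add: extend_terminal_def ext0_def)

context mfg_grid begin

lemma solves_I_iff:
  "solves_I A B K \<phi> \<rho> w \<longleftrightarrow>
     \<rho> $ 0 = r0 \<and> (\<forall>c. cell_cond \<rho> w (adjoint A \<phi>) (adjoint B \<phi>) c) \<and> A \<rho> + B w = 0"
  unfolding solves_I_def opK_iff by blast

text \<open>A zero of the density kills the flux out of the cell, so the implicit diffusion term forces all
  neighbouring densities to vanish as well, and then conservation of mass fails.\<close>

lemma density_pos:
  assumes "\<nu> > 0" and r0: "\<rho> $ 0 = r0" and nn: "\<And>c. 0 \<le> cellM \<rho> c"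
    and wK: "\<And>c. cellW w c \<in> Kcone" and w0: "\<And>c. cellM \<rho> c = 0 \<Longrightarrow> cellW w c = 0"
    and eq: "A \<rho> + B w = 0"
  shows "0 < cellM \<rho> c"
proof (rule ccontr)
  assume "\<not> 0 < cellM \<rho> c"
  then have c0: "cellM \<rho> c = 0" using nn[of c] by linarith
  obtain k i0 j0 where c: "c = (k, i0, j0)" by (cases c)
  define R where "R = \<rho> $ next_level k"
  have pos: "0 \<le> \<rho> $ l $ i $ j" for l i j using nonneg_iff[OF r0] nn by blast
  have nb: "R $ up i $ j = 0 \<and> R $ i $ up j = 0" if z: "R $ i $ j = 0" for i j
  proof -
    have wz: "w $ k $ i $ j = 0"
      using w0[of "(k, i, j)"] z by (simp add: cellM_def cellW_def R_def)
    have wk: "w $ k $ i' $ j' \<in> Kcone" for i' j' using wK[of "(k, i', j')"] by (simp add: cellW_def)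
    have "(A \<rho> + B w) $ k $ i $ j = 0" using eq by simp
    then have e: "(R $ i $ j - \<rho> $ level k $ i $ j) / dt - \<nu> * Lap h R $ i $ j + B w $ k $ i $ j = 0"
      by (simp add: opA_def Dt_def R_def)
    \<comment> \<open>As the flux in the cell itself is zero, only fluxes of neighbours remain, and
      their signs in \<open>Kcone\<close> make the divergence nonpositive.\<close>
    have "B w $ k $ i $ j = (w $ k $ up i $ j $ 2 + w $ k $ i $ up j $ 4
        - w $ k $ dn i $ j $ 1 - w $ k $ i $ dn j $ 3) / h"
      by (simp add: opB_def D1_def D2_def wcomp_def wz diff_divide_distrib add_divide_distrib)
    also have "\<dots> \<le> 0"
      using wk[of "up i" j] wk[of i "up j"] wk[of "dn i" j] wk[of i "dn j"] h_pos
      by (intro divide_nonpos_pos) (auto simp: Kcone_def)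
    finally have "B w $ k $ i $ j \<le> 0" .
    moreover have "(R $ i $ j - \<rho> $ level k $ i $ j) / dt \<le> 0"
      using pos[of "level k" i j] dt_pos z by (simp add: divide_nonpos_pos)
    ultimately have "\<nu> * Lap h R $ i $ j \<le> 0" using e by linarith
    then have "Lap h R $ i $ j \<le> 0" using \<open>\<nu> > 0\<close> by (simp add: mult_le_0_iff)
    then have "R $ dn i $ j + R $ up i $ j + R $ i $ dn j + R $ i $ up j \<le> 0"
      using h_pos z by (simp add: Lap_def divide_le_0_iff)
    then show ?thesis
      using pos[of "next_level k" "dn i" j] pos[of "next_level k" "up i" j]
        pos[of "next_level k" i "dn j"] pos[of "next_level k" i "up j"]
      unfolding R_def[symmetric] by linarith
  qed
  have 1: "R $ i $ j0 = 0" for i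
    by (rule up_reach[where ?i0.0 = i0 and P = "\<lambda>i. R $ i $ j0 = 0"])
      (use c0 nb in \<open>auto simp: c cellM_def R_def\<close>)
  have "R $ i $ j = 0" for i j
    by (rule up_reach[where ?i0.0 = j0 and P = "\<lambda>j. R $ i $ j = 0"]) (use 1 nb in auto)
  then have "R \<bullet> one_slice = 0" by (simp add: inner_slice)
  then show False
    using mass_conserved[OF eq dt_pos, of "next_level k"] mass_pos r0 by (simp add: R_def)
qed

text \<open>By \<open>dHh_eq\<close> the momentum derivative of the Hamiltonian is the negated
  velocity at the adjoint of \<open>B\<close>, so each product of density and derivative is a
  negated component of \<open>w\<close>.\<close>

lemma transport_eq:
  assumes nn: "\<And>c. 0 \<le> cellM \<rho> c"
    and w: "\<And>c. cellW w c = cellM \<rho> c *\<^sub>R vel (cellM \<rho> c) (cellW (adjoint B \<phi>) c)"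
  shows "transport h \<epsilon> \<beta> \<alpha> (\<phi> $ k) (\<rho> $ next_level k) (\<rho> $ next_level k) $ i $ j = - (B w $ k $ i $ j)"
proof -
  have P: "\<rho> $ next_level k $ i $ j * dHh \<epsilon> \<beta> \<alpha> m (Dh h (\<phi> $ k) i j) (\<rho> $ next_level k $ i $ j)
      = - (w $ k $ i $ j $ m)" for m i j
    using w[of "(k, i, j)"] nn[of "(k, i, j)"]
    by (simp add: cellW_adjoint_opB) (simp add: cellM_def cellW_def dHh_eq)
  show ?thesis
    unfolding transport_def Let_def P
    by (simp add: opB_def D1_def D2_def wcomp_def diff_divide_distrib add_divide_distrib algebra_simps)
qed

lemma Psi_deriv:
  assumes F: "\<And>k i j r. r > 0 \<Longrightarrow> (F (grid_time dt (k :: 't mod_ring)) (grid_point h (i :: 'n mod_ring) j)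
        has_real_derivative f (grid_time dt k) (grid_point h i j) r) (at r)"
    and G: "\<And>i j r. r > 0 \<Longrightarrow> (G (grid_point h (i :: 'n mod_ring) j)
        has_real_derivative g (grid_point h i j) r) (at r)"
    and "r > 0"
  shows "(\<Psi> (k, i, j) has_real_derivative f (grid_time dt k) (grid_point h i j) r
     + (if next_level k = (final_level :: 't option mod_ring) then g (grid_point h i j) r / dt else 0)) (at r)"
proof (cases "next_level k = (final_level :: 't option mod_ring)")
  case True
  have "((\<lambda>r. F (grid_time dt k) (grid_point h i j) r + 1 / dt * G (grid_point h i j) r) has_real_derivative
      f (grid_time dt k) (grid_point h i j) r + 1 / dt * g (grid_point h i j) r) (at r)"
    by (intro DERIV_add F DERIV_cmult G \<open>r > 0\<close>)
  then show ?thesis using True by (simp add: Psi_def potential_def)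
next
  case False
  then show ?thesis using F[OF \<open>r > 0\<close>] by (simp add: Psi_def potential_def)
qed

text \<open>The flux \<open>w\<close> is determined by \<phi> and \<rho>, so both sides have the
  same unknowns. The density equations match by \<open>transport_eq\<close>. The Hamilton-Jacobi
  equation says that the subgradient in the cell is the derivative of the potential, which at a
  positive density is the only subgradient.\<close>

lemma mfg_system_iff:
  assumes "\<nu> > 0"
    and F: "\<And>k i j r. r > 0 \<Longrightarrow> (F (grid_time dt (k :: 't mod_ring)) (grid_point h (i :: 'n mod_ring) j)
        has_real_derivative f (grid_time dt k) (grid_point h i j) r) (at r)"
    and G: "\<And>i j r. r > 0 \<Longrightarrow> (G (grid_point h (i :: 'n mod_ring) j)
        has_real_derivative g (grid_point h i j) r) (at r)"
  shows "mfg_system \<nu> h dt \<epsilon> \<beta> \<alpha> f g r0 (extend_terminal h g \<rho> \<phi>) \<rho> \<longleftrightarrow> (\<exists>w. solves_I A B K \<phi> \<rho> w)"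
    (is "?S \<longleftrightarrow> _")
proof
  define fc :: "('t, 'n) cell \<Rightarrow> real \<Rightarrow> real" where "fc = (\<lambda>(k, i, j) r. f (grid_time dt k) (grid_point h i j) r
     + (if next_level k = (final_level :: 't option mod_ring) then g (grid_point h i j) r / dt else 0))"
  have d: "(\<Psi> c has_real_derivative fc c r) (at r)" if "r > 0" for c r
    using Psi_deriv[where f = f and g = g, OF F G that] by (cases c) (simp add: fc_def)
  \<comment> \<open>At the final level \<open>ext0\<close> has the value 0 where
    \<open>extend_terminal\<close> has \<open>g\<close>; the difference, divided by
    \<open>dt\<close>, is the derivative of the terminal cost contained in
    \<open>fc\<close>.\<close>
  have hjb: "- Dt dt (extend_terminal h g \<rho> \<phi>) $ k $ i $ j - \<nu> * Lap h (extend_terminal h g \<rho> \<phi> $ level k) $ i $ j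
        + Hh \<epsilon> \<beta> \<alpha> (Dh h (extend_terminal h g \<rho> \<phi> $ level k) i j) (\<rho> $ next_level k $ i $ j)
        = f (grid_time dt k) (grid_point h i j) (\<rho> $ next_level k $ i $ j) \<longleftrightarrow>
      cellM (adjoint A \<phi>) (k, i, j) + \<theta> (cellM \<rho> (k, i, j)) (cellW (adjoint B \<phi>) (k, i, j))
        = fc (k, i, j) (cellM \<rho> (k, i, j))" for k i j
  proof -
    have "cellM (adjoint A \<phi>) (k, i, j) =
        (\<phi> $ k $ i $ j - ext0 \<phi> $ next_level k $ i $ j) / dt - \<nu> * Lap h (\<phi> $ k) $ i $ j"
      by (simp add: cellM_def adjoint_opA_nth)
    moreover have "- Dt dt (extend_terminal h g \<rho> \<phi>) $ k $ i $ j =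
        (\<phi> $ k $ i $ j - ext0 \<phi> $ next_level k $ i $ j) / dt
        - (if next_level k = (final_level :: 't option mod_ring)
           then g (grid_point h i j) (\<rho> $ next_level k $ i $ j) / dt else 0)"
      by (simp add: Dt_def) (simp add: extend_terminal_eq diff_divide_distrib add_divide_distrib)
    ultimately show ?thesis
      by (auto simp: fc_def cellW_adjoint_opB Hh_eq_theta cellM_def)
  qed
  {
    assume S: ?S
    have "0 < \<rho> $ next_level k $ i $ j" for k i j using S by (simp add: mfg_system_def)
    then have pos: "0 < cellM \<rho> c" for c by (cases c) (simp add: cellM_def)
    define w where "w = mkW (\<lambda>c. cellM \<rho> c *\<^sub>R vel (cellM \<rho> c) (cellW (adjoint B \<phi>) c))"
    have "cell_cond \<rho> w (adjoint A \<phi>) (adjoint B \<phi>) c" for c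
    proof -
      obtain k i j where c: "c = (k, i, j)" by (cases c)
      have "cellM (adjoint A \<phi>) c + \<theta> (cellM \<rho> c) (cellW (adjoint B \<phi>) c) = fc c (cellM \<rho> c)"
        unfolding c hjb[symmetric] using S unfolding mfg_system_def by blast
      then show ?thesis
        using deriv_subgrad_on[OF Psi_convex d[OF pos] pos, of c] by (simp add: cell_cond_def w_def)
    qed
    moreover have "A \<rho> + B w = 0"
    proof -
      have "A \<rho> $ k $ i $ j + B w $ k $ i $ j = 0" for k i j
      proof -
        have "Dt dt \<rho> $ k $ i $ j - \<nu> * Lap h (\<rho> $ next_level k) $ i $ j
            - transport h \<epsilon> \<beta> \<alpha> (\<phi> $ k) (\<rho> $ next_level k) (\<rho> $ next_level k) $ i $ j = 0"
          using S by (simp add: mfg_system_def)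
        moreover have "transport h \<epsilon> \<beta> \<alpha> (\<phi> $ k) (\<rho> $ next_level k) (\<rho> $ next_level k) $ i $ j
            = - (B w $ k $ i $ j)"
          by (rule transport_eq) (simp_all add: w_def less_imp_le[OF pos])
        ultimately show ?thesis by (simp add: opA_def)
      qed
      then show ?thesis by (simp add: vec_eq_iff)
    qed
    moreover have "\<rho> $ 0 = r0" using S by (simp add: mfg_system_def)
    ultimately show "\<exists>w. solves_I A B K \<phi> \<rho> w" unfolding solves_I_iff by blast
  next
    assume "\<exists>w. solves_I A B K \<phi> \<rho> w"
    then obtain w where r0: "\<rho> $ 0 = r0" and cc: "\<And>c. cell_cond \<rho> w (adjoint A \<phi>) (adjoint B \<phi>) c"
      and eq: "A \<rho> + B w = 0" unfolding solves_I_iff by blast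
    have nn: "0 \<le> cellM \<rho> c" for c using cell_cond_nonneg[OF cc] .
    have w: "cellW w c = cellM \<rho> c *\<^sub>R vel (cellM \<rho> c) (cellW (adjoint B \<phi>) c)" for c
      using cc[of c] unfolding cell_cond_def by blast
    have pos: "0 < cellM \<rho> c" for c
      by (rule density_pos[OF \<open>\<nu> > 0\<close> r0 nn _ _ eq])
        (simp_all add: w nn vel_in_Kcone scaleR_in_Kcone)
    have "cellM (adjoint A \<phi>) c + \<theta> (cellM \<rho> c) (cellW (adjoint B \<phi>) c) = fc c (cellM \<rho> c)" for c
      using subgrad_on_deriv[OF d[OF pos] pos] cc[of c] unfolding cell_cond_def by blast
    note H = this[of "(_, _, _)", folded hjb]
    have "\<rho> $ next_level k $ i $ j > 0" for k i j
      using pos[of "(k, i, j)"] by (simp add: cellM_def)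
    moreover have "Dt dt \<rho> $ k $ i $ j - \<nu> * Lap h (\<rho> $ next_level k) $ i $ j
            - transport h \<epsilon> \<beta> \<alpha> (\<phi> $ k) (\<rho> $ next_level k) (\<rho> $ next_level k) $ i $ j = 0" for k i j
    proof -
      have "(A \<rho> + B w) $ k $ i $ j = 0" using eq by simp
      then show ?thesis unfolding transport_eq[OF nn w] by (simp add: opA_def)
    qed
    moreover have "extend_terminal h g \<rho> \<phi> $ final_level $ i $ j
        = g (grid_point h i j) (\<rho> $ final_level $ i $ j)" for i j
      by (simp add: extend_terminal_def)
    ultimately show ?S
      unfolding mfg_system_def using r0 H by simp
  }
qed

end

section \<open>Existence of solutions\<close>

lemma continuous_on_mkM:
  assumes "\<And>c. continuous_on S (\<lambda>x. g x c)"
  shows "continuous_on S (\<lambda>x. mkM s (g x))"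
  unfolding mkM_def
proof (rule continuous_on_vec_lambda)
  fix l :: "'a option mod_ring"
  show "continuous_on S (\<lambda>x. if l = 0 then s else \<chi> i j. g x (prev_step l, i, j))"
    by (cases "l = 0") (auto intro!: continuous_on_vec_lambda assms)
qed

lemma continuous_on_mkW:
  assumes "\<And>c. continuous_on S (\<lambda>x. g x c)"
  shows "continuous_on S (\<lambda>x. mkW (g x))"
  unfolding mkW_def by (intro continuous_on_vec_lambda assms)

section \<open>Coercivity estimates and a Slater point\<close>

lemma norm_mkM_le: "norm (mkM 0 f) \<le> (\<Sum>c\<in>UNIV. \<bar>f c\<bar>)"
proof -
  have "norm (mkM 0 f) = L2_set f UNIV"
    unfolding norm_eq_sqrt_inner L2_set_def by (simp add: inner_Mspace power2_eq_square)
  then show ?thesis using L2_set_le_sum_abs[of f UNIV] by simp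
qed

text \<open>A discrete Poincare inequality: the adjoint of \<open>opB\<close> is injective, hence
  bounded below, on functions with mean zero at every step, and \<open>u\<close> does not see the
  spatial means of \<open>\<phi>\<close>.\<close>

lemma opB_adjoint_bounded_below:
  fixes u :: "('t::finite, 'n::finite) Uspace"
  assumes h: "h > 0" and u: "\<And>k. u $ k \<bullet> one_slice = 0"
  shows "\<exists>t\<ge>0. \<forall>\<phi>. \<bar>u \<bullet> \<phi>\<bar> \<le> t * norm (adjoint (opB h) \<phi>)"
proof -
  let ?B = "adjoint (opB h) :: ('t, 'n) Uspace \<Rightarrow> ('t, 'n) Wspace"
  have linB: "linear ?B" by (rule adjoint_linear[OF linear_opB])
  define s where "s = {\<psi> :: ('t, 'n) Uspace. \<forall>k. \<psi> $ k \<bullet> one_slice = 0}"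
  have sub: "subspace s" by (auto simp: subspace_def s_def inner_simps)
  have N: "one_slice \<bullet> (one_slice :: 'n slice) > 0"
    by (simp add: inner_slice)
  have inj: "\<psi> = 0" if \<psi>: "\<psi> \<in> s" "?B \<psi> = 0" for \<psi>
  proof -
    have c: "\<psi> $ k $ i $ j = \<psi> $ k $ 0 $ 0" for k i j by (rule adjoint_opB_eq_0_imp[OF \<psi>(2) h])
    have "\<psi> $ k = (\<psi> $ k $ 0 $ 0) *\<^sub>R one_slice" for k
      using c by (simp add: vec_eq_iff)
    note k = this
    have "\<psi> $ k \<bullet> one_slice = 0" for k using \<psi>(1) by (simp add: s_def)
    then have "\<psi> $ k $ 0 $ 0 * (one_slice \<bullet> (one_slice :: 'n slice)) = 0" for k
      by (subst (asm) k) simp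
    then have "\<psi> $ k $ 0 $ 0 = 0" for k using N by simp
    then have "\<psi> $ k $ i $ j = 0" for k i j using c by simp
    then show ?thesis by (simp add: vec_eq_iff)
  qed
  obtain e where e: "e > 0" "\<And>\<psi>. \<psi> \<in> s \<Longrightarrow> e * norm \<psi> \<le> norm (?B \<psi>)"
    using injective_imp_isometric[OF closed_subspace[OF sub] sub, of ?B] inj linB
    by (auto simp: linear_conv_bounded_linear)
  have "\<bar>u \<bullet> \<phi>\<bar> \<le> (norm u / e) * norm (?B \<phi>)" for \<phi>
  proof -
    define a :: "('t, 'n) Uspace" where "a = (\<chi> k i j. (\<phi> $ k \<bullet> one_slice) / (one_slice \<bullet> (one_slice :: 'n slice)))"
    have ak: "a $ k = ((\<phi> $ k \<bullet> one_slice) / (one_slice \<bullet> (one_slice :: 'n slice))) *\<^sub>R one_slice" for k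
      by (simp add: a_def vec_eq_iff)
    have "\<phi> - a \<in> s" using N by (simp add: s_def inner_diff_left ak)
    have "cellW (?B a) c = 0" for c
      by (cases c) (simp add: cellW_adjoint_opB a_def Dh_const)
    then have "?B a = 0" by (intro Wspace_eqI) (simp add: cellW_def split: prod.split)
    then have B: "?B (\<phi> - a) = ?B \<phi>" by (simp add: linear_diff[OF linB])
    have "u \<bullet> a = 0" unfolding inner_vec_def[of u a] by (simp add: ak u)
    then have "\<bar>u \<bullet> \<phi>\<bar> = \<bar>u \<bullet> (\<phi> - a)\<bar>" by (simp add: inner_diff_right)
    also have "\<dots> \<le> norm u * norm (\<phi> - a)" by (rule Cauchy_Schwarz_ineq2)
    also have "\<dots> \<le> norm u * (norm (?B \<phi>) / e)"
      using e(2)[OF \<open>\<phi> - a \<in> s\<close>] e(1) by (intro mult_left_mono) (simp_all add: B field_simps)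
    finally show ?thesis by simp
  qed
  then show ?thesis using e(1) by (intro exI[of _ "norm u / e"]) auto
qed

text \<open>This rests on injectivity. If the adjoint of \<open>opB\<close> vanishes,
  \<open>\<phi>\<close> is constant in space; the adjoint of \<open>opA\<close> then makes
  consecutive levels equal, and the value zero at the final level propagates backwards.\<close>

lemma opA_opB_adjoint_bounded_below:
  assumes h: "h > 0" and dt: "dt > 0"
  shows "\<exists>e>0. \<forall>\<phi> :: ('t::finite, 'n::finite) Uspace.
    e * norm \<phi> \<le> (\<Sum>c\<in>UNIV. \<bar>cellM (adjoint (opA \<nu> h dt) \<phi>) c\<bar>) + norm (adjoint (opB h) \<phi>)"
proof -
  let ?A = "adjoint (opA \<nu> h dt) :: ('t, 'n) Uspace \<Rightarrow> ('t, 'n) Mspace"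
  let ?B = "adjoint (opB h) :: ('t, 'n) Uspace \<Rightarrow> ('t, 'n) Wspace"
  have linA: "linear ?A" and linB: "linear ?B"
    by (rule adjoint_linear[OF linear_opA], rule adjoint_linear[OF linear_opB])
  \<comment> \<open>\<open>mkM 0\<close> discards level 0, where the density is prescribed and
    offers no variation to test with.\<close>
  define L where "L \<phi> = (mkM 0 (cellM (?A \<phi>)), ?B \<phi>)" for \<phi>
  have linL: "linear L"
    by (rule linearI)
      (auto simp: L_def linear_add[OF linA] linear_add[OF linB] linear_scale[OF linA]
        linear_scale[OF linB] intro!: Mspace_eqI)
  have "\<phi> = 0" if "L \<phi> = 0" for \<phi>
  proof -
    have B0: "?B \<phi> = 0" and M0: "mkM 0 (cellM (?A \<phi>)) = 0" using that by (simp_all add: L_def zero_prod_def)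
    have A0: "cellM (?A \<phi>) c = 0" for c
    proof -
      have "cellM (?A \<phi>) c = cellM (mkM 0 (cellM (?A \<phi>))) c" by simp
      also have "\<dots> = 0" unfolding M0 by (simp add: cellM_def split: prod.split)
      finally show ?thesis .
    qed
    have c: "\<phi> $ k $ i $ j = \<phi> $ k $ 0 $ 0" for k i j by (rule adjoint_opB_eq_0_imp[OF B0 h])
    then have "\<phi> $ k = (\<chi> i j. \<phi> $ k $ 0 $ 0)" for k by (simp add: vec_eq_iff)
    then have Lap0: "Lap h (\<phi> $ k) = 0" for k by (metis Lap_const)
    have step: "\<phi> $ k $ i $ j = ext0 \<phi> $ next_level k $ i $ j" for k i j
      using A0[of "(k, i, j)"] dt by (simp add: cellM_def adjoint_opA_nth Lap0)
    have "ext0 \<phi> $ l = 0" for l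
    proof (induction l rule: level_back_induct)
      case (2 k) then show ?case using step[of k] by (simp add: vec_eq_iff)
    qed simp
    then have "\<phi> $ k = 0" for k by (metis ext0_level(1))
    then show ?thesis by (simp add: vec_eq_iff)
  qed
  then have "inj L" using linL by (simp add: linear_injective_0)
  obtain e where e: "e > 0" "\<And>\<phi>. e * norm \<phi> \<le> norm (L \<phi>)"
    using linear_inj_bounded_below_pos[OF linL \<open>inj L\<close>] by blast
  have "norm (L \<phi>) \<le> (\<Sum>c\<in>UNIV. \<bar>cellM (?A \<phi>) c\<bar>) + norm (?B \<phi>)" for \<phi>
    using norm_Pair_le[of "mkM 0 (cellM (?A \<phi>))" "?B \<phi>"] norm_mkM_le[of "cellM (?A \<phi>)"]
    by (simp add: L_def)
  then show ?thesis using e by (meson order_trans)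
qed

context mfg_grid begin

definition mean :: real where
  "mean = (r0 \<bullet> one_slice) / (one_slice \<bullet> (one_slice :: 'n slice))"

lemma mean_pos: "mean > 0"
  unfolding mean_def by (rule divide_pos_pos[OF mass_pos]) (simp add: inner_slice)

text \<open>The flux is pushed into the cone by adding a constant field, which the divergence does not see.\<close>

lemma slater:
  obtains \<kappa> W where "\<kappa> > 0" "\<And>\<phi>. \<exists>\<rho> w. \<rho> $ 0 = r0 \<and> (\<forall>c. mean / 2 \<le> cellM \<rho> c \<and> cellM \<rho> c \<le> 2 * mean)
    \<and> (\<forall>c. cellW w c \<in> Kcone \<and> norm (cellW w c) \<le> W) \<and> \<kappa> * norm \<phi> \<le> (A \<rho> + B w) \<bullet> \<phi>"
proof -
  have linA: "linear A" and linB: "linear B" by (rule linear_opA, rule linear_opB)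
  \<comment> \<open>This density carries the same mass at every level, so its image under
    \<open>A\<close> has mean zero at every step and is controlled by the adjoint of
    \<open>B\<close>.\<close>
  define \<rho>0 :: "('t, 'n) Mspace" where "\<rho>0 = mkM r0 (\<lambda>_. mean)"
  have \<rho>0: "\<rho>0 $ l \<bullet> one_slice = r0 \<bullet> one_slice" for l
  proof (cases "l = 0")
    case False
    then have "\<rho>0 $ l = mean *\<^sub>R one_slice" by (simp add: \<rho>0_def mkM_def vec_eq_iff)
    then show ?thesis by (simp add: mean_def inner_slice)
  qed (simp add: \<rho>0_def)
  have "A \<rho>0 $ k \<bullet> one_slice = 0" for k
    by (simp add: opA_nth inner_diff_left inner_scaleR_left mass_Lap \<rho>0)
  then obtain t0 where t0: "t0 \<ge> 0" "\<And>\<phi>. \<bar>A \<rho>0 \<bullet> \<phi>\<bar> \<le> t0 * norm (adjoint B \<phi>)"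
    using opB_adjoint_bounded_below[OF h_pos, of "A \<rho>0"] by blast
  obtain e where e: "e > 0" "\<And>\<phi>. e * norm \<phi> \<le> (\<Sum>c\<in>UNIV. \<bar>cellM (adjoint A \<phi>) c\<bar>) + norm (adjoint B \<phi>)"
    using opA_opB_adjoint_bounded_below[OF h_pos dt_pos] by blast
  \<comment> \<open>The part \<open>t0\<close> absorbs the contribution of \<open>\<rho>0\<close>;
    the extra 1 leaves a full \<open>norm b\<close>.\<close>
  define t where "t = t0 + 1"
  \<comment> \<open>Perturbing the mean by at most half of it keeps the density away from
    zero.\<close>
  define \<delta> where "\<delta> = mean / 2"
  \<comment> \<open>Added to a vector whose components have modulus at most 1, this moves it into
    \<open>Kcone\<close>.\<close>
  define e1 :: "real ^ 4" where "e1 = vector [1, -1, 1, -1]"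
  define \<kappa> where "\<kappa> = min \<delta> 1 * e"
  define W where "W = t + t * norm e1"
  have \<delta>: "\<delta> > 0" using mean_pos by (simp add: \<delta>_def)
  have t: "t > 0" using t0 by (simp add: t_def)
  show thesis
  proof (rule that[of \<kappa> W])
    show "\<kappa> > 0" using e \<delta> by (simp add: \<kappa>_def)
    fix \<phi> :: "('t, 'n) Uspace"
    define b where "b = adjoint B \<phi>"
    \<comment> \<open>Paired with the adjoint of \<open>A\<close> at \<open>\<phi>\<close>, the
      signs give the sum of its moduli; the normalised field \<open>n\<close> below gives
      \<open>norm b\<close> in the same way.\<close>
    define \<rho> where "\<rho> = \<rho>0 + \<delta> *\<^sub>R mkM 0 (\<lambda>c. sgn (cellM (adjoint A \<phi>) c))"
    define n where "n = (1 / norm b) *\<^sub>R b"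
    define w where "w = t *\<^sub>R n + mkW (\<lambda>_. t *\<^sub>R e1)"
    have "norm n \<le> 1" by (simp add: n_def)
    have cn: "norm (cellW n c) \<le> 1" for c
    proof -
      have "norm (cellW n c) \<le> norm n"
      proof -
        obtain k i j where "c = (k, i, j)" by (cases c)
        moreover have "norm (n $ k $ i $ j) \<le> norm (n $ k $ i)" by (rule Finite_Cartesian_Product.norm_nth_le)
        moreover have "norm (n $ k $ i) \<le> norm (n $ k)" by (rule Finite_Cartesian_Product.norm_nth_le)
        moreover have "norm (n $ k) \<le> norm n" by (rule Finite_Cartesian_Product.norm_nth_le)
        ultimately show ?thesis by (simp add: cellW_def)
      qed
      then show ?thesis using \<open>norm n \<le> 1\<close> by linarith
    qed
    have cc: "\<bar>cellW n c $ m\<bar> \<le> 1" for c m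
      using component_le_norm_cart[of "cellW n c" m] cn[of c] by linarith
    have cell_w: "cellW w c = t *\<^sub>R (cellW n c + e1)" for c
      by (simp add: w_def scaleR_add_right)
    have "cellW n c + e1 \<in> Kcone" for c
      using cc[of c 1] cc[of c 2] cc[of c 3] cc[of c 4]
      by (auto simp: Kcone_def e1_def vector_4 abs_le_iff)
    then have wK: "cellW w c \<in> Kcone" for c
      unfolding cell_w using t by (intro scaleR_in_Kcone) auto
    have wW: "norm (cellW w c) \<le> W" for c
    proof -
      have "norm (cellW w c) = t * norm (cellW n c + e1)" using t by (simp add: cell_w)
      also have "\<dots> \<le> t * (1 + norm e1)"
        using t cn[of c] norm_triangle_ineq[of "cellW n c" e1] by (intro mult_left_mono) auto
      finally show ?thesis by (simp add: W_def distrib_left)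
    qed
    have "n \<bullet> b = norm b"
      by (cases "b = 0") (simp_all add: n_def power2_norm_eq_inner[symmetric] power2_eq_square)
    moreover have "B (mkW (\<lambda>_. t *\<^sub>R e1)) = 0" by (rule opB_const)
    ultimately have Bw: "B w \<bullet> \<phi> = t * norm b"
      using adjoint_works[OF linB, of n \<phi>]
      by (simp add: w_def linear_add[OF linB] linear_scale[OF linB] b_def)
    have "A (mkM 0 (\<lambda>c. sgn (cellM (adjoint A \<phi>) c))) \<bullet> \<phi> = (\<Sum>c\<in>UNIV. \<bar>cellM (adjoint A \<phi>) c\<bar>)"
      unfolding adjoint_works[OF linA, symmetric] by (simp add: inner_Mspace mult_sgn_abs mult.commute linordered_idom_class.abs_sgn)
    then have "(A \<rho> + B w) \<bullet> \<phi> = A \<rho>0 \<bullet> \<phi> + \<delta> * (\<Sum>c\<in>UNIV. \<bar>cellM (adjoint A \<phi>) c\<bar>) + t * norm b"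
      by (simp add: \<rho>_def inner_add_left linear_add[OF linA] linear_scale[OF linA] Bw)
    also have "\<dots> \<ge> \<delta> * (\<Sum>c\<in>UNIV. \<bar>cellM (adjoint A \<phi>) c\<bar>) + norm b"
      using t0(2)[of \<phi>] by (simp add: t_def b_def distrib_right)
    also have "\<delta> * (\<Sum>c\<in>UNIV. \<bar>cellM (adjoint A \<phi>) c\<bar>) + norm b
        \<ge> min \<delta> 1 * (\<Sum>c\<in>UNIV. \<bar>cellM (adjoint A \<phi>) c\<bar>) + min \<delta> 1 * norm b"
      by (intro add_mono mult_right_mono) (auto simp: sum_nonneg mult_left_le_one_le min_le_iff_disj \<delta>[THEN less_imp_le])
    also have "min \<delta> 1 * (\<Sum>c\<in>UNIV. \<bar>cellM (adjoint A \<phi>) c\<bar>) + min \<delta> 1 * norm b \<ge> \<kappa> * norm \<phi>"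
      unfolding \<kappa>_def mult.assoc distrib_left[symmetric] b_def
      using e(2)[of \<phi>] \<delta> by (intro mult_left_mono) auto
    finally have main: "\<kappa> * norm \<phi> \<le> (A \<rho> + B w) \<bullet> \<phi>" .
    have "mean / 2 \<le> cellM \<rho> c \<and> cellM \<rho> c \<le> 2 * mean" for c
      using mean_pos by (simp add: \<rho>_def \<rho>0_def \<delta>_def sgn_if)
    then show "\<exists>\<rho> w. \<rho> $ 0 = r0 \<and> (\<forall>c. mean / 2 \<le> cellM \<rho> c \<and> cellM \<rho> c \<le> 2 * mean)
        \<and> (\<forall>c. cellW w c \<in> Kcone \<and> norm (cellW w c) \<le> W) \<and> \<kappa> * norm \<phi> \<le> (A \<rho> + B w) \<bullet> \<phi>"
      using wK wW main by (intro exI[of _ \<rho>] exI[of _ w]) (simp add: \<rho>_def \<rho>0_def)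
  qed
qed

lemma Psi_bounded: "\<exists>b. \<forall>c. \<forall>r\<in>{0..R}. \<bar>\<Psi> c r\<bar> \<le> b"
proof -
  have "\<exists>b. \<forall>r\<in>{0..R}. \<bar>\<Psi> c r\<bar> \<le> b" for c
  proof -
    have "compact (\<Psi> c ` {0..R})"
      by (intro compact_continuous_image continuous_on_subset[OF Psi_cont]) auto
    from compact_imp_bounded[OF this] obtain b where "\<forall>x\<in>\<Psi> c ` {0..R}. norm x \<le> b"
      unfolding bounded_iff by blast
    then show ?thesis by (intro exI[of _ b]) auto
  qed
  then obtain b where b: "\<And>c r. r \<in> {0..R} \<Longrightarrow> \<bar>\<Psi> c r\<bar> \<le> b c" by metis
  have "\<bar>\<Psi> c r\<bar> \<le> (\<Sum>c\<in>UNIV. \<bar>b c\<bar>)" if "r \<in> {0..R}" for c r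
    using b[OF that, of c] member_le_sum[of c UNIV "\<lambda>c. \<bar>b c\<bar>"] by simp
  then show ?thesis by blast
qed

text \<open>The energy sees the flux through its norm only; \<open>W *\<^sub>R axis 1 1\<close>
  serves as a vector of norm \<open>W\<close>.\<close>

lemma energy_le:
  assumes "0 \<le> \<eta>" "\<eta> \<le> R" "0 < m" "m \<le> r" "norm w \<le> W"
  shows "en \<eta> r w \<le> en R m (W *\<^sub>R axis 1 1)"
proof -
  have "W \<ge> 0" using assms(5) norm_ge_zero order_trans by blast
  define b where "b = \<beta> / (\<beta> - 1)"
  have "b > 1" using conj_exponents(1) by (simp add: b_def)
  then show ?thesis
    unfolding energy_def b_def[symmetric] using assms eps_pos alpha_pos \<open>W \<ge> 0\<close>
    by (intro frac_le mult_mono mult_left_mono powr_mono2) auto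
qed

section \<open>The truncated fixed-point problem\<close>

definition density_box :: "real \<Rightarrow> ('t, 'n) Mspace set" where
  "density_box R = {\<rho>. \<rho> $ 0 = r0 \<and> (\<forall>c. cellM \<rho> c \<in> {0..R})}"

lemma density_boxD: "\<rho> \<in> density_box R \<Longrightarrow> \<rho> $ 0 = r0"
  "\<rho> \<in> density_box R \<Longrightarrow> cellM \<rho> c \<in> {0..R}"
  unfolding density_box_def by blast+

lemma density_boxI: "\<rho> $ 0 = r0 \<Longrightarrow> (\<And>c. cellM \<rho> c \<in> {0..R}) \<Longrightarrow> \<rho> \<in> density_box R"
  unfolding density_box_def by blast

text \<open>With level 0 prescribed, bounds on the cells bound the whole density.\<close>

lemma compact_box:
  "compact (density_box R)"
  unfolding compact_eq_bounded_closed
proof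
  have "norm \<rho> \<le> norm r0 + real CARD(('t, 'n) cell) * R"
    if "\<rho> \<in> density_box R" for \<rho> :: "('t, 'n) Mspace"
  proof -
    have "\<rho> = mkM r0 (\<lambda>_. 0) + mkM 0 (cellM \<rho>)"
      using density_boxD(1)[OF that] by (intro Mspace_eqI) simp_all
    then have "norm \<rho> \<le> norm (mkM r0 (\<lambda>_. 0) :: ('t, 'n) Mspace) + norm (mkM 0 (cellM \<rho>))"
      by (metis norm_triangle_ineq)
    moreover have "norm (mkM r0 (\<lambda>_. 0) :: ('t, 'n) Mspace) = norm r0"
      by (simp add: norm_eq_sqrt_inner inner_Mspace)
    moreover have "(\<Sum>c\<in>UNIV. \<bar>cellM \<rho> c\<bar>) \<le> (\<Sum>c\<in>(UNIV :: ('t, 'n) cell set). R)"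
      using density_boxD(2)[OF that] by (intro sum_mono) (metis abs_of_nonneg atLeastAtMost_iff)
    ultimately show ?thesis using norm_mkM_le[of "cellM \<rho>"] by simp
  qed
  then show "bounded (density_box R)"
    unfolding bounded_iff by blast
  have "density_box R = {\<rho>. \<rho> $ 0 = r0} \<inter> (\<Inter>c. {\<rho>. 0 \<le> cellM \<rho> c} \<inter> {\<rho>. cellM \<rho> c \<le> R})"
    unfolding density_box_def by auto
  also have "closed \<dots>"
    by (intro closed_Int closed_INT closed_Collect_eq closed_Collect_le ballI continuous_intros)
  finally show "closed (density_box R)" .
qed

lemma convex_box: "convex (density_box R)"
proof (rule convexI)
  fix x y and u v :: real
  assume xy: "x \<in> density_box R" "y \<in> density_box R" and uv: "0 \<le> u" "0 \<le> v" "u + v = 1"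
  show "u *\<^sub>R x + v *\<^sub>R y \<in> density_box R"
  proof (rule density_boxI)
    show "(u *\<^sub>R x + v *\<^sub>R y) $ 0 = r0"
      using density_boxD(1)[OF xy(1)] density_boxD(1)[OF xy(2)] uv(3)
      by (simp flip: scaleR_add_left)
    fix c
    have "u *\<^sub>R cellM x c + v *\<^sub>R cellM y c \<in> {0..R}"
      by (rule convexD[OF convex_real_interval(5) density_boxD(2)[OF xy(1)] density_boxD(2)[OF xy(2)] uv])
    then show "cellM (u *\<^sub>R x + v *\<^sub>R y) c \<in> {0..R}" by simp
  qed
qed

text \<open>Density and multiplier are truncated to a compact set and found by Brouwer's theorem.  The
  Slater condition bounds the multiplier, so that its truncation is inactive and the constraint
  holds; conservation of mass then bounds the density, so that its truncation is inactive as well.\<close>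

lemma solution_exists: "\<exists>\<phi> \<rho> w. solves_I A B K \<phi> \<rho> w"
proof -
  have linA: "linear A" and linB: "linear B" by (rule linear_opA, rule linear_opB)
  \<comment> \<open>Large enough to admit the Slater densities, and beyond the total mass, which
    bounds every single value of a nonnegative density.\<close>
  define R where "R = 2 * mean + r0 \<bullet> one_slice + 1"
  have R: "R > 0" "2 * mean \<le> R" "r0 \<bullet> one_slice < R" using mean_pos mass_pos by (simp_all add: R_def)
  obtain \<kappa> W where \<kappa>: "\<kappa> > 0" and slater: "\<And>\<phi>. \<exists>\<rho> w. \<rho> $ 0 = r0
    \<and> (\<forall>c. mean / 2 \<le> cellM \<rho> c \<and> cellM \<rho> c \<le> 2 * mean)
    \<and> (\<forall>c. cellW w c \<in> Kcone \<and> norm (cellW w c) \<le> W) \<and> \<kappa> * norm \<phi> \<le> (A \<rho> + B w) \<bullet> \<phi>"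
    using slater by blast
  obtain b where b: "\<And>c r. r \<in> {0..R} \<Longrightarrow> \<bar>\<Psi> c r\<bar> \<le> b" using Psi_bounded by blast
  define e where "e = en R (mean / 2) (W *\<^sub>R axis 1 1)"
  \<comment> \<open>The comparison with the Slater point bounds
    \<open>\<kappa> * norm \<phi>\<close> by the number of cells times \<open>e + 2 * b\<close>; the
    1 makes the bound strict.\<close>
  define Q where "Q = real CARD(('t, 'n) cell) * (e + 2 * b) / \<kappa> + 1"
  have e0: "e \<ge> 0" unfolding e_def by (rule energy_nonneg)
  have b0: "b \<ge> 0" using b[of 0 undefined] R by (meson abs_ge_zero atLeastAtMost_iff less_imp_le order_refl order_trans)
  have Q: "Q > 0" unfolding Q_def using \<kappa> e0 b0 by (simp add: add_nonneg_pos)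
  define flux where "flux z = mkW (\<lambda>c. cellM (fst z) c *\<^sub>R vel (cellM (fst z) c) (cellW (adjoint B (snd z)) c))" for z
  \<comment> \<open>At a fixed point the subgradient condition holds on \<open>{0..R}\<close>, and
    the residual of the linear constraint satisfies a variational inequality on the ball.\<close>
  define f where "f z = (mkM r0 (\<lambda>c. prox R (\<Psi> c) (cellM (fst z) c + (cellM (adjoint A (snd z)) c
        + \<theta> (cellM (fst z) c) (cellW (adjoint B (snd z)) c)))),
      closest_point (cball 0 Q) (snd z - (A (fst z) + B (flux z))))" for z
  let ?S = "density_box R \<times> cball (0 :: ('t, 'n) Uspace) Q"
  have ball: "cball (0 :: ('t, 'n) Uspace) Q \<noteq> {}" using Q by simp
  have nnS: "0 \<le> cellM (fst z) c" if "z \<in> ?S" for z c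
    using density_boxD(2)[of "fst z" R c] that by auto
  have cM: "continuous_on ?S (\<lambda>z. cellM (fst z) c)" for c by (intro continuous_intros)
  have cA: "continuous_on ?S (\<lambda>z. cellM (adjoint A (snd z)) c)" for c
    by (intro continuous_on_cellM linear_continuous_on_compose[OF _ adjoint_linear[OF linA]]
        continuous_on_snd continuous_on_id)
  have cB: "continuous_on ?S (\<lambda>z. cellW (adjoint B (snd z)) c)" for c
    by (intro continuous_on_cellW linear_continuous_on_compose[OF _ adjoint_linear[OF linB]]
        continuous_on_snd continuous_on_id)
  have "continuous_on ?S flux"
    unfolding flux_def
    by (intro continuous_on_mkW continuous_on_scaleR cM continuous_on_vel[OF cM cB nnS])
  then have "continuous_on ?S (\<lambda>z. snd z - (A (fst z) + B (flux z)))"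
    by (intro continuous_on_diff continuous_on_add linear_continuous_on_compose[OF _ linA]
        linear_continuous_on_compose[OF _ linB] continuous_on_fst continuous_on_snd continuous_on_id)
  then have "continuous_on ?S (\<lambda>z. closest_point (cball 0 Q) (snd z - (A (fst z) + B (flux z))))"
    by (rule continuous_on_compose2[OF continuous_on_closest_point[OF convex_cball closed_cball ball, of UNIV]])
      simp
  moreover have "continuous_on ?S (\<lambda>z. mkM r0 (\<lambda>c. prox R (\<Psi> c) (cellM (fst z) c + (cellM (adjoint A (snd z)) c
        + \<theta> (cellM (fst z) c) (cellW (adjoint B (snd z)) c)))))"
    by (intro continuous_on_mkM continuous_on_prox[OF Psi_convex Psi_cont R(1)] continuous_on_add
        cM cA continuous_on_theta[OF cM cB nnS])
  ultimately have cont: "continuous_on ?S f"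
    unfolding f_def by (intro continuous_on_Pair)
  have maps: "f \<in> ?S \<rightarrow> ?S"
  proof
    fix z assume "z \<in> ?S"
    have "prox R (\<Psi> c) x \<in> {0..R}" for c x
      using prox_subgrad[OF Psi_convex Psi_cont R(1)] unfolding subgrad_on_def by blast
    then show "f z \<in> ?S"
      unfolding f_def
      by (intro SigmaI density_boxI closest_point_in_set[OF closed_cball ball]) simp_all
  qed
  have "mkM r0 (\<lambda>_. 0) \<in> density_box R" using R(1) by (intro density_boxI) simp_all
  then have ne: "?S \<noteq> {}" using ball by blast
  obtain z where z: "z \<in> ?S" "f z = z"
    using brouwer[OF compact_Times[OF compact_box compact_cball] convex_Times[OF convex_box convex_cball]
        ne cont maps] by blast
  define \<rho> \<phi> where "\<rho> = fst z" and "\<phi> = snd z"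
  define w where "w = flux z"
  define a p where "a = adjoint A \<phi>" and "p = adjoint B \<phi>"
  define u where "u = A \<rho> + B w"
  have \<rho>: "\<rho> \<in> density_box R" using z(1) by (auto simp: \<rho>_def mem_Times_iff)
  note r0 = density_boxD(1)[OF \<rho>]
  have nn: "0 \<le> cellM \<rho> c" for c using density_boxD(2)[OF \<rho>, of c] by simp
  have w: "cellW w c = cellM \<rho> c *\<^sub>R vel (cellM \<rho> c) (cellW p c)" for c
    by (simp add: w_def flux_def \<rho>_def p_def \<phi>_def)
  have fz: "mkM r0 (\<lambda>c. prox R (\<Psi> c) (cellM \<rho> c + (cellM a c + \<theta> (cellM \<rho> c) (cellW p c)))) = \<rho>"
    "closest_point (cball 0 Q) (\<phi> - u) = \<phi>"
    using z(2) by (simp_all add: f_def \<rho>_def \<phi>_def a_def p_def u_def w_def prod_eq_iff)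
  have sub: "subgrad_on {0..R} (\<Psi> c) (cellM \<rho> c) (cellM a c + \<theta> (cellM \<rho> c) (cellW p c))" for c
  proof -
    have "prox R (\<Psi> c) (cellM \<rho> c + (cellM a c + \<theta> (cellM \<rho> c) (cellW p c))) = cellM \<rho> c"
      using arg_cong[OF fz(1), of "\<lambda>M. cellM M c"] by simp
    then show ?thesis
      using prox_subgrad[OF Psi_convex[of c] Psi_cont[of c] R(1), of "cellM \<rho> c + (cellM a c + \<theta> (cellM \<rho> c) (cellW p c))"]
      by simp
  qed
  have proj: "0 \<le> u \<bullet> (y - \<phi>)" if "norm y \<le> Q" for y
    using closest_point_dot[OF convex_cball closed_cball, of y 0 Q "\<phi> - u"] that by (simp add: fz(2))
  obtain \<rho>' w' where s: "\<rho>' $ 0 = r0" "\<And>c. mean / 2 \<le> cellM \<rho>' c" "\<And>c. cellM \<rho>' c \<le> 2 * mean"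
    "\<And>c. cellW w' c \<in> Kcone" "\<And>c. norm (cellW w' c) \<le> W" "\<kappa> * norm \<phi> \<le> (A \<rho>' + B w') \<bullet> \<phi>"
    using slater[of \<phi>] by blast
  have \<rho>'R: "cellM \<rho>' c \<in> {0..R}" for c using s(2)[of c] s(3)[of c] R mean_pos by simp
  \<comment> \<open>Optimality of the cell, tested with the Slater point; the energy at the fixed
    point is dropped because it is nonnegative.\<close>
  have cell: "cellM a c * (cellM \<rho>' c - cellM \<rho> c) + cellW p c \<bullet> (cellW w' c - cellW w c) \<le> e + 2 * b" for c
  proof -
    have dom: "energy_dom (cellM \<rho>' c) (cellW w' c)"
      using s(2)[of c] s(4)[of c] mean_pos by (simp add: energy_dom_def)
    have "{0..R} \<subseteq> {0..}" by auto
    from cell_subdifferential_iff[OF nn this, THEN iffD2, OF conjI[OF w sub], THEN conjunct2, THEN conjunct2]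
    have "en (cellM \<rho> c) (cellM \<rho> c) (cellW w c) + \<Psi> c (cellM \<rho> c)
        + (cellM a c * (cellM \<rho>' c - cellM \<rho> c) + cellW p c \<bullet> (cellW w' c - cellW w c))
        \<le> en (cellM \<rho> c) (cellM \<rho>' c) (cellW w' c) + \<Psi> c (cellM \<rho>' c)"
      using \<rho>'R dom by blast
    moreover have "0 \<le> en (cellM \<rho> c) (cellM \<rho> c) (cellW w c)" by (rule energy_nonneg)
    moreover have "en (cellM \<rho> c) (cellM \<rho>' c) (cellW w' c) \<le> e"
      unfolding e_def using nn density_boxD(2)[OF \<rho>, of c] s(2,5) mean_pos by (intro energy_le) auto
    ultimately show ?thesis
      using b[OF density_boxD(2)[OF \<rho>], of c c] b[OF \<rho>'R, of c c] by linarith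
  qed
  \<comment> \<open>This sign allows the residual to be subtracted, so that only differences from
    the Slater point remain, to which the cell inequalities apply.\<close>
  have "u \<bullet> \<phi> \<le> 0" using proj[of 0] Q by simp
  have "\<kappa> * norm \<phi> \<le> (A \<rho>' + B w') \<bullet> \<phi>" by (rule s(6))
  also have "\<dots> \<le> (A \<rho>' + B w') \<bullet> \<phi> - u \<bullet> \<phi>" using \<open>u \<bullet> \<phi> \<le> 0\<close> by simp
  also have "\<dots> = A (\<rho>' - \<rho>) \<bullet> \<phi> + B (w' - w) \<bullet> \<phi>"
    by (simp add: u_def linear_diff[OF linA] linear_diff[OF linB] inner_simps)
  also have "\<dots> = (\<rho>' - \<rho>) \<bullet> a + (w' - w) \<bullet> p"
    by (simp add: a_def p_def adjoint_works[OF linA] adjoint_works[OF linB])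
  also have "\<dots> = (\<Sum>c\<in>UNIV. cellM a c * (cellM \<rho>' c - cellM \<rho> c) + cellW p c \<bullet> (cellW w' c - cellW w c))"
    by (simp add: inner_Mspace inner_Wspace s(1) r0 sum.distrib mult.commute inner_commute)
  also have "\<dots> \<le> (\<Sum>c\<in>(UNIV :: ('t, 'n) cell set). e + 2 * b)" by (rule sum_mono) (rule cell)
  finally have "\<kappa> * norm \<phi> \<le> real CARD(('t, 'n) cell) * (e + 2 * b)" by simp
  then have "norm \<phi> \<le> real CARD(('t, 'n) cell) * (e + 2 * b) / \<kappa>"
    using \<kappa> by (metis mult.commute pos_le_divide_eq)
  then have "norm \<phi> < Q" unfolding Q_def by linarith
  then have u0: "u = 0" using proj by (rule inward_normal_eq_0)
  have "cellM \<rho> c < R" for c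
  proof -
    obtain k i j where c: "c = (k, i, j)" by (cases c)
    have pos: "0 \<le> \<rho> $ l $ i $ j" for l i j using nonneg_iff[OF r0] nn by blast
    have "\<rho> $ next_level k $ i $ j \<le> (\<Sum>j\<in>UNIV. \<rho> $ next_level k $ i $ j)"
      by (rule member_le_sum) (use pos in auto)
    also have "\<dots> \<le> (\<Sum>i\<in>UNIV. \<Sum>j\<in>UNIV. \<rho> $ next_level k $ i $ j)"
      by (rule member_le_sum[of i UNIV "\<lambda>i. \<Sum>j\<in>UNIV. \<rho> $ next_level k $ i $ j"])
        (use pos in \<open>auto intro: sum_nonneg\<close>)
    also have "\<dots> = r0 \<bullet> one_slice"
      using mass_conserved[OF u0[unfolded u_def] dt_pos, of "next_level k"] by (simp add: inner_slice r0)
    finally show ?thesis using R(3) by (simp add: c cellM_def)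
  qed
  then have "cell_cond \<rho> w a p c" for c
    unfolding cell_cond_def using w subgrad_on_extend[OF Psi_convex sub] by blast
  then show ?thesis
    using r0 u0 unfolding solves_I_iff u_def a_def p_def by blast
qed

end

section \<open>Cell averages\<close>

lemma negligible_support_if_integral_eq_0:
  fixes f :: "'a::euclidean_space \<Rightarrow> real"
  assumes f: "f integrable_on S" and nonneg: "\<And>x. 0 \<le> f x" and int: "integral S f = 0"
  shows "negligible {x \<in> S. f x \<noteq> 0}"
proof -
  have a: "f absolutely_integrable_on S"
    by (rule nonnegative_absolutely_integrable_1[OF f nonneg])
  then have "(LINT x|lebesgue. indicator S x *\<^sub>R f x) = 0"
    using set_lebesgue_integral_eq_integral(2)[OF a] int by (simp add: set_lebesgue_integral_def)
  then have "AE x in lebesgue. indicator S x *\<^sub>R f x = 0"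
    using integral_nonneg_eq_0_iff_AE[of lebesgue "\<lambda>x. indicator S x *\<^sub>R f x"] a nonneg
    by (simp add: set_integrable_def)
  then obtain N where N: "{x \<in> space lebesgue. \<not> (indicator S x *\<^sub>R f x = 0)} \<subseteq> N" "N \<in> null_sets lebesgue"
    by (auto elim!: AE_E simp: null_sets_def)
  have "{x \<in> S. f x \<noteq> 0} \<subseteq> N" using N(1) by (auto simp: indicator_def)
  then show ?thesis using N(2) negligible_iff_null_sets negligible_subset by blast
qed

lemma torus_periodic_minus:
  assumes "torus_periodic r" "m \<in> {0, 1}" "n \<in> {0, 1 :: real}"
  shows "r (x - (m, n)) = r x"
proof -
  have p: "r (x + (1, 0)) = r x" "r (x + (0, 1)) = r x" for x
    using assms(1) unfolding torus_periodic_def by blast+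
  have 1: "r (x - (1, 0)) = r x" for x using p(1)[of "x - (1, 0)"] by simp
  have 2: "r (x - (0, 1)) = r x" for x using p(2)[of "x - (0, 1)"] by simp
  have "x - (1, 1) = x - (1, 0) - (0, 1)" by (cases x) simp
  then have "r (x - (1, 1)) = r x" by (simp only: 1 2)
  then show ?thesis using assms(2,3) 1[of x] 2[of x] by (auto simp: zero_prod_def[symmetric])
qed

lemma cell_eq_cbox:
  "{x :: real \<times> real. max \<bar>fst x - fst p\<bar> \<bar>snd x - snd p\<bar> \<le> d}
     = cbox (fst p - d, snd p - d) (fst p + d, snd p + d)"
  by (auto simp: cbox_Pair_eq abs_le_iff)

lemma cell_average_nonneg:
  assumes "\<forall>x. 0 \<le> r x"
  shows "0 \<le> cell_average h r $ i $ j"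
proof -
  \<comment> \<open>The integral of a function that is not integrable is 0 by convention, so the
    sign holds in either case.\<close>
  have "0 \<le> integral S r" for S
    using assms integral_nonneg[of r S] not_integrable_integral[of r S] by fastforce
  then show ?thesis by (simp add: cell_average_def)
qed

text \<open>Round \<open>x / h\<close> to the nearest integer. If this is \<open>CARD('n)\<close>,
  then \<open>x\<close> lies within half a cell of 1, and the shift \<open>m = 1\<close> takes it to
  the cell of index 0.\<close>

lemma grid_cover:
  fixes x h :: real
  assumes h: "h > 0" "1 / h = real CARD('n::finite)" and x: "0 \<le> x" "x \<le> 1"
  shows "\<exists>i :: 'n mod_ring. \<exists>m\<in>{0, 1}. \<bar>x - m - real_of_int (to_int_mod_ring i) * h\<bar> \<le> h / 2"
proof -
  define k where "k = \<lfloor>x / h + 1 / 2\<rfloor>"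
  have Nh: "real CARD('n) * h = 1" using h by (simp add: field_simps)
  have "real_of_int k \<le> x / h + 1 / 2" "x / h + 1 / 2 < real_of_int k + 1"
    unfolding k_def by linarith+
  then have d: "\<bar>x - real_of_int k * h\<bar> \<le> h / 2"
    using h(1) unfolding abs_le_iff by (simp add: field_simps)
  have "0 \<le> x / h" using x h by simp
  then have k0: "0 \<le> k" unfolding k_def by (simp add: le_floor_iff)
  have "x / h \<le> 1 / h" by (rule divide_right_mono) (use x h(1) in auto)
  then have "real_of_int k < real CARD('n) + 1"
    using \<open>real_of_int k \<le> x / h + 1 / 2\<close> h(2) by linarith
  then have kN: "k \<le> int CARD('n)" by linarith
  show ?thesis
  proof (cases "k < int CARD('n)")
    case True
    then have "to_int_mod_ring (of_int_mod_ring k :: 'n mod_ring) = k" using k0 by simp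
    then show ?thesis using d by (intro exI[of _ "of_int_mod_ring k"] bexI[of _ 0]) simp_all
  next
    case False
    then have "k = int CARD('n)" using kN by simp
    then have "real_of_int k * h = 1" using Nh by simp
    then show ?thesis using d by (intro exI[of _ 0] bexI[of _ 1]) simp_all
  qed
qed

text \<open>If all cell averages vanished, the density would vanish almost everywhere on the cells, whose
  integer translates cover the unit square.\<close>

lemma cell_average_mass_pos:
  assumes r: "torus_density r" and h: "h > 0" "1 / h = real CARD('n::finite)"
  shows "0 < (\<Sum>i\<in>UNIV. \<Sum>j\<in>UNIV. (cell_average h r :: 'n slice) $ i $ j)"
proof (rule ccontr)
  have per: "torus_periodic r" and nn: "\<And>x. 0 \<le> r x"
    and int: "r absolutely_integrable_on cbox (0, 0) (1, 1)" "integral (cbox (0, 0) (1, 1)) r = 1"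
    using r unfolding torus_density_def by blast+
  define cell where "cell i j = {x. max \<bar>fst x - fst (grid_point h i j)\<bar> \<bar>snd x - snd (grid_point h i j)\<bar> \<le> h / 2}"
    for i j :: "'n mod_ring"
  let ?c = "cell_average h r :: 'n slice"
  have nonneg: "0 \<le> ?c $ i $ j" for i j by (rule cell_average_nonneg) (simp add: nn)
  assume "\<not> 0 < (\<Sum>i\<in>UNIV. \<Sum>j\<in>UNIV. ?c $ i $ j)"
  then have "(\<Sum>i\<in>UNIV. \<Sum>j\<in>UNIV. ?c $ i $ j) = 0"
    using nonneg by (simp add: order_antisym sum_nonneg)
  then have "?c $ i $ j = 0" for i j
    using nonneg by (simp add: sum_nonneg_eq_0_iff sum_nonneg)
  then have zero: "integral (cell i j) r = 0" for i j
    using h(1) by (simp add: cell_average_def cell_def)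
  have Nh: "real CARD('n) * h = 1" using h by (simp add: field_simps)
  have h1: "h \<le> 1"
  proof -
    have "1 \<le> real CARD('n)" by (simp add: Suc_leI)
    then have "1 * h \<le> real CARD('n) * h" using h(1) by (intro mult_right_mono) auto
    then show ?thesis using Nh by simp
  qed
  \<comment> \<open>Cells of index 0 reach below 0 by \<open>h / 2\<close>, so integrability over
    the unit square must first be carried over to its translates by periodicity.\<close>
  have shift: "r absolutely_integrable_on cbox (- m, - n) (1 - m, 1 - n)" if "m \<in> {0, 1}" "n \<in> {0, 1}" for m n
  proof (rule nonnegative_absolutely_integrable_1[OF _ nn])
    have "(\<lambda>x. r (x + (m, n))) integrable_on cbox ((0, 0) - (m, n)) ((1, 1) - (m, n))"
      by (intro integrable_shift_cbox set_lebesgue_integral_eq_integral(1)[OF int(1)])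
    moreover have "r (x + (m, n)) = r x" for x
      using torus_periodic_minus[OF per that, of "x + (m, n)"] by simp
    ultimately show "r integrable_on cbox (- m, - n) (1 - m, 1 - n)" by simp
  qed
  have big: "r absolutely_integrable_on cbox (- 1, - 1) (1, 1)"
  proof -
    have "r absolutely_integrable_on (cbox (- 0, - 0) (1 - 0, 1 - 0) \<union> cbox (- 1, - 0) (1 - 1, 1 - 0))
        \<union> (cbox (- 0, - 1) (1 - 0, 1 - 1) \<union> cbox (- 1, - 1) (1 - 1, 1 - 1))"
      by (intro absolutely_integrable_Un shift) auto
    then show ?thesis
      by (rule set_integrable_subset) (simp, auto simp: cbox_Pair_eq)
  qed
  have "r integrable_on cell i j" for i j
  proof -
    have "0 \<le> real_of_int (to_int_mod_ring i) * h \<and> real_of_int (to_int_mod_ring i) * h \<le> 1 - h" for i :: "'n mod_ring"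
    proof -
      have "real_of_int (to_int_mod_ring i) \<le> real CARD('n) - 1"
        using to_int_mod_ring_bounds(2)[of i] by linarith
      then have "real_of_int (to_int_mod_ring i) * h \<le> (real CARD('n) - 1) * h"
        using h(1) by (intro mult_right_mono) auto
      then show ?thesis using Nh to_int_mod_ring_bounds(1)[of i] h(1) by (simp add: algebra_simps)
    qed
    from this[of i] this[of j] have "cell i j \<subseteq> cbox (- 1, - 1) (1, 1)"
      unfolding cell_def cell_eq_cbox cbox_Pair_eq using h(1) h1 by (auto simp: grid_point_def)
    moreover have "cell i j \<in> sets lebesgue" unfolding cell_def cell_eq_cbox by simp
    ultimately have "r absolutely_integrable_on cell i j" using set_integrable_subset[OF big] by blast
    then show ?thesis by (rule set_lebesgue_integral_eq_integral(1))
  qed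
  then have neg: "negligible {x \<in> cell i j. r x \<noteq> 0}" for i j
    using nn zero by (rule negligible_support_if_integral_eq_0)
  have "{x \<in> cbox (0, 0) (1, 1). r x \<noteq> 0} \<subseteq>
      (\<Union>i. \<Union>j. \<Union>m\<in>{0, 1}. \<Union>n\<in>{0, 1}. (+) (m, n) ` {x \<in> cell i j. r x \<noteq> 0})"
  proof
    fix x assume "x \<in> {x \<in> cbox (0, 0) (1, 1). r x \<noteq> 0}"
    then have x: "0 \<le> fst x" "fst x \<le> 1" "0 \<le> snd x" "snd x \<le> 1" "r x \<noteq> 0"
      by (auto simp: cbox_Pair_eq)
    obtain i :: "'n mod_ring" and m where i: "m \<in> {0, 1}" "\<bar>fst x - m - real_of_int (to_int_mod_ring i) * h\<bar> \<le> h / 2"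
      using grid_cover[OF h x(1,2)] by blast
    obtain j :: "'n mod_ring" and n where j: "n \<in> {0, 1}" "\<bar>snd x - n - real_of_int (to_int_mod_ring j) * h\<bar> \<le> h / 2"
      using grid_cover[OF h x(3,4)] by blast
    have "x - (m, n) \<in> {x \<in> cell i j. r x \<noteq> 0}"
      using i j x(5) torus_periodic_minus[OF per i(1) j(1), of x] by (simp add: cell_def grid_point_def)
    moreover have "x = (m, n) + (x - (m, n))" by simp
    ultimately show "x \<in> (\<Union>i. \<Union>j. \<Union>m\<in>{0, 1}. \<Union>n\<in>{0, 1}. (+) (m, n) ` {x \<in> cell i j. r x \<noteq> 0})"
      using i(1) j(1) by blast
  qed
  moreover have "negligible (\<Union>i. \<Union>j. \<Union>m\<in>{0, 1}. \<Union>n\<in>{0, 1}. (+) (m, n) ` {x \<in> cell i j. r x \<noteq> 0})"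
    by (intro negligible_Union finite_imageI) (auto intro!: negligible_Union negligible_translation neg)
  ultimately have "negligible {x \<in> cbox (0, 0) (1, 1). r x \<noteq> 0}" using negligible_subset by blast
  then have "integral (cbox (0, 0) (1, 1)) r = integral (cbox (0, 0) (1, 1)) (\<lambda>_ :: real \<times> real. 0)"
    by (rule integral_spike[where S = "{x \<in> cbox (0, 0) (1, 1). r x \<noteq> 0}"]) auto
  then show False using int(2) by simp
qed

section \<open>Convergence of the iteration\<close>

lemma primal_dual_pair_iff:
  "primal_dual_pair (opC \<nu> h dt) (opCstar \<nu> h dt) opM (opN h dt \<epsilon> \<beta> \<alpha> F G r0) \<phi> (\<rho>, w)
     \<longleftrightarrow> solves_I (opA \<nu> h dt) (opB h) (opK h dt \<epsilon> \<beta> \<alpha> F G r0) \<phi> \<rho> w"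
  unfolding primal_dual_pair_def solves_I_def opN_def sv_inverse_def opC_def opCstar_def opM_def
  by (simp add: neg_eq_iff_add_eq_0)

lemma solves_P_opM_iff: "solves_P C Cs opM N \<phi> \<longleftrightarrow> (\<exists>z. primal_dual_pair C Cs opM N \<phi> z)"
proof -
  have "opM \<phi> + Cs ` N (C \<phi>) = Cs ` N (C \<phi>)" by (auto simp: opM_def set_plus_def)
  then show ?thesis by (auto simp: solves_P_def primal_dual_pair_def opM_def)
qed

lemma linear_opC: "linear (opC \<nu> h dt)"
  by (rule linearI)
    (simp_all add: opC_def linear_add[OF adjoint_linear[OF linear_opA]] linear_add[OF adjoint_linear[OF linear_opB]]
      linear_scale[OF adjoint_linear[OF linear_opA]] linear_scale[OF adjoint_linear[OF linear_opB]])

lemma linear_opCstar: "linear (opCstar \<nu> h dt)"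
  by (rule linearI)
    (simp_all add: opCstar_def linear_add[OF linear_opA] linear_add[OF linear_opB]
      linear_scale[OF linear_opA] linear_scale[OF linear_opB] scaleR_add_right)

lemma opC_opCstar_adjoint: "opC \<nu> h dt \<phi> \<bullet> z = \<phi> \<bullet> opCstar \<nu> h dt z"
  using adjoint_works[OF linear_opA, of "fst z" \<nu> h dt \<phi>] adjoint_works[OF linear_opB, of "snd z" h \<phi>]
  by (cases z) (simp add: opC_def opCstar_def inner_commute inner_add_right)

lemma pdhg_iterates_exist:
  assumes "\<And>u. \<exists>x. resolvent \<sigma> K u = {x}"
  shows "\<exists>\<phi> \<rho> w. \<phi> 0 = \<phi>0 \<and> \<rho> 0 = \<rho>0 \<and> w 0 = w0 \<and> pdhg_iterates A B K \<tau> \<sigma> \<phi> \<rho> w"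
proof -
  obtain R where R: "\<And>u. resolvent \<sigma> K u = {R u}" using assms by metis
  define \<Phi> where "\<Phi> x = fst x - \<tau> *\<^sub>R (A (fst (snd x)) + B (snd (snd x)))" for x
  define step where "step x = (\<Phi> x, R (fst (snd x) + \<sigma> *\<^sub>R adjoint A (2 *\<^sub>R \<Phi> x - fst x),
    snd (snd x) + \<sigma> *\<^sub>R adjoint B (2 *\<^sub>R \<Phi> x - fst x)))" for x
  define s where "s n = (step ^^ n) (\<phi>0, \<rho>0, w0)" for n
  have s: "s 0 = (\<phi>0, \<rho>0, w0)" "s (Suc n) = step (s n)" for n by (simp_all add: s_def)
  have "pdhg_iterates A B K \<tau> \<sigma> (\<lambda>n. fst (s n)) (\<lambda>n. fst (snd (s n))) (\<lambda>n. snd (snd (s n)))"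
    unfolding pdhg_iterates_def Let_def R s(2) by (simp add: step_def \<Phi>_def)
  then show ?thesis
    by (intro exI[of _ "\<lambda>n. fst (s n)"] exI[of _ "\<lambda>n. fst (snd (s n))"] exI[of _ "\<lambda>n. snd (snd (s n))"])
      (simp add: s(1))
qed

context mfg_grid begin

lemma resolvent_K_singleton:
  assumes "\<sigma> > 0"
  shows "\<exists>x. resolvent \<sigma> K u = {x}"
proof -
  obtain x where "x \<in> resolvent \<sigma> K u" using resolvent_K_exists[OF assms] by blast
  then show ?thesis using resolvent_unique[OF monotone_K assms] by blast
qed

lemma pdhg_converges:
  assumes pos: "\<tau> > 0" "\<sigma> > 0"
    and step: "\<tau> * \<sigma> < 1 / (onorm (opC \<nu> h dt :: ('t, 'n) Uspace \<Rightarrow> ('t, 'n) Mspace \<times> ('t, 'n) Wspace))\<^sup>2"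
    and it: "pdhg_iterates A B K \<tau> \<sigma> \<phi>s \<rho>s ws"
  shows "\<exists>\<phi> \<rho> w. \<phi>s \<longlonglongrightarrow> \<phi> \<and> \<rho>s \<longlonglongrightarrow> \<rho> \<and> ws \<longlonglongrightarrow> w \<and> solves_I A B K \<phi> \<rho> w"
proof -
  obtain \<phi>' \<rho>' w' where "solves_I A B K \<phi>' \<rho>' w'" using solution_exists by blast
  then have sol: "opC \<nu> h dt \<phi>' \<in> K (\<rho>', w')" "opCstar \<nu> h dt (\<rho>', w') = 0"
    by (simp_all add: solves_I_def opC_def opCstar_def)
  have it1: "\<phi>s (Suc n) = \<phi>s n - \<tau> *\<^sub>R opCstar \<nu> h dt (\<rho>s n, ws n)" for n
    using it by (simp add: pdhg_iterates_def opCstar_def)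
  \<comment> \<open>The resolvent equation, solved for the element of \<open>K\<close>, as
    \<open>pdhg_convergence\<close> takes it.\<close>
  have it2: "((\<rho>s n, ws n) - (\<rho>s (Suc n), ws (Suc n))) /\<^sub>R \<sigma> + opC \<nu> h dt (2 *\<^sub>R \<phi>s (Suc n) - \<phi>s n)
      \<in> K (\<rho>s (Suc n), ws (Suc n))" for n
  proof -
    let ?c = "opC \<nu> h dt (2 *\<^sub>R \<phi>s (Suc n) - \<phi>s n)"
    have "resolvent \<sigma> K ((\<rho>s n, ws n) + \<sigma> *\<^sub>R ?c) = {(\<rho>s (Suc n), ws (Suc n))}"
      using spec[OF it[unfolded pdhg_iterates_def Let_def], of n, THEN conjunct2] by (simp add: opC_def)
    then have "(\<rho>s n, ws n) + \<sigma> *\<^sub>R ?c \<in> {(\<rho>s (Suc n), ws (Suc n)) + \<sigma> *\<^sub>R u | u. u \<in> K (\<rho>s (Suc n), ws (Suc n))}"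
      unfolding resolvent_def sv_inverse_def by blast
    then obtain u where u: "(\<rho>s n, ws n) + \<sigma> *\<^sub>R ?c = (\<rho>s (Suc n), ws (Suc n)) + \<sigma> *\<^sub>R u"
      "u \<in> K (\<rho>s (Suc n), ws (Suc n))" by blast
    have "x - y = \<sigma> *\<^sub>R (v - v')" if "x + \<sigma> *\<^sub>R v' = y + \<sigma> *\<^sub>R v" for x y v v' :: "('t, 'n) Mspace \<times> ('t, 'n) Wspace"
    proof -
      have "x - y = (x + \<sigma> *\<^sub>R v') - (y + \<sigma> *\<^sub>R v')" by simp
      also have "\<dots> = \<sigma> *\<^sub>R (v - v')" unfolding that by (simp add: scaleR_diff_right)
      finally show ?thesis .
    qed
    from this[OF u(1)] have "((\<rho>s n, ws n) - (\<rho>s (Suc n), ws (Suc n))) /\<^sub>R \<sigma> + ?c = u" using pos(2) by simp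
    then show ?thesis using u(2) by simp
  qed
  obtain \<phi> z where lim: "\<phi>s \<longlonglongrightarrow> \<phi>" "(\<lambda>n. (\<rho>s n, ws n)) \<longlonglongrightarrow> z" "opC \<nu> h dt \<phi> \<in> K z" "opCstar \<nu> h dt z = 0"
    by (rule pdhg_convergence[OF linear_opC opC_opCstar_adjoint linear_opCstar maximally_monotone_K
          pos step sol, where \<phi> = \<phi>s and z = "\<lambda>n. (\<rho>s n, ws n)", OF it1 it2])
  have "\<rho>s \<longlonglongrightarrow> fst z" "ws \<longlonglongrightarrow> snd z"
    using tendsto_fst[OF lim(2)] tendsto_snd[OF lim(2)] by simp_all
  moreover have "solves_I A B K \<phi> (fst z) (snd z)"
    using lim(3,4) by (simp add: solves_I_def opC_def opCstar_def)
  ultimately show ?thesis using lim(1) by blast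
qed

end

theorem theorem3p1:
  fixes T \<nu> h dt \<epsilon> \<beta> \<alpha> :: real
    and F f :: "real \<Rightarrow> real \<times> real \<Rightarrow> real \<Rightarrow> real"
    and G g :: "real \<times> real \<Rightarrow> real \<Rightarrow> real"
    and rho0 :: "real \<times> real \<Rightarrow> real"
  defines "A \<equiv> (opA \<nu> h dt :: ('t::finite, 'n::finite) Mspace \<Rightarrow> ('t, 'n) Uspace)"
    and "B \<equiv> (opB h :: ('t, 'n) Wspace \<Rightarrow> ('t, 'n) Uspace)"
    and "C \<equiv> (opC \<nu> h dt :: ('t, 'n) Uspace \<Rightarrow> ('t, 'n) Mspace \<times> ('t, 'n) Wspace)"
    and "Cs \<equiv> (opCstar \<nu> h dt :: ('t, 'n) Mspace \<times> ('t, 'n) Wspace \<Rightarrow> ('t, 'n) Uspace)"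
    and "r0 \<equiv> (cell_average h rho0 :: 'n slice)"
    and "M \<equiv> (opM :: ('t, 'n) Uspace \<Rightarrow> ('t, 'n) Uspace set)"
    and "K \<equiv> (opK h dt \<epsilon> \<beta> \<alpha> F G (cell_average h rho0) ::
           ('t, 'n) Mspace \<times> ('t, 'n) Wspace \<Rightarrow> (('t, 'n) Mspace \<times> ('t, 'n) Wspace) set)"
    and "N \<equiv> (opN h dt \<epsilon> \<beta> \<alpha> F G (cell_average h rho0) ::
           ('t, 'n) Mspace \<times> ('t, 'n) Wspace \<Rightarrow> (('t, 'n) Mspace \<times> ('t, 'n) Wspace) set)"
  assumes "T > 0" "\<nu> \<ge> 0"
    and "h > 0" "1 / h = real CARD('n)"
    and "dt > 0" "T / dt = real CARD('t)"
    and "\<epsilon> > 0" "1 < \<beta>" "\<beta> \<le> 2" "0 < \<alpha>" "\<alpha> \<le> 4 * (\<beta> - 1) / \<beta>"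
    and "torus_density rho0"
    and "\<forall>t\<in>{0..T}. \<forall>r\<ge>0. torus_periodic (\<lambda>x. F t x r)"
    and "\<forall>r\<ge>0. torus_periodic (\<lambda>x. G x r)"
    and "\<forall>t\<in>{0..T}. \<forall>x. convex_on {0..} (F t x) \<and> continuous_on {0..} (F t x)"
    and "\<forall>x. convex_on {0..} (G x) \<and> continuous_on {0..} (G x)"
  shows
    "(maximally_monotone M \<and> maximally_monotone N
      \<and> (\<forall>\<phi>. solves_P C Cs M N \<phi> \<longleftrightarrow> (\<exists>\<rho> w. solves_I A B K \<phi> \<rho> w))
      \<and> (\<forall>\<rho> w. solves_D C Cs M N (\<rho>, w) \<longleftrightarrow> (\<exists>\<phi>. solves_I A B K \<phi> \<rho> w)))
    \<and> (\<exists>\<phi> \<rho> w. solves_P C Cs M N \<phi> \<and> solves_D C Cs M N (\<rho>, w)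
        \<and> primal_dual_pair C Cs M N \<phi> (\<rho>, w))
    \<and> (\<nu> > 0 \<longrightarrow>
       (\<forall>t\<in>{0..T}. \<forall>x. \<forall>r>0. (F t x has_real_derivative f t x r) (at r)) \<longrightarrow>
       (\<forall>x. \<forall>r>0. (G x has_real_derivative g x r) (at r)) \<longrightarrow>
       (\<forall>\<phi> \<rho>. mfg_system \<nu> h dt \<epsilon> \<beta> \<alpha> f g r0 (extend_terminal h g \<rho> \<phi>) \<rho>
          \<longleftrightarrow> (\<exists>w. primal_dual_pair C Cs M N \<phi> (\<rho>, w))))
    \<and> (\<nu> > 0 \<longrightarrow>
       (\<forall>t\<in>{0..T}. \<forall>x. \<forall>r>0. (F t x has_real_derivative f t x r) (at r)) \<longrightarrow>
       (\<forall>x. \<forall>r>0. (G x has_real_derivative g x r) (at r)) \<longrightarrow>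
       (\<forall>\<tau> \<sigma>. \<tau> > 0 \<longrightarrow> \<sigma> > 0 \<longrightarrow> \<tau> * \<sigma> < 1 / (onorm C)\<^sup>2 \<longrightarrow>
          (\<forall>\<phi>0 \<rho>0 w0. \<exists>\<phi>s \<rho>s ws. \<phi>s 0 = \<phi>0 \<and> \<rho>s 0 = \<rho>0 \<and> ws 0 = w0
              \<and> pdhg_iterates A B K \<tau> \<sigma> \<phi>s \<rho>s ws)
          \<and> (\<forall>\<phi>s \<rho>s ws. pdhg_iterates A B K \<tau> \<sigma> \<phi>s \<rho>s ws \<longrightarrow>
              (\<exists>\<phi> \<rho> w. \<phi>s \<longlonglongrightarrow> \<phi> \<and> \<rho>s \<longlonglongrightarrow> \<rho> \<and> ws \<longlonglongrightarrow> w
                 \<and> mfg_system \<nu> h dt \<epsilon> \<beta> \<alpha> f g r0 (extend_terminal h g \<rho> \<phi>) \<rho>))))"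
proof -
  \<comment> \<open>The hypotheses on \<open>F\<close> speak of times in \<open>{0..T}\<close>, so
    the grid times must be located there.\<close>
  have tgrid: "grid_time dt (k :: 't mod_ring) \<in> {0..T}" for k
  proof -
    have "real_of_int (to_int_mod_ring k) * dt \<le> real CARD('t) * dt"
      using to_int_mod_ring_bounds(2)[of k] \<open>dt > 0\<close> by (intro mult_right_mono) linarith+
    also have "\<dots> = T" using \<open>T / dt = real CARD('t)\<close> \<open>dt > 0\<close> by (simp add: field_simps)
    finally show ?thesis
      using to_int_mod_ring_bounds(1)[of k] \<open>dt > 0\<close> by (simp add: grid_time_def)
  qed
  have Fc: "convex_on {0..} (F (grid_time dt (k :: 't mod_ring)) x)"
    "continuous_on {0..} (F (grid_time dt (k :: 't mod_ring)) x)" for k x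
    using assms(23) tgrid by blast+
  have Gc: "convex_on {0..} (G x)" "continuous_on {0..} (G x)" for x
    using assms(24) by blast+
  interpret mfg_grid \<epsilon> \<beta> \<alpha> \<nu> h dt F G "cell_average h rho0 :: 'n slice"
    "potential h dt F G :: ('t, 'n) cell \<Rightarrow> real \<Rightarrow> real"
  proof
    have "\<forall>x. 0 \<le> rho0 x" using \<open>torus_density rho0\<close> by (simp add: torus_density_def)
    then show "0 \<le> (cell_average h rho0 :: 'n slice) $ i $ j" for i j by (rule cell_average_nonneg)
    show "0 < (cell_average h rho0 :: 'n slice) \<bullet> one_slice"
      using cell_average_mass_pos[OF \<open>torus_density rho0\<close> \<open>h > 0\<close> \<open>1 / h = real CARD('n)\<close>]
      by (simp add: inner_slice)
    fix c :: "('t, 'n) cell"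
    obtain k i j where c: "c = (k, i, j)" by (cases c)
    have fin: "potential h dt F G c = (\<lambda>r. F (grid_time dt k) (grid_point h i j) r + 1 / dt * G (grid_point h i j) r)"
      if "next_level k = (final_level :: 't option mod_ring)" using that by (simp add: c potential_def)
    have nfin: "potential h dt F G c = F (grid_time dt k) (grid_point h i j)"
      if "next_level k \<noteq> (final_level :: 't option mod_ring)" using that by (simp add: c potential_def)
    have d: "0 \<le> 1 / dt" using \<open>dt > 0\<close> by simp
    have "convex_on {0..} (potential h dt F G c) \<and> continuous_on {0..} (potential h dt F G c)"
    proof (cases "next_level k = (final_level :: 't option mod_ring)")
      case True
      show ?thesis
        unfolding fin[OF True]
        by (intro conjI convex_on_add convex_on_cmul d continuous_on_add continuous_on_mult
            continuous_on_const Fc Gc)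
    next
      case False
      show ?thesis unfolding nfin[OF False] by (intro conjI Fc)
    qed
    then show "convex_on {0..} (potential h dt F G c)" "continuous_on {0..} (potential h dt F G c)"
      by blast+
  qed (use assms in simp_all)
  have pd: "primal_dual_pair C Cs M N \<phi> (\<rho>, w) \<longleftrightarrow> solves_I A B K \<phi> \<rho> w" for \<phi> \<rho> w
    unfolding assms by (rule primal_dual_pair_iff)
  have P: "solves_P C Cs M N \<phi> \<longleftrightarrow> (\<exists>\<rho> w. solves_I A B K \<phi> \<rho> w)" for \<phi>
    unfolding pd[symmetric] unfolding assms solves_P_opM_iff by (simp add: split_paired_Ex)
  have D: "solves_D C Cs M N (\<rho>, w) \<longleftrightarrow> (\<exists>\<phi>. solves_I A B K \<phi> \<rho> w)" for \<rho> w
    unfolding solves_D_def pd ..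
  have max: "maximally_monotone M" "maximally_monotone N"
    unfolding assms opN_def
    by (rule maximally_monotone_opM, rule maximally_monotone_sv_inverse[OF maximally_monotone_K])
  have ex: "\<exists>\<phi> \<rho> w. solves_I A B K \<phi> \<rho> w" unfolding assms by (rule solution_exists)
  have S: "mfg_system \<nu> h dt \<epsilon> \<beta> \<alpha> f g r0 (extend_terminal h g \<rho> \<phi>) \<rho> \<longleftrightarrow> (\<exists>w. solves_I A B K \<phi> \<rho> w)"
    if "\<nu> > 0" "\<forall>t\<in>{0..T}. \<forall>x. \<forall>r>0. (F t x has_real_derivative f t x r) (at r)"
      "\<forall>x. \<forall>r>0. (G x has_real_derivative g x r) (at r)" for \<phi> \<rho>
    unfolding assms by (rule mfg_system_iff) (use that tgrid in blast)+
  have conv: "\<exists>\<phi> \<rho> w. \<phi>s \<longlonglongrightarrow> \<phi> \<and> \<rho>s \<longlonglongrightarrow> \<rho> \<and> ws \<longlonglongrightarrow> w \<and> solves_I A B K \<phi> \<rho> w"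
    if "\<tau> > 0" "\<sigma> > 0" "\<tau> * \<sigma> < 1 / (onorm C)\<^sup>2" "pdhg_iterates A B K \<tau> \<sigma> \<phi>s \<rho>s ws" for \<tau> \<sigma> \<phi>s \<rho>s ws
    using that unfolding assms by (rule pdhg_converges)
  have iter: "\<exists>\<phi>s \<rho>s ws. \<phi>s 0 = \<phi>0 \<and> \<rho>s 0 = \<rho>0 \<and> ws 0 = w0 \<and> pdhg_iterates A B K \<tau> \<sigma> \<phi>s \<rho>s ws"
    if "\<sigma> > 0" for \<tau> \<sigma> \<phi>0 \<rho>0 w0
    unfolding assms by (rule pdhg_iterates_exist[OF resolvent_K_singleton[OF that]])
  show ?thesis
  proof (intro conjI impI allI)
    show "\<exists>\<phi> \<rho> w. solves_P C Cs M N \<phi> \<and> solves_D C Cs M N (\<rho>, w) \<and> primal_dual_pair C Cs M N \<phi> (\<rho>, w)"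
      unfolding P D pd using ex by blast
  next
    fix \<phi> \<rho>
    assume "\<nu> > 0" "\<forall>t\<in>{0..T}. \<forall>x. \<forall>r>0. (F t x has_real_derivative f t x r) (at r)"
      "\<forall>x. \<forall>r>0. (G x has_real_derivative g x r) (at r)"
    then show "mfg_system \<nu> h dt \<epsilon> \<beta> \<alpha> f g r0 (extend_terminal h g \<rho> \<phi>) \<rho>
        \<longleftrightarrow> (\<exists>w. primal_dual_pair C Cs M N \<phi> (\<rho>, w))"
      unfolding pd by (rule S)
  next
    fix \<tau> \<sigma> \<phi>s \<rho>s ws
    assume a: "\<nu> > 0" "\<forall>t\<in>{0..T}. \<forall>x. \<forall>r>0. (F t x has_real_derivative f t x r) (at r)"
      "\<forall>x. \<forall>r>0. (G x has_real_derivative g x r) (at r)"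
      "\<tau> > 0" "\<sigma> > 0" "\<tau> * \<sigma> < 1 / (onorm C)\<^sup>2" "pdhg_iterates A B K \<tau> \<sigma> \<phi>s \<rho>s ws"
    show "\<exists>\<phi> \<rho> w. \<phi>s \<longlonglongrightarrow> \<phi> \<and> \<rho>s \<longlonglongrightarrow> \<rho> \<and> ws \<longlonglongrightarrow> w
        \<and> mfg_system \<nu> h dt \<epsilon> \<beta> \<alpha> f g r0 (extend_terminal h g \<rho> \<phi>) \<rho>"
      using conv[OF a(4-7)] S[OF a(1-3)] by blast
  qed (use max P D iter in \<open>simp_all\<close>)
qed

end
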